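(* Let $k_0>0$ and $r_M>r_s>0$. Let $f\in L^2(\mathbb{R}^2)$ (complex-valued) with $\operatorname{supp}(f)\subset\mathcal{B}_{r_s}$, and let $a\in L^2(\mathbb{S}^1)$ (complex-valued). Let $u^{\mathrm{inc}}(\mathbf r)=\int_{\mathbb{S}^1}a(\mathbf s)e^{ik_0\mathbf r\cdot\mathbf s}\,ds$ for $\mathbf{r}\in\mathbb{R}^2$, and let $$u(\mathbf r)=\int_{\mathbb{R}^2}G(\mathbf r-\mathbf r')f(\mathbf r')u^{\mathrm{inc}}(\mathbf r')\,d\mathbf r',\qquad \mathbf r\in\mathbb{R}^2,\qquad G(\mathbf r)=\frac{i}{4}H_0^{(1)}(k_0\|\mathbf r\|).$$ Write $u|_{r_2=r_M}$ for the function $x\mapsto u(x,r_M)$ on $\mathbb{R}$. Then, for $k\in(-k_0,k_0)$, $$\mathcal{F}\big(u|_{r_2=r_M}\big)(k)=\sqrt{\frac{\pi}{2}}\,\frac{i\,e^{i\kappa(k)r_M}}{\kappa(k)}\int_{\mathbb{S}^1}a(\mathbf s)\,\mathcal{F}f\big(\mathbf h(k)-k_0\mathbf s\big)\,ds .$$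
   Context: $\mathcal{B}_{r_s}=\{\mathbf r\in\mathbb{R}^2:\|\mathbf r\|<r_s\}$; $\mathbb{S}^1$ is the unit circle in $\mathbb{R}^2$ and $ds$ is the standard line element (arc length) on it. $H_0^{(1)}$ is the zeroth order Hankel function of the first kind, so $G$ is the outgoing fundamental solution of the Helmholtz equation and $u$ is the outgoing solution of $(\Delta+k_0^2)u=-f\,u^{\mathrm{inc}}$ (the Born approximation of the scattered wave). For $k\in(-k_0,k_0)$: $\kappa(k)=\sqrt{k_0^2-k^2}$ and $\mathbf h(k)=(k,\kappa(k))^\intercal\in\mathbb{R}^2$. The $N$-dimensional Fourier transform is $\mathcal F\phi(\mathbf k)=(2\pi)^{-N/2}\int_{\mathbb{R}^N}\phi(\mathbf r)e^{-i\mathbf k\cdot\mathbf r}\,d\mathbf r$; on the right-hand side $N=2$, on the left-hand side $N=1$. The Fourier transform on the left-hand side is in general that of a tempered distribution ($u|_{r_2=r_M}$ is bounded and smooth), defined by $\mathcal{F}w[\phi]=w[\mathcal F\phi]$ for Schwartz functions $\phi$. The asserted equality for $k\in(-k_0,k_0)$ means that the restriction of the distribution $\mathcal{F}(u|_{r_2=r_M})$ to the open interval $(-k_0,k_0)$ (i.e. tested against $\phi\in C_c^\infty(\mathbb{R})$ with support in $(-k_0,k_0)$) is given by the function on the right-hand side. *)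

theory Defs
  imports "HOL-Analysis.Analysis"
begin

text \<open>
  The plane is \<^typ>\<open>real \<times> real\<close>, whose norm, inner product and Lebesgue measure are the
  Euclidean ones.
\<close>

definition square_integrable :: "'a measure \<Rightarrow> ('a \<Rightarrow> complex) \<Rightarrow> bool" where
  "square_integrable M f \<longleftrightarrow>
     f \<in> borel_measurable M \<and> integrable M (\<lambda>x. (norm (f x))\<^sup>2)"

text \<open>
  Support of a class of functions modulo null sets: the complement of the largest open set on
  which the function vanishes almost everywhere.
\<close>

definition ess_support :: "('a::euclidean_space \<Rightarrow> complex) \<Rightarrow> 'a set" where
  "ess_support f = {x. \<forall>U. open U \<and> x \<in> U \<longrightarrow> \<not> (AE y in lebesgue. y \<in> U \<longrightarrow> f y = 0)}"

text \<open>
  Arc length on the unit circle, obtained from the unit speed parametrisation. It is completed,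
  so that functions on the circle need only be measurable in the sense of Lebesgue; the
  underlying space is the circle, hence values of a function off the circle are irrelevant.
\<close>

definition arc_length :: "(real \<times> real) measure" where
  "arc_length = completion
     (distr (restrict_space lborel {0..<2 * pi}) (restrict_space borel (sphere 0 1))
        (\<lambda>t. (cos t, sin t)))"

definition fourier :: "('a::euclidean_space \<Rightarrow> complex) \<Rightarrow> 'a \<Rightarrow> complex" where
  "fourier \<phi> k = of_real ((2 * pi) powr (- real DIM('a) / 2)) *
     (\<integral>r. \<phi> r * exp (- (\<i> * of_real (k \<bullet> r))) \<partial>lebesgue)"

text \<open>
  The Bessel functions of order zero by their classical series; the one for the second kind
  (Watson, 3.51; DLMF 10.8.2) is meant for positive arguments only.
\<close>

definition bessel_J0 :: "real \<Rightarrow> real" where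
  "bessel_J0 x = (\<Sum>m. (-1) ^ m * (x / 2) ^ (2 * m) / (fact m)\<^sup>2)"

definition bessel_Y0 :: "real \<Rightarrow> real" where
  "bessel_Y0 x =
     2 / pi * (ln (x / 2) + euler_mascheroni) * bessel_J0 x
     - 2 / pi * (\<Sum>m. (-1) ^ m * harm m * (x / 2) ^ (2 * m) / (fact m)\<^sup>2)"

definition hankel1_0 :: "real \<Rightarrow> complex" where
  "hankel1_0 x = of_real (bessel_J0 x) + \<i> * of_real (bessel_Y0 x)"

text \<open>The value at the origin is meaningless, but irrelevant under an integral.\<close>

definition helmholtz_G :: "real \<Rightarrow> real \<times> real \<Rightarrow> complex" where
  "helmholtz_G k0 r = \<i> / 4 * hankel1_0 (k0 * norm r)"

definition incident_field :: "real \<Rightarrow> (real \<times> real \<Rightarrow> complex) \<Rightarrow> real \<times> real \<Rightarrow> complex" where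
  "incident_field k0 a r = (\<integral>s. a s * exp (\<i> * of_real (k0 * (r \<bullet> s))) \<partial>arc_length)"

definition born_field ::
  "real \<Rightarrow> (real \<times> real \<Rightarrow> complex) \<Rightarrow> (real \<times> real \<Rightarrow> complex) \<Rightarrow> real \<times> real \<Rightarrow> complex" where
  "born_field k0 f a r =
     (\<integral>r'. helmholtz_G k0 (r - r') * f r' * incident_field k0 a r' \<partial>lebesgue)"

definition kappa :: "real \<Rightarrow> real \<Rightarrow> real" where
  "kappa k0 k = sqrt (k0\<^sup>2 - k\<^sup>2)"

definition h_vec :: "real \<Rightarrow> real \<Rightarrow> real \<times> real" where
  "h_vec k0 k = (k, kappa k0 k)"

definition smooth :: "(real \<Rightarrow> complex) \<Rightarrow> bool" where
  "smooth \<phi> \<longleftrightarrow>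
     (\<exists>D. D 0 = \<phi> \<and> (\<forall>n x. (D n has_vector_derivative D (Suc n) x) (at x)))"

definition test_function :: "real set \<Rightarrow> (real \<Rightarrow> complex) \<Rightarrow> bool" where
  "test_function S \<phi> \<longleftrightarrow>
     smooth \<phi> \<and> compact (closure {x. \<phi> x \<noteq> 0}) \<and> closure {x. \<phi> x \<noteq> 0} \<subseteq> S"

text \<open>
  Measurable functions of at most polynomial growth; these define tempered distributions.
\<close>

definition slowly_growing :: "(real \<Rightarrow> complex) \<Rightarrow> bool" where
  "slowly_growing w \<longleftrightarrow>
     w \<in> borel_measurable lebesgue \<and> (\<exists>C N. \<forall>x. norm (w x) \<le> C * (1 + \<bar>x\<bar>) ^ N)"

text \<open>
  Distributions are represented by functionals, which are applied to Schwartz functions only.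
\<close>

definition regular_distribution :: "(real \<Rightarrow> complex) \<Rightarrow> (real \<Rightarrow> complex) \<Rightarrow> complex" where
  "regular_distribution w \<phi> = (\<integral>x. w x * \<phi> x \<partial>lebesgue)"

definition fourier_distribution ::
  "((real \<Rightarrow> complex) \<Rightarrow> complex) \<Rightarrow> (real \<Rightarrow> complex) \<Rightarrow> complex" where
  "fourier_distribution T \<phi> = T (fourier \<phi>)"

text \<open>The restriction of \<open>T\<close> to the open set \<open>S\<close> is given by the function \<open>g\<close>.\<close>

definition given_by_on ::
  "((real \<Rightarrow> complex) \<Rightarrow> complex) \<Rightarrow> real set \<Rightarrow> (real \<Rightarrow> complex) \<Rightarrow> bool" where
  "given_by_on T S g \<longleftrightarrow>
     (\<forall>K. compact K \<and> K \<subseteq> S \<longrightarrow> set_integrable lebesgue K g) \<and>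
     (\<forall>\<phi>. test_function S \<phi> \<longrightarrow> T \<phi> = (LINT x:S|lebesgue. g x * \<phi> x))"

end

theory Submission
  imports Defs "HOL-Probability.Characteristic_Functions" "HOL-Real_Asymp.Real_Asymp"
begin

text \<open>
  Everything rests on Weyl's decomposition of the outgoing fundamental solution into plane waves
  (\<open>hankel_weyl\<close>): for \<open>y > 0\<close>,
  \<open>\<pi> H\<^sub>0(\<surd>(x\<^sup>2 + y\<^sup>2)) = A(x, y) - \<i> B(x, y)\<close>, where
  \<open>A(x, y) = \<integral> exp(\<i> (x sin t + y cos t)) dt\<close> over \<open>\<bar>t\<bar> \<le> \<pi>/2\<close> superposes the waves that propagate
  and \<open>B(x, y) = \<integral> 2 cos(x \<surd>(1 + u\<^sup>2)) exp(-y u) / \<surd>(1 + u\<^sup>2) du\<close> over \<open>u \<ge> 0\<close> superposes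
  the evanescent ones. Along the measurement line, \<open>A(k\<^sub>0 x, k\<^sub>0 y)\<close> contains only the frequencies
  \<open>k\<^sub>0 sin t\<close> in \<open>[-k\<^sub>0, k\<^sub>0]\<close> and \<open>B(k\<^sub>0 x, k\<^sub>0 y)\<close> only the frequencies \<open>\<plusminus>k\<^sub>0 \<surd>(1 + u\<^sup>2)\<close>, which
  lie outside \<open>(-k\<^sub>0, k\<^sub>0)\<close>. Paired with the Fourier transform of a test function supported in
  \<open>(-k\<^sub>0, k\<^sub>0)\<close>, the evanescent part therefore disappears (\<open>hankel_fourier\<close>). Fubini's theorem
  transports this to the scattered field (\<open>born_paired_with_fourier\<close>), the substitution
  \<open>k = k\<^sub>0 sin t\<close>, \<open>dt = dk/\<kappa>(k)\<close> yields the factor \<open>1/\<kappa>\<close> (\<open>sine_substitution\<close>), and a last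
  exchange of integrals recognises the transform of \<open>f u\<^sup>i\<^sup>n\<^sup>c\<close> at \<open>h(k)\<close> as the integral over
  the circle of \<open>a(s) Ff(h(k) - k\<^sub>0 s)\<close>.

  The decomposition itself has two ingredients. The combination \<open>A - \<i> B\<close> is invariant under
  rotations: the angular derivatives of \<open>A\<close> and of \<open>B\<close> are integrals of total derivatives,
  whose boundary terms at the transition between propagating and evanescent waves cancel
  (\<open>propagating_rotate\<close>, \<open>evanescent_rotate\<close>). On the axis \<open>x = 0\<close> the decomposition is a classical
  integral representation of \<open>J\<^sub>0 + \<i> Y\<^sub>0\<close> (\<open>hankel1_0_integral\<close>). The series and the integrals
  satisfy the same Bessel equation, and two solutions whose difference tends to \<open>0\<close> at the origin
  coincide (\<open>bessel_equation_unique\<close>). For \<open>Y\<^sub>0\<close> this requires the constant term of the logarithmic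
  singularity, where the Euler--Mascheroni constant arises from a comparison with harmonic sums
  (\<open>decay_integral_at_0\<close>). The same representation shows that \<open>H\<^sub>0\<close> is bounded away from the origin,
  so the scattered field is bounded on the line.
\<close>

section \<open>Differentiation under the integral sign and improper integrals\<close>

text \<open>
  By the mean value inequality the difference quotients are dominated by the same \<open>g\<close> as the
  derivatives, so dominated convergence applies along every sequence that tends to \<open>x\<close>.
\<close>

lemma has_vector_derivative_lebesgue_integral:
  fixes f f' :: "real \<Rightarrow> 'a \<Rightarrow> 'b::{banach,second_countable_topology}"
  assumes S: "open S" "convex S" "x \<in> S"
    and int: "\<And>z. z \<in> S \<Longrightarrow> integrable M (f z)"
    and deriv: "\<And>z t. z \<in> S \<Longrightarrow> t \<in> space M \<Longrightarrow> ((\<lambda>z. f z t) has_vector_derivative f' z t) (at z)"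
    and bound: "\<And>z t. z \<in> S \<Longrightarrow> t \<in> space M \<Longrightarrow> norm (f' z t) \<le> g t"
    and g: "integrable M g"
  shows "integrable M (f' x)"
    and "((\<lambda>z. \<integral>t. f z t \<partial>M) has_vector_derivative (\<integral>t. f' x t \<partial>M)) (at x)"
proof -
  define q where "q y t = (f y t - f x t) /\<^sub>R (y - x)" for y t
  have qlim: "(\<lambda>n. q (X n) t) \<longlonglongrightarrow> f' x t"
    if X: "\<And>n. X n \<in> S - {x}" "X \<longlonglongrightarrow> x" and t: "t \<in> space M" for X t
  proof -
    have "((\<lambda>y. q y t) \<longlongrightarrow> f' x t) (at x within S)"
    proof -
      have "((\<lambda>y. (1 / norm (y - x)) *\<^sub>R (f y t - (f x t + (y - x) *\<^sub>R f' x t))) \<longlongrightarrow> 0) (at x within S)"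
        using deriv[OF S(3) t, THEN has_vector_derivative_at_within[where S=S]]
        unfolding has_vector_derivative_def has_derivative_within by blast
      then have "((\<lambda>y. norm ((1 / norm (y - x)) *\<^sub>R (f y t - (f x t + (y - x) *\<^sub>R f' x t)))) \<longlongrightarrow> 0) (at x within S)"
        by (rule tendsto_norm_zero)
      then have "((\<lambda>y. norm (q y t - f' x t)) \<longlongrightarrow> 0) (at x within S)"
      proof (rule Lim_transform_eventually)
        have *: "norm ((1 / norm (y - x)) *\<^sub>R (f y t - (f x t + (y - x) *\<^sub>R f' x t))) = norm (q y t - f' x t)"
          if "y \<noteq> x" for y
        proof -
          have "q y t - f' x t = (1 / (y - x)) *\<^sub>R (f y t - (f x t + (y - x) *\<^sub>R f' x t))"
            using that by (simp add: q_def scaleR_diff_right scaleR_add_right divide_inverse_commute)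
          then show ?thesis by simp
        qed
        show "\<forall>\<^sub>F y in at x within S. norm ((1 / norm (y - x)) *\<^sub>R (f y t - (f x t + (y - x) *\<^sub>R f' x t)))
          = norm (q y t - f' x t)"
          using * by (auto simp: eventually_at intro!: exI[of _ 1])
      qed
      then show ?thesis
        using Lim_null tendsto_norm_zero_iff by blast
    qed
    then show ?thesis
      using X unfolding tendsto_at_iff_sequentially by (auto simp: o_def)
  qed
  have qbound: "norm (q y t) \<le> g t" if "y \<in> S - {x}" "t \<in> space M" for y t
  proof -
    have "norm (f y t - f x t) \<le> g t * norm (y - x)"
    proof (rule differentiable_bound[OF S(2), where f'="\<lambda>z h. h *\<^sub>R f' z t"])
      show "((\<lambda>z. f z t) has_derivative (\<lambda>h. h *\<^sub>R f' z t)) (at z within S)" if "z \<in> S" for z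
        using deriv[OF that \<open>t \<in> space M\<close>] has_vector_derivative_at_within
        unfolding has_vector_derivative_def using has_derivative_at_withinI by blast
      show "onorm (\<lambda>h. h *\<^sub>R f' z t) \<le> g t" if "z \<in> S" for z
        by (rule onorm_le) (use bound[OF that \<open>t \<in> space M\<close>] in \<open>auto simp: mult.commute intro: mult_left_mono\<close>)
    qed (use that S in auto)
    then show ?thesis
      using that by (simp add: q_def divide_simps)
  qed
  obtain X0 where X0: "\<And>n. X0 n \<in> S - {x}" "X0 \<longlonglongrightarrow> x"
  proof -
    have "x islimpt S" using S by (simp add: interior_limit_point interior_open)
    then show ?thesis using that unfolding islimpt_sequential by blast
  qed
  have qm: "q y \<in> borel_measurable M" if "y \<in> S" for y
    using int[OF that] int[OF S(3)] unfolding q_def by measurable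
  have fm: "f' x \<in> borel_measurable M"
    by (rule borel_measurable_LIMSEQ_metric[where f="\<lambda>n. q (X0 n)"]) (use X0 qm qlim in auto)
  show "integrable M (f' x)"
    by (rule Bochner_Integration.integrable_bound[OF g fm])
       (use bound S(3) in \<open>force intro!: AE_I2\<close>)
  have lim: "((\<lambda>y. \<integral>t. q y t \<partial>M) \<longlongrightarrow> (\<integral>t. f' x t \<partial>M)) (at x within S)"
    unfolding tendsto_at_iff_sequentially o_def
  proof (intro allI impI)
    fix X :: "nat \<Rightarrow> real"
    assume X: "\<forall>i. X i \<in> S - {x}" "X \<longlonglongrightarrow> x"
    show "(\<lambda>n. \<integral>t. q (X n) t \<partial>M) \<longlonglongrightarrow> (\<integral>t. f' x t \<partial>M)"
      by (rule integral_dominated_convergence[where w=g])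
         (use X qm qlim qbound g fm in \<open>auto intro!: AE_I2\<close>)
  qed
  have eq: "norm ((\<integral>t. q y t \<partial>M) - (\<integral>t. f' x t \<partial>M)) =
      norm ((1 / norm (y - x)) *\<^sub>R ((\<integral>t. f y t \<partial>M) - ((\<integral>t. f x t \<partial>M) + (y - x) *\<^sub>R (\<integral>t. f' x t \<partial>M))))"
    if "y \<in> S - {x}" for y
  proof -
    have "(\<integral>t. q y t \<partial>M) = (1 / (y - x)) *\<^sub>R ((\<integral>t. f y t \<partial>M) - (\<integral>t. f x t \<partial>M))"
      using that int S(3) by (simp add: q_def[abs_def] divide_inverse_commute)
    then have "(\<integral>t. q y t \<partial>M) - (\<integral>t. f' x t \<partial>M) =
       (1 / (y - x)) *\<^sub>R ((\<integral>t. f y t \<partial>M) - ((\<integral>t. f x t \<partial>M) + (y - x) *\<^sub>R (\<integral>t. f' x t \<partial>M)))"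
      using that by (simp add: scaleR_diff_right scaleR_add_right divide_inverse_commute)
    then show ?thesis by simp
  qed
  have "((\<lambda>y. norm ((\<integral>t. q y t \<partial>M) - (\<integral>t. f' x t \<partial>M))) \<longlongrightarrow> 0) (at x within S)"
    using lim Lim_null tendsto_norm_zero by blast
  then have "((\<lambda>y. norm ((1 / norm (y - x)) *\<^sub>R
    ((\<integral>t. f y t \<partial>M) - ((\<integral>t. f x t \<partial>M) + (y - x) *\<^sub>R (\<integral>t. f' x t \<partial>M))))) \<longlongrightarrow> 0) (at x within S)"
    by (rule Lim_transform_eventually) (use eq in \<open>auto simp: eventually_at intro!: exI[of _ 1]\<close>)
  then have "((\<lambda>z. \<integral>t. f z t \<partial>M) has_vector_derivative (\<integral>t. f' x t \<partial>M)) (at x within S)"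
    unfolding has_vector_derivative_def has_derivative_within
    by (blast intro: tendsto_norm_zero_cancel bounded_linear_scaleR_left)
  then show "((\<lambda>z. \<integral>t. f z t \<partial>M) has_vector_derivative (\<integral>t. f' x t \<partial>M)) (at x)"
    by (simp only: at_within_open[OF S(3,1)])
qed

lemma has_vector_derivative_set_lebesgue_integral:
  fixes f f' :: "real \<Rightarrow> 'a \<Rightarrow> 'b::{banach,second_countable_topology}"
  assumes S: "open S" "convex S" "x \<in> S"
    and int: "\<And>z. z \<in> S \<Longrightarrow> set_integrable M A (f z)"
    and deriv: "\<And>z t. z \<in> S \<Longrightarrow> t \<in> A \<Longrightarrow> ((\<lambda>z. f z t) has_vector_derivative f' z t) (at z)"
    and bound: "\<And>z t. z \<in> S \<Longrightarrow> t \<in> A \<Longrightarrow> norm (f' z t) \<le> g t"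
    and g: "set_integrable M A g"
  shows "set_integrable M A (f' x)"
    and "((\<lambda>z. LINT t:A|M. f z t) has_vector_derivative (LINT t:A|M. f' x t)) (at x)"
proof -
  have d: "((\<lambda>z. indicat_real A t *\<^sub>R f z t) has_vector_derivative indicat_real A t *\<^sub>R f' z t) (at z)"
    if "z \<in> S" for z t
  proof (cases "t \<in> A")
    case True
    then show ?thesis using deriv[OF that True] by simp
  qed simp
  have b: "norm (indicat_real A t *\<^sub>R f' z t) \<le> indicat_real A t *\<^sub>R g t" if "z \<in> S" for z t
    using bound[OF that] by (auto simp: indicator_def)
  note * = has_vector_derivative_lebesgue_integral[OF S, of M "\<lambda>z t. indicat_real A t *\<^sub>R f z t" 
      "\<lambda>z t. indicat_real A t *\<^sub>R f' z t" "\<lambda>t. indicat_real A t *\<^sub>R g t"]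
  show "set_integrable M A (f' x)"
    unfolding set_integrable_def
    by (rule *(1)) (use int g d b in \<open>auto simp: set_integrable_def\<close>)
  show "((\<lambda>z. LINT t:A|M. f z t) has_vector_derivative (LINT t:A|M. f' x t)) (at x)"
    unfolding set_lebesgue_integral_def
    by (rule *(2)) (use int g d b in \<open>auto simp: set_integrable_def\<close>)
qed

lemma integral_FTC_atLeast:
  fixes f F :: "real \<Rightarrow> 'a::euclidean_space"
  assumes F: "\<And>x. a \<le> x \<Longrightarrow> (F has_vector_derivative f x) (at x)"
    and f: "continuous_on {a..} f"
    and int: "set_integrable lborel {a..} f"
    and lim: "(F \<longlongrightarrow> L) at_top"
  shows "(LINT x:{a..}|lborel. f x) = L - F a"
proof (rule tendsto_unique[OF trivial_limit_at_top_linorder])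
  show "((\<lambda>b. LINT x:{a..b}|lborel. f x) \<longlongrightarrow> (LINT x:{a..}|lborel. f x)) at_top"
    by (rule tendsto_set_lebesgue_integral_at_top) (use int in auto)
  have "((\<lambda>b. F b - F a) \<longlongrightarrow> L - F a) at_top"
    by (intro tendsto_intros lim)
  then show "((\<lambda>b. LINT x:{a..b}|lborel. f x) \<longlongrightarrow> L - F a) at_top"
  proof (rule Lim_transform_eventually)
    have "F b - F a = (LINT x:{a..b}|lborel. f x)" if "b \<ge> a" for b
      unfolding set_lebesgue_integral_def
      using that by (intro integral_FTC_atLeastAtMost[symmetric])
        (auto intro: F has_vector_derivative_at_within continuous_on_subset[OF f])
    then show "\<forall>\<^sub>F b in at_top. F b - F a = (LINT x:{a..b}|lborel. f x)"
      by (auto simp: eventually_at_top_linorder)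
  qed
qed

section \<open>Uniqueness for the Bessel equation of order zero\<close>

text \<open>
  The equation says that \<open>p(x) = x D'(x)\<close> has derivative \<open>-x D(x)\<close>, so that \<open>p\<close> has a limit at \<open>0\<close>.
  A nonzero limit would make \<open>D\<close> grow like a logarithm; hence \<open>p\<close> tends to \<open>0\<close>, which improves to
  \<open>D'(x) = O(x)\<close>. The energy \<open>D\<^sup>2 + D'\<^sup>2\<close> then tends to \<open>0\<close> at the origin, and since the first order
  term of the equation acts as friction, the energy cannot increase afterwards.
\<close>

lemma bessel_equation_unique:
  fixes D D' D'' :: "real \<Rightarrow> real"
  assumes D: "\<And>x. x > 0 \<Longrightarrow> (D has_real_derivative D' x) (at x)"
    and D': "\<And>x. x > 0 \<Longrightarrow> (D' has_real_derivative D'' x) (at x)"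
    and ode: "\<And>x. x > 0 \<Longrightarrow> x * D'' x + D' x + x * D x = 0"
    and lim: "(D \<longlongrightarrow> 0) (at_right 0)"
    and x: "x > 0"
  shows "D x = 0"
proof -
  define p where "p x = x * D' x" for x
  have p: "(p has_real_derivative - (x * D x)) (at x)" if "x > 0" for x
    unfolding p_def using that ode[OF that]
    by (auto intro!: derivative_eq_intros D' simp: algebra_simps)
  have small: "\<exists>d>0. \<forall>x. 0 < x \<and> x < d \<longrightarrow> \<bar>D x\<bar> < e" if "e > 0" for e
    using lim that unfolding tendsto_iff eventually_at_right_field
    by (fastforce simp: dist_real_def)
  have pdiff: "\<bar>p y - p x\<bar> \<le> e * y * (y - x)"
    if "0 < x" "x < y" and e: "\<And>z. x \<le> z \<Longrightarrow> z \<le> y \<Longrightarrow> \<bar>D z\<bar> \<le> e" for x y e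
  proof -
    obtain z where z: "z > x" "z < y" "p y - p x = (y - x) * (- (z * D z))"
    proof -
      have "\<exists>z>x. z < y \<and> p y - p x = (y - x) * (- (z * D z))"
        by (rule MVT2[OF \<open>x < y\<close>]) (use p \<open>0 < x\<close> in auto)
      then show ?thesis using that by blast
    qed
    have "\<bar>p y - p x\<bar> = (y - x) * (z * \<bar>D z\<bar>)"
      using z that by (simp add: abs_mult)
    also have "\<dots> \<le> (y - x) * (y * e)"
      using z that e[of z] by (intro mult_left_mono mult_mono) auto
    finally show ?thesis by (simp add: algebra_simps)
  qed
  have plim: "\<exists>d>0. \<forall>x. 0 < x \<and> x < d \<longrightarrow> \<bar>p x\<bar> < e" if "e > 0" for e
  proof -
    obtain d where d: "d > 0" "\<And>x. 0 < x \<Longrightarrow> x < d \<Longrightarrow> \<bar>D x\<bar> < e / 8"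
    proof -
      have "e / 8 > 0" using \<open>e > 0\<close> by simp
      from small[OF this] show ?thesis using that by blast
    qed
    have "\<bar>p x\<bar> < e" if x: "0 < x" "x < min d 1" for x
    proof -
      \<comment> \<open>With the mean value theorem for \<open>g\<close> on \<open>[x/e, x]\<close>, where \<open>ln\<close> grows by exactly 1,
        \<open>p x\<close> differs from \<open>D x - D (x/e)\<close> only by the oscillation of \<open>p\<close>.\<close>
      define g where "g z = D z - p x * ln z" for z
      have *: "x / exp 1 < x" using x by (simp add: divide_simps)
      have gd: "(g has_real_derivative D' z - p x / z) (at z)" if "z > 0" for z
        unfolding g_def using that by (auto intro!: derivative_eq_intros D)
      obtain z where z: "z > x / exp 1" "z < x" "g x - g (x / exp 1) = (x - x / exp 1) * (D' z - p x / z)"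
      proof -
        have "0 < z" if "x / exp 1 \<le> z" for z
          using that x by (meson divide_pos_pos exp_gt_zero less_le_trans)
        then have "\<exists>z>x / exp 1. z < x \<and> g x - g (x / exp 1) = (x - x / exp 1) * (D' z - p x / z)"
          by (intro MVT2[OF *] gd) auto
        then show ?thesis using that by blast
      qed
      have z0: "z > 0" using z(1) x by (meson divide_pos_pos exp_gt_zero less_trans)
      have "\<bar>p x - p z\<bar> \<le> (e / 8) * x * (x - z)"
        by (rule pdiff) (use z z0 x d(2) in \<open>auto intro!: less_imp_le\<close>)
      also have "\<dots> \<le> (e / 8) * x * x" using z0 x \<open>e > 0\<close> by (intro mult_left_mono) auto
      finally have pz: "\<bar>p x - p z\<bar> \<le> (e / 8) * x * x" .
      have "\<bar>(x - x / exp 1) * (D' z - p x / z)\<bar> = (x - x / exp 1) * (\<bar>p x - p z\<bar> / z)"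
      proof -
        have "D' z - p x / z = (p z - p x) / z" using z0 by (simp add: p_def field_simps)
        then show ?thesis using * z0 by (simp add: abs_mult abs_minus_commute)
      qed
      then have "\<bar>g x - g (x / exp 1)\<bar> = (x - x / exp 1) * (\<bar>p x - p z\<bar> / z)" using z(3) by simp
      also have "\<dots> \<le> x * (((e / 8) * x * x) / (x / exp 1))"
        using pz z x z0 \<open>e > 0\<close> by (intro mult_mono frac_le) auto
      also have "\<dots> = exp 1 * (e / 8) * (x * x)" using x by (simp add: field_simps)
      finally have g2: "\<bar>g x - g (x / exp 1)\<bar> \<le> exp 1 * (e / 8) * (x * x)" .
      have e1: "exp 1 * (e / 8) * (x * x) \<le> 3 * (e / 8) * (1 * 1)"
        using x \<open>e > 0\<close> exp_le by (intro mult_mono) auto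
      have "x / exp 1 < d" "0 < x / exp 1" using * x by auto
      then have "\<bar>D x\<bar> < e / 8" "\<bar>D (x / exp 1)\<bar> < e / 8" using d(2) x by auto
      moreover have "g x - g (x / exp 1) = D x - D (x / exp 1) - p x"
        using x by (simp add: g_def ln_div algebra_simps)
      ultimately show ?thesis using g2 e1 \<open>e > 0\<close> by linarith
    qed
    then show ?thesis using d(1) by (intro exI[of _ "min d 1"]) auto
  qed
  have D'small: "\<bar>D' x\<bar> \<le> e * x"
    if x: "0 < x" and e: "\<And>z. 0 < z \<Longrightarrow> z \<le> x \<Longrightarrow> \<bar>D z\<bar> \<le> e" for x e
  proof -
    have e0: "0 \<le> e" using e[OF x] by simp
    have "\<bar>p x\<bar> \<le> e * x * x + \<eta>" if "\<eta> > 0" for \<eta>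
    proof -
      obtain d where d: "d > 0" "\<And>x. 0 < x \<Longrightarrow> x < d \<Longrightarrow> \<bar>p x\<bar> < \<eta>"
        using plim[OF \<open>\<eta> > 0\<close>] by blast
      define y where "y = min (d / 2) (x / 2)"
      have y: "0 < y" "y < x" "y < d" using d x by (auto simp: y_def)
      have "\<bar>p x - p y\<bar> \<le> e * x * (x - y)"
        by (rule pdiff) (use y e in auto)
      also have "\<dots> \<le> e * x * x" using e0 y by (intro mult_left_mono) auto
      finally show ?thesis using d(2)[OF y(1,3)] by linarith
    qed
    then have "\<bar>p x\<bar> \<le> e * x * x" by (rule field_le_epsilon)
    then have "x * \<bar>D' x\<bar> \<le> x * (e * x)" using x by (simp add: p_def abs_mult algebra_simps)
    then show ?thesis using x by simp
  qed
  define V where "V x = (D x)\<^sup>2 + (D' x)\<^sup>2" for x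
  have V: "V x \<le> V y" if "0 < y" "y \<le> x" for x y
  proof (rule DERIV_nonpos_imp_nonincreasing[OF that(2)])
    fix z assume "y \<le> z" "z \<le> x"
    then have z: "z > 0" using that by simp
    have D''z: "D'' z = - D' z / z - D z" using ode[OF z] z by (simp add: field_simps)
    have "2 * D z * D' z + 2 * D' z * D'' z = - 2 * (D' z)\<^sup>2 / z"
      unfolding D''z using z by (simp add: field_simps power2_eq_square)
    then have "(V has_real_derivative - 2 * (D' z)\<^sup>2 / z) (at z)"
      unfolding V_def using z
      by (auto intro!: derivative_eq_intros D D' simp: algebra_simps)
    then show "\<exists>w. (V has_real_derivative w) (at z) \<and> w \<le> 0"
      using z by (intro exI[of _ "- 2 * (D' z)\<^sup>2 / z"]) auto
  qed
  have "V x \<le> 0 + e" if "e > 0" for e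
  proof -
    obtain d where d: "d > 0" "\<And>x. 0 < x \<Longrightarrow> x < d \<Longrightarrow> \<bar>D x\<bar> < sqrt (e / 2)"
    proof -
      have "sqrt (e / 2) > 0" using \<open>e > 0\<close> by simp
      from small[OF this] show ?thesis using that by blast
    qed
    define y where "y = min (d / 2) (min x 1)"
    have y: "0 < y" "y \<le> x" "y \<le> 1" "y < d" using d x by (auto simp: y_def)
    have Dy: "\<bar>D y\<bar> \<le> sqrt (e / 2)" using d(2)[of y] y by simp
    have "\<bar>D' y\<bar> \<le> sqrt (e / 2) * y"
      by (rule D'small) (use y d(2) in \<open>auto intro!: less_imp_le\<close>)
    also have "\<dots> \<le> sqrt (e / 2)" using y that by (simp add: mult_left_le)
    finally have D'y: "\<bar>D' y\<bar> \<le> sqrt (e / 2)" .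
    have "(D y)\<^sup>2 \<le> (sqrt (e / 2))\<^sup>2" "(D' y)\<^sup>2 \<le> (sqrt (e / 2))\<^sup>2"
      using Dy D'y that by (simp_all only: abs_le_square_iff[symmetric] abs_of_nonneg real_sqrt_ge_zero)
    then have "(D y)\<^sup>2 \<le> e / 2" "(D' y)\<^sup>2 \<le> e / 2" using that by simp_all
    then have "V y \<le> e" by (simp add: V_def)
    then show ?thesis using V[OF y(1,2)] by simp
  qed
  then have "V x \<le> 0" by (rule field_le_epsilon)
  then show ?thesis by (simp add: V_def sum_power2_le_zero_iff)
qed

section \<open>The series of J0 and Y0 solve the Bessel equation\<close>

definition J0_coeff :: "nat \<Rightarrow> real" where "J0_coeff m = (-1) ^ m / (fact m)\<^sup>2"
definition Y0_coeff :: "nat \<Rightarrow> real" where "Y0_coeff m = (-1) ^ m * harm m / (fact m)\<^sup>2"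

lemma harm_le: "harm m \<le> real m"
proof (induction m)
  case (Suc m)
  have "inverse (real (Suc m)) \<le> 1" by (simp add: inverse_le_1_iff)
  then show ?case using Suc by (simp add: harm_Suc)
qed (simp add: harm_def)

lemma summable_exp_bound:
  fixes c :: "nat \<Rightarrow> real"
  assumes "\<And>m. \<bar>c m\<bar> \<le> 1 / fact m"
  shows "summable (\<lambda>m. c m * y ^ m)"
proof (rule summable_comparison_test'[OF summable_exp[of "\<bar>y\<bar>"], of 0])
  fix n :: nat
  have "norm (c n * y ^ n) = \<bar>c n\<bar> * \<bar>y\<bar> ^ n" by (simp add: abs_mult power_abs)
  also have "\<dots> \<le> (1 / fact n) * \<bar>y\<bar> ^ n" by (intro mult_right_mono assms) auto
  finally show "norm (c n * y ^ n) \<le> inverse (fact n) * \<bar>y\<bar> ^ n" by (simp add: divide_inverse)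
qed

lemma summable_J0_coeff: "summable (\<lambda>m. J0_coeff m * y ^ m)"
proof (rule summable_exp_bound)
  fix m
  have "(1::real) \<le> fact m" by (rule fact_ge_1)
  then have "fact m \<le> (fact m :: real)\<^sup>2" by (simp add: power2_eq_square)
  then show "\<bar>J0_coeff m\<bar> \<le> 1 / fact m"
    by (simp add: J0_coeff_def abs_mult power_abs frac_le)
qed

lemma summable_Y0_coeff: "summable (\<lambda>m. Y0_coeff m * y ^ m)"
proof (rule summable_exp_bound)
  fix m
  have "real m \<le> fact m" by (metis fact_ge_self of_nat_fact of_nat_le_iff)
  then have "harm m \<le> (fact m :: real)" using harm_le[of m] by linarith
  then have "harm m / (fact m)\<^sup>2 \<le> (fact m :: real) / (fact m)\<^sup>2"
    by (rule divide_right_mono) simp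
  also have "\<dots> = 1 / fact m" by (simp add: power2_eq_square)
  finally show "\<bar>Y0_coeff m\<bar> \<le> 1 / fact m"
    by (simp add: Y0_coeff_def abs_mult power_abs harm_nonneg)
qed

text \<open>
  In the variable \<open>z = x\<^sup>2/4\<close> the Bessel operator becomes \<open>z \<tau>'' + \<tau>' + \<tau>\<close>, which acts on
  the coefficients of a power series by a two-term recursion.
\<close>

lemma series_bessel_identity:
  fixes c d :: "nat \<Rightarrow> real"
  assumes c: "\<And>y. summable (\<lambda>m. c m * y ^ m)" and d: "\<And>y. summable (\<lambda>m. d m * y ^ m)"
    and rec: "\<And>m. (real m + 1)\<^sup>2 * c (Suc m) + c m = d m"
  shows "z * (\<Sum>m. diffs (diffs c) m * z ^ m) + (\<Sum>m. diffs c m * z ^ m) + (\<Sum>m. c m * z ^ m)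
    = (\<Sum>m. d m * z ^ m)"
proof -
  have s1: "summable (\<lambda>m. diffs c m * y ^ m)" for y by (rule termdiff_converges_all[OF c])
  have s2: "summable (\<lambda>m. diffs (diffs c) m * y ^ m)" for y by (rule termdiff_converges_all[OF s1])
  have "(\<lambda>m. real m * diffs c m * z ^ (m - 1)) sums (\<Sum>m. diffs (diffs c) m * z ^ m)"
    using diffs_equiv[OF s2] by simp
  then have "(\<lambda>m. z * (real m * diffs c m * z ^ (m - 1))) sums (z * (\<Sum>m. diffs (diffs c) m * z ^ m))"
    by (rule sums_mult)
  moreover have "z * (real m * diffs c m * z ^ (m - 1)) = real m * diffs c m * z ^ m" for m
    by (cases m) auto
  ultimately have 1: "(\<lambda>m. real m * diffs c m * z ^ m) sums (z * (\<Sum>m. diffs (diffs c) m * z ^ m))"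
    by (simp only:)
  have "(\<lambda>m. real m * diffs c m * z ^ m + diffs c m * z ^ m + c m * z ^ m) sums
    (z * (\<Sum>m. diffs (diffs c) m * z ^ m) + (\<Sum>m. diffs c m * z ^ m) + (\<Sum>m. c m * z ^ m))"
    by (intro sums_add 1 summable_sums s1 c)
  also have "(\<lambda>m. real m * diffs c m * z ^ m + diffs c m * z ^ m + c m * z ^ m) = (\<lambda>m. d m * z ^ m)"
    by (rule ext, subst rec[symmetric]) (simp add: diffs_def algebra_simps power2_eq_square)
  finally show ?thesis using sums_unique by metis
qed

definition power_series_sum :: "(nat \<Rightarrow> real) \<Rightarrow> real \<Rightarrow> real" where "power_series_sum c z = (\<Sum>m. c m * z ^ m)"

lemma power_series_sum_DERIV:
  assumes "\<And>y. summable (\<lambda>m. c m * y ^ m)"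
  shows "(power_series_sum c has_real_derivative power_series_sum (diffs c) z) (at z)"
  unfolding power_series_sum_def[abs_def] by (rule termdiffs_strong_converges_everywhere[OF assms])

lemma J0_coeff_Suc: "J0_coeff (Suc m) = - J0_coeff m / (real m + 1)\<^sup>2"
  by (simp add: J0_coeff_def power2_eq_square divide_simps) (simp add: algebra_simps)

lemma J0_coeff_ode: "z * power_series_sum (diffs (diffs J0_coeff)) z + power_series_sum (diffs J0_coeff) z
  + power_series_sum J0_coeff z = 0"
proof -
  have "z * power_series_sum (diffs (diffs J0_coeff)) z + power_series_sum (diffs J0_coeff) z
    + power_series_sum J0_coeff z = (\<Sum>m. (\<lambda>_. 0) m * z ^ m)"
    unfolding power_series_sum_def by (rule series_bessel_identity[OF summable_J0_coeff])
      (auto simp: J0_coeff_Suc)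
  then show ?thesis by simp
qed

text \<open>
  The logarithm in \<open>Y\<^sub>0\<close> leaves the inhomogeneity \<open>2 J\<^sub>0'\<close> behind; the harmonic numbers in the
  coefficients are there to produce it.
\<close>

lemma Y0_coeff_ode: "z * power_series_sum (diffs (diffs Y0_coeff)) z + power_series_sum (diffs Y0_coeff) z
  + power_series_sum Y0_coeff z = power_series_sum (diffs J0_coeff) z"
  unfolding power_series_sum_def
proof (rule series_bessel_identity[OF summable_Y0_coeff termdiff_converges_all[OF summable_J0_coeff]])
  fix m
  have "Y0_coeff k = harm k * J0_coeff k" for k by (simp add: Y0_coeff_def J0_coeff_def)
  then show "(real m + 1)\<^sup>2 * Y0_coeff (Suc m) + Y0_coeff m = diffs J0_coeff m"
    by (simp add: J0_coeff_Suc harm_Suc diffs_def power2_eq_square divide_simps) (simp add: algebra_simps)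
qed

lemma bessel_J0_eq_power_series_sum: "bessel_J0 x = power_series_sum J0_coeff (x\<^sup>2 / 4)"
  unfolding bessel_J0_def power_series_sum_def J0_coeff_def
  by (intro suminf_cong) (simp add: power_mult power_divide)

lemma bessel_Y0_eq_power_series_sum: "bessel_Y0 x
  = 2 / pi * ((ln (x / 2) + euler_mascheroni) * power_series_sum J0_coeff (x\<^sup>2 / 4) - power_series_sum
    Y0_coeff (x\<^sup>2 / 4))"
proof -
  have "(\<Sum>m. (-1) ^ m * harm m * (x / 2) ^ (2 * m) / (fact m)\<^sup>2) = power_series_sum Y0_coeff (x\<^sup>2 / 4)"
    unfolding power_series_sum_def Y0_coeff_def by (intro suminf_cong) (simp add: power_mult power_divide)
  then show ?thesis
    unfolding bessel_Y0_def by (simp add: bessel_J0_eq_power_series_sum algebra_simps)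
qed

text \<open>
  Explicit first and second derivatives of \<open>J\<^sub>0\<close> and of the part of \<open>Y\<^sub>0\<close> without logarithm
  (taken with the factor \<open>-\<pi>/2\<close>), obtained from the substitution \<open>z = x\<^sup>2/4\<close>.
\<close>

definition bessel_J0' where "bessel_J0' x = x / 2 * power_series_sum (diffs J0_coeff) (x\<^sup>2 / 4)"
definition bessel_J0'' where "bessel_J0'' x = power_series_sum (diffs J0_coeff) (x\<^sup>2 / 4) / 2
  + x\<^sup>2 / 4 * power_series_sum (diffs (diffs J0_coeff)) (x\<^sup>2 / 4)"
definition regular_Y0' where "regular_Y0' x = x / 2 * power_series_sum (diffs Y0_coeff) (x\<^sup>2 / 4)"
definition regular_Y0'' where "regular_Y0'' x = power_series_sum (diffs Y0_coeff) (x\<^sup>2 / 4) / 2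
  + x\<^sup>2 / 4 * power_series_sum (diffs (diffs Y0_coeff)) (x\<^sup>2 / 4)"

lemma power_series_sum_quarter_sq_DERIV:
  assumes "\<And>y. summable (\<lambda>m. c m * y ^ m)"
  shows "((\<lambda>x. power_series_sum c (x\<^sup>2 / 4)) has_real_derivative x / 2 * power_series_sum (diffs c) (x\<^sup>2 / 4))
    (at x)"
    and "((\<lambda>x. x / 2 * power_series_sum (diffs c) (x\<^sup>2 / 4)) has_real_derivative
      (power_series_sum (diffs c) (x\<^sup>2 / 4) / 2 + x\<^sup>2 / 4 * power_series_sum (diffs (diffs c)) (x\<^sup>2 / 4))) (at x)"
proof -
  have *: "((\<lambda>x. power_series_sum d (x\<^sup>2 / 4))
    has_real_derivative x / 2 * power_series_sum (diffs d) (x\<^sup>2 / 4)) (at x)"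
    if "\<And>y. summable (\<lambda>m. d m * y ^ m)" for d
  proof -
    have "((\<lambda>x. x\<^sup>2 / 4) has_real_derivative x / 2) (at x)"
      by (auto intro!: derivative_eq_intros)
    from DERIV_chain2[OF power_series_sum_DERIV[OF that] this] show ?thesis by (simp add: mult.commute)
  qed
  note d = *[OF termdiff_converges_all[OF assms]]
  show "((\<lambda>x. power_series_sum c (x\<^sup>2 / 4)) has_real_derivative x / 2 * power_series_sum (diffs c) (x\<^sup>2 / 4))
    (at x)"
    by (rule *[OF assms])
  show "((\<lambda>x. x / 2 * power_series_sum (diffs c) (x\<^sup>2 / 4)) has_real_derivative
      (power_series_sum (diffs c) (x\<^sup>2 / 4) / 2 + x\<^sup>2 / 4 * power_series_sum (diffs (diffs c)) (x\<^sup>2 / 4))) (at x)"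
    using DERIV_mult[OF DERIV_cdivide[OF DERIV_ident, of 2] d]
    by (simp add: power2_eq_square algebra_simps)
qed

lemma bessel_J0_ode:
  "(bessel_J0 has_real_derivative bessel_J0' x) (at x)"
  "(bessel_J0' has_real_derivative bessel_J0'' x) (at x)"
  "x * bessel_J0'' x + bessel_J0' x + x * bessel_J0 x = 0"
proof -
  show "(bessel_J0 has_real_derivative bessel_J0' x) (at x)"
    unfolding bessel_J0_eq_power_series_sum[abs_def] bessel_J0'_def
      by (rule power_series_sum_quarter_sq_DERIV[OF summable_J0_coeff])
  show "(bessel_J0' has_real_derivative bessel_J0'' x) (at x)"
    unfolding bessel_J0'_def[abs_def] bessel_J0''_def
      by (rule power_series_sum_quarter_sq_DERIV[OF summable_J0_coeff])
  have "x * bessel_J0'' x + bessel_J0' x + x * bessel_J0 x =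
     x * (x\<^sup>2 / 4 * power_series_sum (diffs (diffs J0_coeff)) (x\<^sup>2 / 4)
       + power_series_sum (diffs J0_coeff) (x\<^sup>2 / 4) + power_series_sum J0_coeff (x\<^sup>2 / 4))"
    by (simp add: bessel_J0''_def bessel_J0'_def bessel_J0_eq_power_series_sum algebra_simps)
  then show "x * bessel_J0'' x + bessel_J0' x + x * bessel_J0 x = 0" by (simp only: J0_coeff_ode mult_zero_right)
qed

definition bessel_Y0' where "bessel_Y0' x
  = 2 / pi * (bessel_J0 x / x + (ln (x / 2) + euler_mascheroni) * bessel_J0' x - regular_Y0' x)"
definition bessel_Y0'' where "bessel_Y0'' x = 2 / pi * (2 * bessel_J0' x / x - bessel_J0 x / x\<^sup>2
   + (ln (x / 2) + euler_mascheroni) * bessel_J0'' x - regular_Y0'' x)"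

lemma bessel_Y0_ode:
  assumes "x > 0"
  shows "(bessel_Y0 has_real_derivative bessel_Y0' x) (at x)"
  "(bessel_Y0' has_real_derivative bessel_Y0'' x) (at x)"
  "x * bessel_Y0'' x + bessel_Y0' x + x * bessel_Y0 x = 0"
proof -
  have T: "((\<lambda>x. power_series_sum Y0_coeff (x\<^sup>2 / 4)) has_real_derivative regular_Y0' x) (at x)"
    "(regular_Y0' has_real_derivative regular_Y0'' x) (at x)"
    unfolding regular_Y0'_def[abs_def] regular_Y0''_def
      by (rule power_series_sum_quarter_sq_DERIV[OF summable_Y0_coeff])+
  show "(bessel_Y0 has_real_derivative bessel_Y0' x) (at x)"
    unfolding bessel_Y0_eq_power_series_sum[abs_def] bessel_J0_eq_power_series_sum[symmetric] bessel_Y0'_def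
      using assms
    by (auto intro!: derivative_eq_intros T bessel_J0_ode simp: field_simps)
  show "(bessel_Y0' has_real_derivative bessel_Y0'' x) (at x)"
    unfolding bessel_Y0'_def[abs_def] bessel_Y0''_def using assms
    by (auto intro!: derivative_eq_intros T bessel_J0_ode) (simp add: field_simps power2_eq_square)
  have "x * regular_Y0'' x + regular_Y0' x + x * power_series_sum Y0_coeff (x\<^sup>2 / 4) =
     x * (x\<^sup>2 / 4 * power_series_sum (diffs (diffs Y0_coeff)) (x\<^sup>2 / 4)
       + power_series_sum (diffs Y0_coeff) (x\<^sup>2 / 4) + power_series_sum Y0_coeff (x\<^sup>2 / 4))"
    by (simp add: regular_Y0''_def regular_Y0'_def algebra_simps)
  also have "\<dots> = 2 * bessel_J0' x" by (simp only: Y0_coeff_ode) (simp add: bessel_J0'_def)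
  finally have T3: "x * regular_Y0'' x + regular_Y0' x + x * power_series_sum Y0_coeff (x\<^sup>2 / 4)
    = 2 * bessel_J0' x" .
  have "x * bessel_Y0'' x + bessel_Y0' x + x * bessel_Y0 x = 2 / pi * (2 * bessel_J0' x
     + (ln (x / 2) + euler_mascheroni) * (x * bessel_J0'' x + bessel_J0' x + x * bessel_J0 x)
     - (x * regular_Y0'' x + regular_Y0' x + x * power_series_sum Y0_coeff (x\<^sup>2 / 4)))"
    unfolding bessel_Y0''_def bessel_Y0'_def bessel_Y0_eq_power_series_sum
      bessel_J0_eq_power_series_sum[symmetric]
    using assms by (simp add: power2_eq_square field_simps)
  then show "x * bessel_Y0'' x + bessel_Y0' x + x * bessel_Y0 x = 0" by (simp add: T3 bessel_J0_ode(3))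
qed

lemma bessel_at_0:
  shows "(bessel_J0 \<longlongrightarrow> 1) (at_right 0)"
    and "((\<lambda>x. bessel_Y0 x - 2 / pi * (ln (x / 2) + euler_mascheroni)) \<longlongrightarrow> 0) (at_right 0)"
proof -
  have power_series_sum_0: "power_series_sum c 0 = c 0" for c
    unfolding power_series_sum_def by (rule powser_zero)
  have J0: "bessel_J0 0 = 1"
    by (simp add: bessel_J0_eq_power_series_sum power_series_sum_0 J0_coeff_def)
  have cont: "isCont bessel_J0 0" using bessel_J0_ode(1) DERIV_isCont by blast
  then show 1: "(bessel_J0 \<longlongrightarrow> 1) (at_right 0)"
    using J0 by (metis isCont_def filterlim_at_split)
  have "((\<lambda>x. power_series_sum Y0_coeff (x\<^sup>2 / 4)) \<longlongrightarrow> power_series_sum Y0_coeff (0\<^sup>2 / 4)) (at_right 0)"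
    using power_series_sum_quarter_sq_DERIV(1)[OF summable_Y0_coeff, of 0, THEN DERIV_isCont]
    by (metis isCont_def filterlim_at_split)
  then have T: "((\<lambda>x. power_series_sum Y0_coeff (x\<^sup>2 / 4)) \<longlongrightarrow> 0) (at_right 0)"
    by (simp add: power_series_sum_0 Y0_coeff_def harm_def)
  have "((\<lambda>x. (bessel_J0 x - bessel_J0 0) / (x - 0)) \<longlongrightarrow> bessel_J0' 0) (at_right 0)"
    using bessel_J0_ode(1)[of 0] by (metis has_field_derivative_iff filterlim_at_split)
  then have q: "((\<lambda>x. (bessel_J0 x - 1) / x) \<longlongrightarrow> 0) (at_right 0)"
    by (simp add: J0 bessel_J0'_def)
  have l: "((\<lambda>x::real. x * (ln (x / 2) + euler_mascheroni)) \<longlongrightarrow> 0) (at_right 0)"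
    by real_asymp
  have *: "((\<lambda>x. 2 / pi * (((bessel_J0 x - 1) / x) * (x * (ln (x / 2) + euler_mascheroni)) - power_series_sum
    Y0_coeff (x\<^sup>2 / 4)))
     \<longlongrightarrow> 2 / pi * (0 * 0 - 0)) (at_right 0)"
    by (intro tendsto_intros q l T)
  show "((\<lambda>x. bessel_Y0 x - 2 / pi * (ln (x / 2) + euler_mascheroni)) \<longlongrightarrow> 0) (at_right 0)"
  proof (rule Lim_transform_eventually)
    show "((\<lambda>x. 2 / pi * (((bessel_J0 x - 1) / x) * (x * (ln (x / 2) + euler_mascheroni)) - power_series_sum
      Y0_coeff (x\<^sup>2 / 4)))
     \<longlongrightarrow> 0) (at_right 0)" using * by simp
    show "\<forall>\<^sub>F x in at_right 0. 2 / pi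
      * (((bessel_J0 x - 1) / x) * (x * (ln (x / 2) + euler_mascheroni)) - power_series_sum Y0_coeff (x\<^sup>2 / 4))
      = bessel_Y0 x - 2 / pi * (ln (x / 2) + euler_mascheroni)"
      by (auto simp: eventually_at_right_field bessel_Y0_eq_power_series_sum
        bessel_J0_eq_power_series_sum[symmetric] field_simps intro!: exI[of _ 1])
  qed
qed

section \<open>The exponentially damped integral and its logarithmic singularity\<close>

lemma set_integrable_FTC_atLeast_nonneg:
  fixes f F :: "real \<Rightarrow> real"
  assumes [measurable]: "f \<in> borel_measurable borel"
    and F: "\<And>x. a \<le> x \<Longrightarrow> (F has_real_derivative f x) (at x)"
    and nn: "\<And>x. a \<le> x \<Longrightarrow> 0 \<le> f x" and lim: "(F \<longlongrightarrow> T) at_top"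
  shows "set_integrable lborel {a..} f"
proof -
  have "(\<integral>\<^sup>+x. ennreal (f x) * indicator {a..} x \<partial>lborel) = T - F a"
    by (rule nn_integral_FTC_atLeast[OF assms])
  moreover have "(\<integral>\<^sup>+x. ennreal (norm (indicator {a..} x *\<^sub>R f x)) \<partial>lborel)
    = (\<integral>\<^sup>+x. ennreal (f x) * indicator {a..} x \<partial>lborel)"
    by (intro nn_integral_cong) (auto simp: indicator_def nn)
  ultimately show ?thesis
    unfolding set_integrable_def by (intro integrableI_bounded) auto
qed

lemma set_integrable_inverse_one_plus_sq: "set_integrable lborel {0..} (\<lambda>u::real. 1 / (1 + u\<^sup>2))"
  by (rule set_integrable_FTC_atLeast_nonneg[where F=arctan])
    (auto intro!: derivative_eq_intros tendsto_arctan_at_top simp: inverse_eq_divide)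

lemma set_integrable_exp_decay:
  fixes c :: real
  assumes "c > 0"
  shows "set_integrable lborel {0..} (\<lambda>u. exp (- c * u))"
proof (rule set_integrable_FTC_atLeast_nonneg)
  show "((\<lambda>u. - exp (- c * u) / c) has_real_derivative exp (- c * x)) (at x)" for x
    using assms by (auto intro!: derivative_eq_intros)
  show "((\<lambda>u. - exp (- c * u) / c) \<longlongrightarrow> 0) at_top"
    using assms by real_asymp
qed auto

lemma set_integrable_bound_exp_decay:
  fixes f :: "real \<Rightarrow> 'b::{banach,second_countable_topology}"
  assumes "c > 0" and [measurable]: "f \<in> borel_measurable borel"
    and b: "\<And>u. u \<ge> 0 \<Longrightarrow> norm (f u) \<le> K * exp (- c * u)"
  shows "set_integrable lborel {0..} f"
  unfolding set_integrable_def
proof (rule Bochner_Integration.integrable_bound)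
  show "integrable lborel (\<lambda>u. K * (indicator {0..} u *\<^sub>R exp (- c * u)))"
    using set_integrable_exp_decay[OF assms(1)] unfolding set_integrable_def by (rule integrable_mult_right)
  show "AE u in lborel. norm (indicator {0..} u *\<^sub>R f u) \<le> norm (K * (indicator {0..} u *\<^sub>R exp (- c * u)))"
    using b by (intro AE_I2) (force simp: indicator_def)
qed auto

text \<open>
  The exponentially damped part of \<open>-\<pi>/2 Y\<^sub>0\<close>, with its first and second derivatives.
\<close>

definition decay_integral where "decay_integral x = (LINT u:{0..}|lborel. exp (- x * u) / sqrt (1 + u\<^sup>2))"
definition decay_integral' where "decay_integral' x = (LINT u:{0..}|lborel. - u * exp (- x * u) / sqrt (1 + u\<^sup>2))"
definition decay_integral'' where "decay_integral'' x
  = (LINT u:{0..}|lborel. u\<^sup>2 * exp (- x * u) / sqrt (1 + u\<^sup>2))"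

lemma sqrt_one_plus_sq: "1 \<le> sqrt (1 + u\<^sup>2)" "u \<le> sqrt (1 + u\<^sup>2)" "0 < sqrt (1 + u\<^sup>2)"
  by (simp, simp add: real_le_rsqrt, simp add: add_pos_nonneg)

lemma one_plus_sq_ne [simp]: "1 + u\<^sup>2 \<noteq> 0" "\<not> 1 + u\<^sup>2 < 0" for u :: real
  by (simp_all add: add_nonneg_eq_0_iff not_less)

lemma decay_integrand_integrable:
  assumes "x > 0" shows "set_integrable lborel {0..} (\<lambda>u. exp (- x * u) / sqrt (1 + u\<^sup>2))"
proof (rule set_integrable_bound_exp_decay[where c=x and K=1])
  show "norm (exp (- x * u) / sqrt (1 + u\<^sup>2)) \<le> 1 * exp (- x * u)" for u
  proof -
    have "exp (- x * u) / sqrt (1 + u\<^sup>2) \<le> exp (- x * u) / 1"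
      by (rule divide_left_mono) (use sqrt_one_plus_sq[of u] in auto)
    then show ?thesis using sqrt_one_plus_sq(3)[of u] by simp
  qed
qed (use assms in auto)

lemma decay_integral_deriv:
  assumes "x > 0"
  shows "set_integrable lborel {0..} (\<lambda>u. - u * exp (- x * u) / sqrt (1 + u\<^sup>2))"
    "(decay_integral has_real_derivative decay_integral' x) (at x)"
    "set_integrable lborel {0..} (\<lambda>u. u\<^sup>2 * exp (- x * u) / sqrt (1 + u\<^sup>2))"
    "(decay_integral' has_real_derivative decay_integral'' x) (at x)"
proof -
  have S: "open {x / 2<..}" "convex {x / 2<..}" "x \<in> {x / 2<..}" using assms by auto
  have b1: "norm (- u * exp (- z * u) / sqrt (1 + u\<^sup>2)) \<le> exp (- (x / 2) * u)"
    if "z \<in> {x / 2<..}" "u \<in> {0..}" for z u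
  proof -
    have "norm (- u * exp (- z * u) / sqrt (1 + u\<^sup>2)) = (u / sqrt (1 + u\<^sup>2)) * exp (- z * u)"
      using that sqrt_one_plus_sq[of u] by (simp add: abs_mult)
    also have "\<dots> \<le> 1 * exp (- (x / 2) * u)"
      using that sqrt_one_plus_sq[of u] mult_right_mono[of "x / 2" z u]
        by (intro mult_mono) (auto simp: divide_le_eq)
    finally show ?thesis by simp
  qed
  have d1: "((\<lambda>z. exp (- z * u) / sqrt (1 + u\<^sup>2)) has_vector_derivative - u * exp (- z * u) / sqrt (1 + u\<^sup>2))
    (at z)" for z u
    unfolding has_real_derivative_iff_has_vector_derivative[symmetric]
    by (rule DERIV_cdivide) (auto intro!: derivative_eq_intros)
  have i0: "set_integrable lborel {0..} (\<lambda>u. exp (- z * u) / sqrt (1 + u\<^sup>2))" if "z \<in> {x / 2<..}" for z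
    using decay_integrand_integrable that assms by auto
  note L1 = has_vector_derivative_set_lebesgue_integral[OF S i0 d1 b1 set_integrable_exp_decay]
  show i1: "set_integrable lborel {0..} (\<lambda>u. - u * exp (- x * u) / sqrt (1 + u\<^sup>2))"
    by (rule L1(1)) (use assms in auto)
  show "(decay_integral has_real_derivative decay_integral' x) (at x)"
    unfolding has_real_derivative_iff_has_vector_derivative decay_integral_def[abs_def] decay_integral'_def
    by (rule L1(2)) (use assms in auto)
  have b2: "norm (u\<^sup>2 * exp (- z * u) / sqrt (1 + u\<^sup>2)) \<le> (4 / x) * exp (- (x / 4) * u)"
    if "z \<in> {x / 2<..}" "u \<in> {0..}" for z u
  proof -
    have "norm (u\<^sup>2 * exp (- z * u) / sqrt (1 + u\<^sup>2)) = (u / sqrt (1 + u\<^sup>2)) * (u * exp (- z * u))"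
      using that sqrt_one_plus_sq[of u] by (simp add: power2_eq_square)
    also have "\<dots> \<le> 1 * (((4 / x) * exp ((x / 4) * u)) * exp (- (x / 2) * u))"
    proof (intro mult_mono)
      have "(x / 4) * u \<le> exp ((x / 4) * u)" using exp_ge_add_one_self[of "(x / 4) * u"] by linarith
      then show "u \<le> (4 / x) * exp ((x / 4) * u)" using assms by (simp add: field_simps)
    qed (use that sqrt_one_plus_sq[of u] assms mult_right_mono[of "x / 2" z u] in \<open>auto simp: divide_le_eq\<close>)
    also have "\<dots> = (4 / x) * exp ((x / 4) * u + (- (x / 2) * u))"
      by (simp only: exp_add mult_1 mult.assoc)
    also have "(x / 4) * u + (- (x / 2) * u) = - (x / 4) * u" by simp
    finally show ?thesis .
  qed
  have d2: "((\<lambda>z. - u * exp (- z * u) / sqrt (1 + u\<^sup>2))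
    has_vector_derivative u\<^sup>2 * exp (- z * u) / sqrt (1 + u\<^sup>2)) (at z)" for z u
    unfolding has_real_derivative_iff_has_vector_derivative[symmetric]
    by (rule DERIV_cdivide) (auto intro!: derivative_eq_intros simp: power2_eq_square)
  have i1': "set_integrable lborel {0..} (\<lambda>u. - u * exp (- z * u) / sqrt (1 + u\<^sup>2))" if "z \<in> {x / 2<..}" for z
  proof (rule set_integrable_bound_exp_decay[where c="x/2" and K=1])
    show "norm (- u * exp (- z * u) / sqrt (1 + u\<^sup>2)) \<le> 1 * exp (- (x / 2) * u)" if "u \<ge> 0" for u
      using b1[of z u] that \<open>z \<in> {x / 2<..}\<close> by simp
  qed (use assms in auto)
  have g2: "set_integrable lborel {0..} (\<lambda>u. (4 / x) * exp (- (x / 4) * u))"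
    using set_integrable_exp_decay[of "x / 4"] assms by (intro set_integrable_mult_right) auto
  note L2 = has_vector_derivative_set_lebesgue_integral[OF S i1' d2 b2 g2]
  show "set_integrable lborel {0..} (\<lambda>u. u\<^sup>2 * exp (- x * u) / sqrt (1 + u\<^sup>2))"
    by (rule L2(1)) (use assms in auto)
  show "(decay_integral' has_real_derivative decay_integral'' x) (at x)"
    unfolding has_real_derivative_iff_has_vector_derivative decay_integral'_def[abs_def] decay_integral''_def
    by (rule L2(2)) (use assms in auto)
qed

text \<open>
  The integrand of the left-hand side is the derivative of \<open>-\<surd>(1 + u\<^sup>2) exp(-x u)\<close>.
\<close>

lemma decay_integral_ode:
  assumes x: "x > 0"
  shows "x * decay_integral'' x + decay_integral' x + x * decay_integral x = 1"
proof -
  note i = set_integrable_mult_right[where a=x, OF decay_integral_deriv(3)[OF x]]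
    decay_integral_deriv(1)[OF x] set_integrable_mult_right[where a=x, OF decay_integrand_integrable[OF x]]
  let ?f = "\<lambda>u. x * (u\<^sup>2 * exp (- x * u) / sqrt (1 + u\<^sup>2)) + - u * exp (- x * u) / sqrt (1 + u\<^sup>2)
      + x * (exp (- x * u) / sqrt (1 + u\<^sup>2))"
  have fi: "set_integrable lborel {0..} ?f" by (intro set_integral_add i)
  have "(LINT u:{0..}|lborel. ?f u) = x * decay_integral'' x + decay_integral' x + x * decay_integral x"
    unfolding set_integral_add(2)[OF set_integral_add(1)[OF i(1,2)] i(3)] set_integral_add(2)[OF i(1,2)]
      set_integral_mult_right decay_integral_def decay_integral'_def decay_integral''_def ..
  then have "x * decay_integral'' x + decay_integral' x + x * decay_integral x = (LINT u:{0..}|lborel. ?f u)" ..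
  also have "\<dots> = 0 - (- sqrt (1 + 0\<^sup>2) * exp (- x * 0))"
  proof (rule integral_FTC_atLeast[where F="\<lambda>u. - sqrt (1 + u\<^sup>2) * exp (- x * u)"])
    fix u :: real assume "0 \<le> u"
    have s: "sqrt (1 + u\<^sup>2) * sqrt (1 + u\<^sup>2) = 1 + u\<^sup>2" by simp
    have "((\<lambda>u. - sqrt (1 + u\<^sup>2) * exp (- x * u)) has_real_derivative
      (- u / sqrt (1 + u\<^sup>2) * exp (- x * u) + x * sqrt (1 + u\<^sup>2) * exp (- x * u))) (at u)"
      using sqrt_one_plus_sq(3)[of u] by (auto intro!: derivative_eq_intros simp: field_simps add_pos_nonneg)
    also have "x * sqrt (1 + u\<^sup>2) = x * (1 + u\<^sup>2) / sqrt (1 + u\<^sup>2)"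
      using sqrt_one_plus_sq(3)[of u] s by (simp add: field_simps)
    also have "- u / sqrt (1 + u\<^sup>2) * exp (- x * u) + x * (1 + u\<^sup>2) / sqrt (1 + u\<^sup>2) * exp (- x * u) = ?f u"
      by (simp add: add_divide_distrib algebra_simps)
    finally show "((\<lambda>u. - sqrt (1 + u\<^sup>2) * exp (- x * u)) has_vector_derivative ?f u) (at u)"
      by (simp add: has_real_derivative_iff_has_vector_derivative)
  next
    show "continuous_on {0..} ?f"
      by (intro continuous_intros) auto
    show "((\<lambda>u. - sqrt (1 + u\<^sup>2) * exp (- x * u)) \<longlongrightarrow> 0) at_top"
      using x by real_asymp
  qed (rule fi)
  finally show ?thesis by simp
qed


text \<open>
  A step function with the same behaviour at infinity as \<open>1/\<surd>(1 + u\<^sup>2)\<close>. Its integrals over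
  \<open>[0, n)\<close> are the harmonic numbers, and its Laplace transform is elementary.
\<close>

definition harmonic_step :: "real \<Rightarrow> real" where "harmonic_step u = 1 / (1 + of_int \<lfloor>u\<rfloor>)"

lemma harmonic_step_measurable [measurable]: "harmonic_step \<in> borel_measurable borel"
  unfolding harmonic_step_def by measurable

text \<open>
  Both functions lie above \<open>1/(1 + u)\<close> and exceed it by at most \<open>2/(1 + u\<^sup>2)\<close>.
\<close>

lemma harmonic_step_bound:
  assumes "u \<ge> 0"
  shows "0 < harmonic_step u" "harmonic_step u \<le> 1"
    "\<bar>1 / sqrt (1 + u\<^sup>2) - harmonic_step u\<bar> \<le> 2 / (1 + u\<^sup>2)"
proof -
  define k where "k = real_of_int \<lfloor>u\<rfloor>"
  have hk: "harmonic_step u = 1 / (1 + k)" by (simp add: harmonic_step_def k_def)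
  have f: "0 \<le> k" "k \<le> u" "u < k + 1" 
    using assms by (simp_all add: k_def floor_correct)
  have k1: "1 \<le> 1 + k" using f(1) by linarith
  show "0 < harmonic_step u"
    unfolding hk by (rule divide_pos_pos) (use k1 in linarith)+
  show "harmonic_step u \<le> 1"
    unfolding hk using frac_le[OF _ _ _ k1, of 1 1] by simp
  have u2: "1 + u\<^sup>2 \<le> (1 + u)\<^sup>2" using assms by (simp add: power2_eq_square algebra_simps)
  define s where "s = sqrt (1 + u\<^sup>2)"
  have s: "s \<ge> 1" "s \<ge> u" "s * s = 1 + u\<^sup>2" "s \<le> 1 + u"
    using sqrt_one_plus_sq[of u] u2 assms by (auto simp: s_def real_le_lsqrt)
  have u2p: "0 < 1 + u\<^sup>2" by (simp add: add_pos_nonneg)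
  have "1 / s - 1 / (1 + u) = (1 + u - s) / (s * (1 + u))"
    using s assms by (simp add: field_simps)
  also have "\<dots> \<le> 1 / (s * s)"
    using s assms u2p by (intro frac_le mult_left_mono) auto
  finally have 1: "1 / s - 1 / (1 + u) \<le> 1 / (1 + u\<^sup>2)" by (simp only: s(3))
  have 2: "1 / s - 1 / (1 + u) \<ge> 0" using frac_le[of 1 1 s "1 + u"] s by simp
  have "harmonic_step u - 1 / (1 + u) = (u - k) / ((1 + k) * (1 + u))"
    using f assms by (simp add: hk field_simps)
  also have "\<dots> \<le> 1 / (((1 + u) / 2) * (1 + u))"
  proof (rule frac_le)
    show "u - k \<le> 1" using f by linarith
    show "0 < (1 + u) / 2 * (1 + u)" using assms by (intro mult_pos_pos) auto
    have "1 + u \<le> (1 + k) * 2" using f by simp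
    then have "(1 + u) / 2 \<le> 1 + k" by simp
    then show "(1 + u) / 2 * (1 + u) \<le> (1 + k) * (1 + u)"
      by (rule mult_right_mono) (use assms in auto)
  qed simp
  also have "\<dots> = 2 / (1 + u)\<^sup>2" using assms by (simp add: power2_eq_square)
  also have "\<dots> \<le> 2 / (1 + u\<^sup>2)" using u2 u2p by (intro frac_le) auto
  finally have 3: "harmonic_step u - 1 / (1 + u) \<le> 2 / (1 + u\<^sup>2)" .
  have 4: "harmonic_step u - 1 / (1 + u) \<ge> 0" using f assms by (simp add: hk frac_le)
  have "1 / (1 + u\<^sup>2) \<le> 2 / (1 + u\<^sup>2)" by (simp add: divide_right_mono)
  then show "\<bar>1 / sqrt (1 + u\<^sup>2) - harmonic_step u\<bar> \<le> 2 / (1 + u\<^sup>2)"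
    using 1 2 3 4 unfolding s_def by linarith
qed

lemma integral_harmonic_step:
  fixes h F :: "real \<Rightarrow> real"
  assumes h: "continuous_on UNIV h" and F: "\<And>x. (F has_real_derivative h x) (at x)"
  shows "set_integrable lborel {0..<real n} (\<lambda>u. harmonic_step u * h u)"
    and "(LINT u:{0..<real n}|lborel. harmonic_step u * h u)
      = (\<Sum>m<n. (F (real m + 1) - F (real m)) / (real m + 1))"
proof (induction n)
  case 0
  show "set_integrable lborel {0..<real 0} (\<lambda>u. harmonic_step u * h u)"
    "(LINT u:{0..<real 0}|lborel. harmonic_step u * h u) = (\<Sum>m<0. (F (real m + 1) - F (real m)) / (real m + 1))"
    by (simp_all add: set_integrable_def set_lebesgue_integral_def)
next
  case (Suc n)
  have un: "{0..<real (Suc n)} = {0..<real n} \<union> {real n..<real n + 1}" by auto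
  have eq: "indicat_real {real n..<real n + 1} u *\<^sub>R (harmonic_step u * h u)
    = (1 / (real n + 1)) * (indicat_real {real n..<real n + 1} u *\<^sub>R h u)" for u
  proof (cases "u \<in> {real n..<real n + 1}")
    case True
    then have "\<lfloor>u\<rfloor> = int n" by (simp add: floor_eq_iff)
    then show ?thesis by (simp add: harmonic_step_def add.commute)
  qed simp
  have hi: "set_integrable lborel {real n..real n + 1} h"
    by (rule borel_integrable_atLeastAtMost') (use h continuous_on_subset in blast)
  have hi': "set_integrable lborel {real n..<real n + 1} h"
    by (rule set_integrable_subset[OF hi]) auto
  have i: "set_integrable lborel {real n..<real n + 1} (\<lambda>u. harmonic_step u * h u)"
    unfolding set_integrable_def eq
    by (rule integrable_mult_right) (use hi' in \<open>simp add: set_integrable_def\<close>)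
  have "(LINT u:{real n..<real n + 1}|lborel. h u) = (LINT u:{real n..real n + 1}|lborel. h u)"
    using interval_integral_Ico[of "real n" "real n + 1" h] interval_integral_Icc[of "real n" "real n + 1" h]
      by simp
  also have "\<dots> = F (real n + 1) - F (real n)"
    unfolding set_lebesgue_integral_def
    by (rule integral_FTC_atLeastAtMost)
      (use F in \<open>auto simp: has_real_derivative_iff_has_vector_derivative[symmetric] intro:
        has_field_derivative_at_within continuous_on_subset[OF h]\<close>)
  finally have v: "(LINT u:{real n..<real n + 1}|lborel. harmonic_step u * h u)
    = (F (real n + 1) - F (real n)) / (real n + 1)"
    unfolding set_lebesgue_integral_def eq by simp
  show "set_integrable lborel {0..<real (Suc n)} (\<lambda>u. harmonic_step u * h u)"
    unfolding un by (rule set_integrable_Un[OF Suc(1) i]) auto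
  show "(LINT u:{0..<real (Suc n)}|lborel. harmonic_step u * h u)
    = (\<Sum>m<Suc n. (F (real m + 1) - F (real m)) / (real m + 1))"
    unfolding un by (subst set_integral_Un) (use Suc i v in auto)
qed

lemma tendsto_set_integral_nat:
  fixes f :: "real \<Rightarrow> 'b::{banach,second_countable_topology}"
  assumes f: "set_integrable lborel {0..} f"
  shows "(\<lambda>n. LINT u:{0..<real n}|lborel. f u) \<longlonglongrightarrow> (LINT u:{0..}|lborel. f u)"
proof -
  have un: "(\<Union>n. {0..<real n}) = {0..}"
  proof (intro equalityI subsetI)
    fix x :: real assume "x \<in> {0..}"
    then show "x \<in> (\<Union>n. {0..<real n})" using reals_Archimedean2[of x] by auto
  qed auto
  have "(\<lambda>n. LINT u:{0..<real n}|lborel. f u) \<longlonglongrightarrow> (LINT u:(\<Union>n. {0..<real n})|lborel. f u)"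
    by (rule set_integral_cont_up) (use f un in \<open>auto simp: incseq_def\<close>)
  then show ?thesis by (simp only: un)
qed

text \<open>
  With \<open>q = exp(-x)\<close>, summation over the steps leads to the series of \<open>ln (1 - q)\<close>.
\<close>

lemma integral_harmonic_step_exp:
  assumes x: "x > 0"
  shows "set_integrable lborel {0..} (\<lambda>u. harmonic_step u * exp (- x * u))"
    and "(LINT u:{0..}|lborel. harmonic_step u * exp (- x * u))
      = - ln (1 - exp (- x)) * (1 - exp (- x)) / (exp (- x) * x)"
proof -
  show i: "set_integrable lborel {0..} (\<lambda>u. harmonic_step u * exp (- x * u))"
    using harmonic_step_bound
    by (intro set_integrable_bound_exp_decay[OF x, where K=1]) (auto simp: abs_mult abs_of_pos)
  define q where "q = exp (- x)"
  have q: "0 < q" "q < 1" using x by (auto simp: q_def)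
  have "(\<lambda>n. LINT u:{0..<real n}|lborel. harmonic_step u * exp (- x * u))
    = (\<lambda>n. \<Sum>m<n. (1 - q) / (q * x) * (q ^ Suc m / (real m + 1)))"
  proof
    fix n
    have "(LINT u:{0..<real n}|lborel. harmonic_step u * exp (- x * u)) =
      (\<Sum>m<n. (- exp (- x * (real m + 1)) / x - (- exp (- x * real m) / x)) / (real m + 1))"
      by (rule integral_harmonic_step) (use x in \<open>auto intro!: derivative_eq_intros continuous_intros\<close>)
    also have "\<dots> = (\<Sum>m<n. (1 - q) / (q * x) * (q ^ Suc m / (real m + 1)))"
    proof (rule sum.cong[OF refl])
      fix m
      have "exp (- x * real m) = q ^ m" by (simp add: q_def exp_of_nat_mult[symmetric] mult.commute)
      moreover have "exp (- x * (real m + 1)) = q ^ Suc m"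
        by (simp add: q_def exp_of_nat_mult[symmetric] exp_add[symmetric] algebra_simps)
      ultimately show "(- exp (- x * (real m + 1)) / x - (- exp (- x * real m) / x)) / (real m + 1)
        = (1 - q) / (q * x) * (q ^ Suc m / (real m + 1))"
        using q x by (simp add: divide_simps) (simp add: algebra_simps)
    qed
    finally show "(LINT u:{0..<real n}|lborel. harmonic_step u * exp (- x * u))
      = (\<Sum>m<n. (1 - q) / (q * x) * (q ^ Suc m / (real m + 1)))" .
  qed
  moreover have "(\<lambda>n. \<Sum>m<n. (1 - q) / (q * x) * (q ^ Suc m / (real m + 1))) \<longlonglongrightarrow> (1 - q) / (q * x) * (- ln (1 - q))"
  proof -
    have "(\<lambda>n. - ((- (-q)) ^ n) / of_nat n) sums ln (1 + (-q))"
      by (rule ln_series') (use q in auto)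
    then have "(\<lambda>n. - (q ^ n / real n)) sums ln (1 - q)" by simp
    then have "(\<lambda>n. - (q ^ Suc n / real (Suc n))) sums ln (1 - q)"
      by (subst sums_Suc_iff) simp
    then have "(\<lambda>n. - (- (q ^ Suc n / real (Suc n)))) sums (- ln (1 - q))" by (rule sums_minus)
    then have "(\<lambda>n. q ^ Suc n / (real n + 1)) sums (- ln (1 - q))" by (simp add: add.commute)
    then show ?thesis unfolding sums_def[symmetric] by (rule sums_mult)
  qed
  ultimately have "(\<lambda>n. LINT u:{0..<real n}|lborel. harmonic_step u * exp (- x * u))
    \<longlonglongrightarrow> (1 - q) / (q * x) * (- ln (1 - q))"
    by simp
  from LIMSEQ_unique[OF tendsto_set_integral_nat[OF i] this]
  show "(LINT u:{0..}|lborel. harmonic_step u * exp (- x * u))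
    = - ln (1 - exp (- x)) * (1 - exp (- x)) / (exp (- x) * x)"
    by (simp add: q_def)
qed

text \<open>
  The integral over \<open>[0, n)\<close> is \<open>arsinh n - H\<^sub>n\<close>, and \<open>arsinh n - ln n\<close> tends to \<open>ln 2\<close>.
\<close>

lemma integral_arsinh_minus_harmonic:
  shows "set_integrable lborel {0..} (\<lambda>u. 1 / sqrt (1 + u\<^sup>2) - harmonic_step u)"
    and "(LINT u:{0..}|lborel. 1 / sqrt (1 + u\<^sup>2) - harmonic_step u) = ln 2 - euler_mascheroni"
proof -
  have g: "set_integrable lborel {0..} (\<lambda>u::real. 2 * (1 / (1 + u\<^sup>2)))"
    by (intro set_integrable_mult_right set_integrable_inverse_one_plus_sq)
  show i: "set_integrable lborel {0..} (\<lambda>u. 1 / sqrt (1 + u\<^sup>2) - harmonic_step u)"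
    unfolding set_integrable_def
    by (rule Bochner_Integration.integrable_bound[OF g[unfolded set_integrable_def]])
      (use harmonic_step_bound(3) in \<open>auto simp: indicator_def intro!: AE_I2\<close>)
  have "(LINT u:{0..<real n}|lborel. 1 / sqrt (1 + u\<^sup>2) - harmonic_step u) = arsinh (real n) - harm n" for n
  proof -
    have s0: "continuous_on {0..real n} (\<lambda>u. 1 / sqrt (1 + u\<^sup>2))"
      by (intro continuous_intros) auto
    have s1: "set_integrable lborel {0..real n} (\<lambda>u. 1 / sqrt (1 + u\<^sup>2))"
      by (rule borel_integrable_atLeastAtMost'[OF s0])
    have s2: "set_integrable lborel {0..<real n} (\<lambda>u. 1 / sqrt (1 + u\<^sup>2))"
      by (rule set_integrable_subset[OF s1]) auto
    have "(LINT u:{0..<real n}|lborel. 1 / sqrt (1 + u\<^sup>2)) = (LINT u:{0..real n}|lborel. 1 / sqrt (1 + u\<^sup>2))"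
      using interval_integral_Ico[of 0 "real n" "\<lambda>u. 1 / sqrt (1 + u\<^sup>2)"]
        interval_integral_Icc[of 0 "real n" "\<lambda>u. 1 / sqrt (1 + u\<^sup>2)"] by simp
    also have "\<dots> = arsinh (real n) - arsinh 0"
      unfolding set_lebesgue_integral_def
      by (rule integral_FTC_atLeastAtMost[OF _ _ s0])
        (auto simp: has_real_derivative_iff_has_vector_derivative[symmetric] add.commute intro!:
          derivative_eq_intros)
    finally have a: "(LINT u:{0..<real n}|lborel. 1 / sqrt (1 + u\<^sup>2)) = arsinh (real n)" by simp
    have h: "(LINT u:{0..<real n}|lborel. harmonic_step u * 1) = (\<Sum>m<n. (real m + 1 - real m) / (real m + 1))"
      "set_integrable lborel {0..<real n} (\<lambda>u. harmonic_step u * 1)"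
      by (rule integral_harmonic_step; auto intro!: derivative_eq_intros)+
    have "(\<Sum>m<n. (real m + 1 - real m) / (real m + 1)) = harm n"
      by (simp add: harm_def sum.atLeast1_atMost_eq inverse_eq_divide add.commute)
    then show ?thesis using h a s2 by (simp add: set_integral_diff)
  qed
  then have 1: "(\<lambda>n. arsinh (real n) - harm n) \<longlonglongrightarrow> (LINT u:{0..}|lborel. 1 / sqrt (1 + u\<^sup>2) - harmonic_step u)"
    using tendsto_set_integral_nat[OF i] by simp
  have "(\<lambda>n. (arsinh (real n) - ln (real n)) - (harm n - ln (real n))) \<longlonglongrightarrow> ln 2 - euler_mascheroni"
  proof (intro tendsto_diff euler_mascheroni_LIMSEQ)
    have "((\<lambda>n. ln (real n + sqrt ((real n)\<^sup>2 + 1)) - ln (real n)) \<longlonglongrightarrow> ln 2)" by real_asymp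
    then show "(\<lambda>n. arsinh (real n) - ln (real n)) \<longlonglongrightarrow> ln 2" by (simp add: arsinh_real_def)
  qed
  then have "(\<lambda>n. arsinh (real n) - harm n) \<longlonglongrightarrow> ln 2 - euler_mascheroni" by simp
  from LIMSEQ_unique[OF 1 this]
  show "(LINT u:{0..}|lborel. 1 / sqrt (1 + u\<^sup>2) - harmonic_step u) = ln 2 - euler_mascheroni" .
qed

text \<open>
  Splitting off the step function leaves an integrable function, to which dominated convergence
  applies; the transform of the step function is known exactly and accounts for the logarithm.
\<close>

lemma decay_integral_at_0: "((\<lambda>x. decay_integral x + ln x) \<longlongrightarrow> ln 2 - euler_mascheroni) (at_right 0)"
proof -
  let ?d = "\<lambda>u::real. 1 / sqrt (1 + u\<^sup>2) - harmonic_step u"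
  have m: "?d \<in> borel_measurable borel" by measurable
  have lim: "((\<lambda>x. LINT u:{0..}|lborel. exp (- x * u) * ?d u) \<longlongrightarrow> (LINT u:{0..}|lborel. ?d u)) (at 0 within {0<..})"
    unfolding tendsto_at_iff_sequentially o_def set_lebesgue_integral_def
  proof (intro allI impI)
    fix X :: "nat \<Rightarrow> real"
    assume X: "\<forall>i. X i \<in> {0<..} - {0}" "X \<longlonglongrightarrow> 0"
    show "(\<lambda>n. LINT u|lborel. indicat_real {0..} u *\<^sub>R (exp (- X n * u) * ?d u))
      \<longlonglongrightarrow> (LINT u|lborel. indicat_real {0..} u *\<^sub>R ?d u)"
    proof (rule integral_dominated_convergence[where w="\<lambda>u. norm (indicat_real {0..} u *\<^sub>R ?d u)"])
      show "integrable lborel (\<lambda>u. norm (indicat_real {0..} u *\<^sub>R ?d u))"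
        using integral_arsinh_minus_harmonic(1) unfolding set_integrable_def by (rule integrable_norm)
      show "AE u in lborel. (\<lambda>n. indicat_real {0..} u *\<^sub>R (exp (- X n * u) * ?d u))
        \<longlonglongrightarrow> indicat_real {0..} u *\<^sub>R ?d u"
      proof (rule AE_I2)
        fix u
        have "(\<lambda>n. indicat_real {0..} u *\<^sub>R (exp (- X n * u) * ?d u))
          \<longlonglongrightarrow> indicat_real {0..} u *\<^sub>R (exp (- 0 * u) * ?d u)"
          by (intro tendsto_intros X)
        then show "(\<lambda>n. indicat_real {0..} u *\<^sub>R (exp (- X n * u) * ?d u))
          \<longlonglongrightarrow> indicat_real {0..} u *\<^sub>R ?d u" by simp
      qed
      show "AE u in lborel. norm (indicat_real {0..} u *\<^sub>R (exp (- X n * u) * ?d u))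
        \<le> norm (indicat_real {0..} u *\<^sub>R ?d u)" for n
      proof (rule AE_I2)
        fix u
        have "u \<ge> 0 \<Longrightarrow> exp (- X n * u) \<le> 1" using X(1) by (simp add: less_imp_le)
        then show "norm (indicat_real {0..} u *\<^sub>R (exp (- X n * u) * ?d u))
          \<le> norm (indicat_real {0..} u *\<^sub>R ?d u)"
          by (auto simp: indicator_def abs_mult mult_left_le_one_le)
      qed
    qed measurable
  qed
  have "((\<lambda>x::real. ln x - ln (1 - exp (- x)) * (1 - exp (- x)) / (exp (- x) * x)) \<longlongrightarrow> 0) (at_right 0)"
    by real_asymp
  from tendsto_add[OF lim this]
  have "((\<lambda>x. (LINT u:{0..}|lborel. exp (- x * u) * ?d u)
    + (ln x - ln (1 - exp (- x)) * (1 - exp (- x)) / (exp (- x) * x)))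
    \<longlongrightarrow> ln 2 - euler_mascheroni) (at_right 0)"
    by (simp add: integral_arsinh_minus_harmonic(2))
  then show ?thesis
  proof (rule Lim_transform_eventually)
    have "(LINT u:{0..}|lborel. exp (- x * u) * ?d u)
      + (ln x - ln (1 - exp (- x)) * (1 - exp (- x)) / (exp (- x) * x)) = decay_integral x + ln x"
      if "x > 0" for x
    proof -
      have "(LINT u:{0..}|lborel. exp (- x * u) * ?d u)
        = (LINT u:{0..}|lborel. exp (- x * u) / sqrt (1 + u\<^sup>2) - harmonic_step u * exp (- x * u))"
        by (simp add: algebra_simps)
      also have "\<dots> = decay_integral x - (- ln (1 - exp (- x)) * (1 - exp (- x)) / (exp (- x) * x))"
        unfolding decay_integral_def integral_harmonic_step_exp(2)[OF that, symmetric]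
        by (rule set_integral_diff(2)[OF decay_integrand_integrable[OF that]
          integral_harmonic_step_exp(1)[OF that]])
      finally show ?thesis by simp
    qed
    then show "\<forall>\<^sub>F x in at_right 0. (LINT u:{0..}|lborel. exp (- x * u) * ?d u)
      + (ln x - ln (1 - exp (- x)) * (1 - exp (- x)) / (exp (- x) * x)) = decay_integral x + ln x"
      by (auto simp: eventually_at_right_field intro!: exI[of _ 1])
  qed
qed

section \<open>Integral representation of the Hankel function\<close>

lemma arc_set_integrable: "continuous_on UNIV f \<Longrightarrow> set_integrable lborel {0..pi/2} (f :: real \<Rightarrow> real)"
  by (rule borel_integrable_atLeastAtMost') (auto intro: continuous_on_subset)

lemma arc_integral_deriv:
  fixes g g' :: "real \<Rightarrow> real" and c :: "real \<Rightarrow> real"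
  assumes g: "\<And>y. (g has_real_derivative g' y) (at y)" and g'b: "\<And>y. \<bar>g' y\<bar> \<le> 1"
    and c: "continuous_on UNIV c" "\<And>t. \<bar>c t\<bar> \<le> 1" and g': "continuous_on UNIV g'"
  shows "((\<lambda>x. LINT t:{0..pi/2}|lborel. c t * g (x * cos t)) has_real_derivative
    (LINT t:{0..pi/2}|lborel. c t * cos t * g' (x * cos t))) (at x)"
  unfolding has_real_derivative_iff_has_vector_derivative
proof (rule has_vector_derivative_set_lebesgue_integral(2)[where S=UNIV and g="\<lambda>_. 1"])
  have gc: "continuous_on UNIV g" using g DERIV_isCont continuous_at_imp_continuous_on by blast
  show "set_integrable lborel {0..pi/2} (\<lambda>t. c t * g (z * cos t))" for z
    by (intro arc_set_integrable continuous_intros c continuous_on_compose2[OF gc]) auto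
  show "((\<lambda>z. c t * g (z * cos t)) has_vector_derivative c t * cos t * g' (z * cos t)) (at z)" for z t
    unfolding has_real_derivative_iff_has_vector_derivative[symmetric]
    by (rule derivative_eq_intros DERIV_chain2[OF g] refl)+ simp
  show "norm (c t * cos t * g' (z * cos t)) \<le> 1" for z t
  proof -
    have "norm (c t * cos t * g' (z * cos t)) \<le> 1 * 1 * 1"
      unfolding norm_mult by (intro mult_mono) (auto simp: c g'b)
    then show ?thesis by simp
  qed
  show "set_integrable lborel {0..pi/2} (\<lambda>_. 1::real)" by (intro arc_set_integrable continuous_intros)
qed auto

lemma arc_FTC:
  fixes f F :: "real \<Rightarrow> real"
  assumes F: "\<And>t. (F has_real_derivative f t) (at t)" and f: "continuous_on UNIV f"
  shows "(LINT t:{0..pi/2}|lborel. f t) = F (pi/2) - F 0"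
  unfolding set_lebesgue_integral_def
  by (rule integral_FTC_atLeastAtMost)
    (use F in \<open>auto simp: has_real_derivative_iff_has_vector_derivative[symmetric] intro:
      has_field_derivative_at_within continuous_on_subset[OF f]\<close>)

lemma arc_tendsto:
  fixes g :: "real \<Rightarrow> real"
  assumes g: "continuous_on UNIV g" and b: "\<And>y. \<bar>g y\<bar> \<le> 1"
  shows "((\<lambda>x. LINT t:{0..pi/2}|lborel. g (x * cos t)) \<longlongrightarrow> pi / 2 * g 0) (at_right 0)"
  unfolding tendsto_at_iff_sequentially o_def
proof (intro allI impI)
  fix X :: "nat \<Rightarrow> real" assume X: "\<forall>i. X i \<in> {0<..} - {0}" "X \<longlonglongrightarrow> 0"
  have "(\<lambda>n. LINT t|lborel. indicat_real {0..pi/2} t *\<^sub>R g (X n * cos t))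
    \<longlonglongrightarrow> (LINT t|lborel. indicat_real {0..pi/2} t *\<^sub>R g 0)"
  proof (rule integral_dominated_convergence[where w="indicat_real {0..pi/2}"])
    have [measurable]: "g \<in> borel_measurable borel" by (rule borel_measurable_continuous_onI[OF g])
    show "(\<lambda>t. indicat_real {0..pi/2} t *\<^sub>R g (X n * cos t)) \<in> borel_measurable lborel" for n by measurable
    show "AE t in lborel. (\<lambda>n. indicat_real {0..pi/2} t *\<^sub>R g (X n * cos t)) \<longlonglongrightarrow> indicat_real {0..pi/2} t *\<^sub>R g 0"
    proof (rule AE_I2)
      fix t
      have "(\<lambda>n. X n * cos t) \<longlonglongrightarrow> 0 * cos t" by (intro tendsto_intros X)
      then have "(\<lambda>n. g (X n * cos t)) \<longlonglongrightarrow> g (0 * cos t)"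
        by (rule continuous_on_tendsto_compose[OF g]) auto
      then show "(\<lambda>n. indicat_real {0..pi/2} t *\<^sub>R g (X n * cos t)) \<longlonglongrightarrow> indicat_real {0..pi/2} t *\<^sub>R g 0"
        by (intro tendsto_intros) simp
    qed
    show "AE t in lborel. norm (indicat_real {0..pi/2} t *\<^sub>R g (X n * cos t)) \<le> indicat_real {0..pi/2} t" for n
      using b by (intro AE_I2) (auto simp: indicator_def)
  qed auto
  then show "(\<lambda>n. LINT t:{0..pi/2}|lborel. g (X n * cos t)) \<longlonglongrightarrow> pi / 2 * g 0"
    by (simp add: set_lebesgue_integral_def)
qed

lemma arc_integral_bessel_operator:
  fixes f g h :: "real \<Rightarrow> real"
  assumes "continuous_on UNIV f" "continuous_on UNIV g" "continuous_on UNIV h"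
  shows "x * (LINT t:{0..pi/2}|lborel. f t) + (LINT t:{0..pi/2}|lborel. g t) + x * (LINT t:{0..pi/2}|lborel. h t)
    = (LINT t:{0..pi/2}|lborel. x * f t + g t + x * h t)"
  using assms by (simp add: set_integral_add arc_set_integrable continuous_intros)

text \<open>
  Applying the Bessel operator to \<open>cos (x cos t)\<close> gives the \<open>t\<close>-derivative of
  \<open>-sin t sin (x cos t)\<close>, which vanishes at both ends; the values at the origin agree.
\<close>

lemma bessel_J0_integral:
  assumes "x > 0"
  shows "bessel_J0 x = 2 / pi * (LINT t:{0..pi/2}|lborel. cos (x * cos t))"
proof -
  define C0 where "C0 x = (LINT t:{0..pi/2}|lborel. 1 * cos (x * cos t))" for x
  define C1 where "C1 x = (LINT t:{0..pi/2}|lborel. 1 * cos t * (- sin (x * cos t)))" for x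
  define C2 where "C2 x = (LINT t:{0..pi/2}|lborel. cos t * cos t * (- cos (x * cos t)))" for x
  have 1: "(C0 has_real_derivative C1 x) (at x)" for x
    unfolding C0_def C1_def
    by (rule arc_integral_deriv) (auto intro!: derivative_eq_intros continuous_intros)
  have "((\<lambda>x. LINT t:{0..pi/2}|lborel. cos t * - sin (x * cos t)) has_real_derivative C2 x) (at x)" for x
    unfolding C2_def
    by (rule arc_integral_deriv) (auto intro!: derivative_eq_intros continuous_intros)
  then have 2: "(C1 has_real_derivative C2 x) (at x)" for x
    unfolding C1_def by simp
  have 3: "x * C2 x + C1 x + x * C0 x = 0" for x
  proof -
    have "x * C2 x + C1 x + x * C0 x
      = (LINT t:{0..pi/2}|lborel. x * (cos t * cos t * (- cos (x * cos t))) + 1 * cos t * (- sin (x * cos t))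
        + x * (1 * cos (x * cos t)))"
      unfolding C0_def C1_def C2_def by (intro arc_integral_bessel_operator continuous_intros)
    also have "\<dots> = - sin (pi/2) * sin (x * cos (pi/2)) - (- sin 0 * sin (x * cos 0))"
    proof (rule arc_FTC)
      fix t
      have "x * (cos t * (cos t * w)) + x * (sin t * (sin t * w)) = x * w * (cos t * cos t + sin t * sin t)" for w
        by (simp only: algebra_simps)
      then have "x * (cos t * (cos t * w)) + x * (sin t * (sin t * w)) = x * w" for w
        by (simp only: sin_cos_squared_add3 mult_1_right)
      from this[of "cos (x * cos t)"] show "((\<lambda>t. - sin t * sin (x * cos t)) has_real_derivative
        x * (cos t * cos t * (- cos (x * cos t))) + 1 * cos t * (- sin (x * cos t))
          + x * (1 * cos (x * cos t))) (at t)"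
        by (auto intro!: derivative_eq_intros simp: algebra_simps)
    qed (intro continuous_intros)
    finally show ?thesis by simp
  qed
  have "bessel_J0 x - 2 / pi * C0 x = 0"
  proof (rule bessel_equation_unique[where D="\<lambda>x. bessel_J0 x - 2 / pi
    * C0 x" and D'="\<lambda>x. bessel_J0' x - 2 / pi * C1 x"
        and D''="\<lambda>x. bessel_J0'' x - 2 / pi * C2 x", OF _ _ _ _ assms])
    show "((\<lambda>x. bessel_J0 x - 2 / pi * C0 x) has_real_derivative bessel_J0' x - 2 / pi * C1 x) (at x)" for x
      by (intro DERIV_diff DERIV_cmult bessel_J0_ode 1)
    show "((\<lambda>x. bessel_J0' x - 2 / pi * C1 x) has_real_derivative bessel_J0'' x - 2 / pi * C2 x) (at x)" for x
      by (intro DERIV_diff DERIV_cmult bessel_J0_ode 2)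
    show "x * (bessel_J0'' x - 2 / pi * C2 x) + (bessel_J0' x - 2 / pi * C1 x)
      + x * (bessel_J0 x - 2 / pi * C0 x) = 0" for x
    proof -
      have "x * (bessel_J0'' x - 2 / pi * C2 x) + (bessel_J0' x - 2 / pi * C1 x)
        + x * (bessel_J0 x - 2 / pi * C0 x) =
        (x * bessel_J0'' x + bessel_J0' x + x * bessel_J0 x) - 2 / pi * (x * C2 x + C1 x + x * C0 x)"
        by (simp add: algebra_simps)
      then show ?thesis by (simp only: bessel_J0_ode(3) 3)
    qed
    have "(C0 \<longlongrightarrow> pi / 2 * cos 0) (at_right 0)"
      unfolding C0_def mult_1 by (rule arc_tendsto) (auto intro!: continuous_intros)
    from tendsto_diff[OF bessel_at_0(1) tendsto_mult[OF tendsto_const[of "2/pi"] this]]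
    show "((\<lambda>x. bessel_J0 x - 2 / pi * C0 x) \<longlongrightarrow> 0) (at_right 0)" by simp
  qed
  then show ?thesis by (simp add: C0_def)
qed

text \<open>
  Neither integral solves the homogeneous equation: each of them has the inhomogeneity \<open>1\<close>, coming
  from a boundary term, and these cancel in the difference. At the origin the first integral
  vanishes, and the second has the singularity of the series, including the constant term.
\<close>

lemma bessel_Y0_integral:
  assumes "x > 0"
  shows "bessel_Y0 x = 2 / pi * ((LINT t:{0..pi/2}|lborel. sin (x * cos t)) - decay_integral x)"
proof -
  define C0 where "C0 x = (LINT t:{0..pi/2}|lborel. 1 * sin (x * cos t))" for x
  define C1 where "C1 x = (LINT t:{0..pi/2}|lborel. 1 * cos t * (cos (x * cos t)))" for x
  define C2 where "C2 x = (LINT t:{0..pi/2}|lborel. cos t * cos t * (- sin (x * cos t)))" for x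
  have 1: "(C0 has_real_derivative C1 x) (at x)" for x
    unfolding C0_def C1_def
    by (rule arc_integral_deriv) (auto intro!: derivative_eq_intros continuous_intros)
  have "((\<lambda>x. LINT t:{0..pi/2}|lborel. cos t * cos (x * cos t)) has_real_derivative C2 x) (at x)" for x
    unfolding C2_def
    by (rule arc_integral_deriv) (auto intro!: derivative_eq_intros continuous_intros)
  then have 2: "(C1 has_real_derivative C2 x) (at x)" for x
    unfolding C1_def by simp
  have 3: "x * C2 x + C1 x + x * C0 x = 1" for x
  proof -
    have "x * C2 x + C1 x + x * C0 x
      = (LINT t:{0..pi/2}|lborel. x * (cos t * cos t * (- sin (x * cos t))) + 1 * cos t * (cos (x * cos t))
        + x * (1 * sin (x * cos t)))"
      unfolding C0_def C1_def C2_def by (intro arc_integral_bessel_operator continuous_intros)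
    also have "\<dots> = sin (pi/2) * cos (x * cos (pi/2)) - (sin 0 * cos (x * cos 0))"
    proof (rule arc_FTC)
      fix t
      have "x * (cos t * (cos t * w)) + x * (sin t * (sin t * w)) = x * w * (cos t * cos t + sin t * sin t)" for w
        by (simp only: algebra_simps)
      then have "x * (cos t * (cos t * w)) + x * (sin t * (sin t * w)) = x * w" for w
        by (simp only: sin_cos_squared_add3 mult_1_right)
      from this[of "sin (x * cos t)"] show "((\<lambda>t. sin t * cos (x * cos t)) has_real_derivative
        x * (cos t * cos t * (- sin (x * cos t))) + 1 * cos t * (cos (x * cos t)) + x * (1 * sin (x * cos t)))
          (at t)"
        by (auto intro!: derivative_eq_intros simp: algebra_simps)
    qed (intro continuous_intros)
    finally show ?thesis by simp
  qed
  have "bessel_Y0 x - 2 / pi * (C0 x - decay_integral x) = 0"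
  proof (rule bessel_equation_unique[where D="\<lambda>x. bessel_Y0 x - 2 / pi
    * (C0 x - decay_integral x)" and D'="\<lambda>x. bessel_Y0' x - 2 / pi * (C1 x - decay_integral' x)"
        and D''="\<lambda>x. bessel_Y0'' x - 2 / pi * (C2 x - decay_integral'' x)", OF _ _ _ _ assms])
    fix x :: real assume x: "x > 0"
    show "((\<lambda>x. bessel_Y0 x - 2 / pi * (C0 x - decay_integral x))
      has_real_derivative bessel_Y0' x - 2 / pi * (C1 x - decay_integral' x)) (at x)"
      by (intro DERIV_diff DERIV_cmult bessel_Y0_ode 1 decay_integral_deriv x)
    show "((\<lambda>x. bessel_Y0' x - 2 / pi * (C1 x - decay_integral' x))
      has_real_derivative bessel_Y0'' x - 2 / pi * (C2 x - decay_integral'' x)) (at x)"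
      by (intro DERIV_diff DERIV_cmult bessel_Y0_ode 2 decay_integral_deriv x)
    have "x * (bessel_Y0'' x - c * (C2 x - decay_integral'' x))
      + (bessel_Y0' x - c * (C1 x - decay_integral' x)) + x * (bessel_Y0 x - c * (C0 x - decay_integral x)) =
        (x * bessel_Y0'' x + bessel_Y0' x + x * bessel_Y0 x) - c
          * ((x * C2 x + C1 x + x * C0 x) - (x * decay_integral'' x + decay_integral' x
            + x * decay_integral x))" for c
      by (simp add: algebra_simps)
    then show "x * (bessel_Y0'' x - 2 / pi * (C2 x - decay_integral'' x))
      + (bessel_Y0' x - 2 / pi * (C1 x - decay_integral' x))
        + x * (bessel_Y0 x - 2 / pi * (C0 x - decay_integral x)) = 0"
      by (simp only: bessel_Y0_ode(3)[OF x] 3 decay_integral_ode[OF x]) simp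
  next
    have "(C0 \<longlongrightarrow> pi / 2 * sin 0) (at_right 0)"
      unfolding C0_def mult_1 by (rule arc_tendsto) (auto intro!: continuous_intros)
    then have "((\<lambda>x. 2 / pi * (C0 x)) \<longlongrightarrow> 2 / pi * 0) (at_right 0)"
      by (intro tendsto_intros) simp
    from tendsto_diff[OF tendsto_add[OF bessel_at_0(2)
      tendsto_mult[OF tendsto_const[of "2/pi"] decay_integral_at_0]] this]
    have *: "((\<lambda>x. bessel_Y0 x - 2 / pi * (ln (x / 2) + euler_mascheroni)
      + 2 / pi * (decay_integral x + ln x) - 2 / pi * C0 x) \<longlongrightarrow> 2 / pi * (ln 2 - euler_mascheroni))
        (at_right 0)" by simp
    from tendsto_diff[OF this tendsto_const[of "2 / pi * (ln 2 - euler_mascheroni)"]]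
    have "((\<lambda>x. bessel_Y0 x - 2 / pi * (ln (x / 2) + euler_mascheroni)
      + 2 / pi * (decay_integral x + ln x) - 2 / pi * C0 x - 2 / pi * (ln 2 - euler_mascheroni)) \<longlongrightarrow> 0)
        (at_right 0)" by simp
    then show "((\<lambda>x. bessel_Y0 x - 2 / pi * (C0 x - decay_integral x)) \<longlongrightarrow> 0) (at_right 0)"
    proof (rule Lim_transform_eventually)
      show "\<forall>\<^sub>F x in at_right 0. bessel_Y0 x - 2 / pi * (ln (x / 2) + euler_mascheroni)
        + 2 / pi * (decay_integral x + ln x) - 2 / pi * C0 x - 2 / pi * (ln 2 - euler_mascheroni)
          = bessel_Y0 x - 2 / pi * (C0 x - decay_integral x)"
        by (auto simp: eventually_at_right_field ln_div algebra_simps add_divide_distrib diff_divide_distrib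
          intro!: exI[of _ 1])
    qed
  qed
  then show ?thesis by (simp add: C0_def)
qed

lemma hankel1_0_integral:
  assumes "x > 0"
  shows "hankel1_0 x = 2 / pi * (complex_of_real (LINT t:{0..pi/2}|lborel. cos (x * cos t))
     + \<i> * of_real (LINT t:{0..pi/2}|lborel. sin (x * cos t)) - \<i> * of_real (decay_integral x))"
  unfolding hankel1_0_def bessel_J0_integral[OF assms] bessel_Y0_integral[OF assms]
  by (simp add: algebra_simps)

lemma decay_integral_bound: assumes "0 < c" "c \<le> x" shows "\<bar>decay_integral x\<bar> \<le> 1 / c"
proof -
  note i = set_integrable_exp_decay[OF assms(1)]
  have "\<bar>decay_integral x\<bar> \<le> (LINT u:{0..}|lborel. \<bar>exp (- x * u) / sqrt (1 + u\<^sup>2)\<bar>)"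
    unfolding decay_integral_def set_lebesgue_integral_def
    by (rule order_trans[OF integral_abs_bound]) (simp add: abs_mult)
  also have "\<dots> \<le> (LINT u:{0..}|lborel. exp (- c * u))"
  proof (rule set_integral_mono)
    show "set_integrable lborel {0..} (\<lambda>u. \<bar>exp (- x * u) / sqrt (1 + u\<^sup>2)\<bar>)"
      by (rule set_integrable_abs[OF decay_integrand_integrable]) (use assms in auto)
    fix u :: real assume "u \<in> {0..}"
    then have "exp (- x * u) / sqrt (1 + u\<^sup>2) \<le> exp (- c * u) / 1"
      using assms sqrt_one_plus_sq[of u] by (intro frac_le) (auto intro!: mult_right_mono)
    then show "\<bar>exp (- x * u) / sqrt (1 + u\<^sup>2)\<bar> \<le> exp (- c * u)" using sqrt_one_plus_sq(3)[of u] by simp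
  qed (rule i)
  also have "\<dots> = 0 - (- exp (- c * 0) / c)"
  proof (rule integral_FTC_atLeast[where F="\<lambda>u. - exp (- c * u) / c"])
    show "((\<lambda>u. - exp (- c * u) / c) has_vector_derivative exp (- c * x)) (at x)" for x
      unfolding has_real_derivative_iff_has_vector_derivative[symmetric]
      using assms by (auto intro!: derivative_eq_intros)
    show "((\<lambda>u. - exp (- c * u) / c) \<longlongrightarrow> 0) at_top"
      using assms(1) by real_asymp
  qed (intro continuous_intros i)+
  finally show ?thesis by simp
qed

text \<open>
  The integrals over the arc are bounded by \<open>\<pi>/2\<close>, and the damped integral by \<open>1/c\<close>.
\<close>

lemma hankel1_0_bounded:
  assumes "c > 0"
  shows "\<exists>K. \<forall>x\<ge>c. norm (hankel1_0 x) \<le> K"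
proof (intro exI allI impI)
  fix x assume x: "x \<ge> c"
  have b: "\<bar>LINT t:{0..pi/2}|lborel. g t\<bar> \<le> pi / 2"
    if "continuous_on UNIV g" "\<And>t. \<bar>g t\<bar> \<le> 1" for g :: "real \<Rightarrow> real"
  proof -
    have "norm (LINT t:{0..pi/2}|lborel. g t) \<le> (LINT t|lborel. indicator {0..pi/2} t)"
      unfolding set_lebesgue_integral_def
    proof (rule Bochner_Integration.integral_norm_bound_integral)
      show "integrable lborel (\<lambda>t. indicat_real {0..pi/2} t *\<^sub>R g t)"
        using arc_set_integrable[OF that(1)] by (simp add: set_integrable_def)
      show "integrable lborel (indicat_real {0..pi/2})" by simp
    qed (use that in \<open>auto simp: indicator_def\<close>)
    then show ?thesis by simp
  qed
  let ?C = "LINT t:{0..pi/2}|lborel. cos (x * cos t)"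
  let ?S = "LINT t:{0..pi/2}|lborel. sin (x * cos t)"
  have "norm (hankel1_0 x) \<le> 2 / pi * (\<bar>?C\<bar> + \<bar>?S\<bar> + \<bar>decay_integral x\<bar>)"
  proof -
    have "norm (hankel1_0 x) = 2 / pi
      * norm (complex_of_real ?C + \<i> * of_real ?S - \<i> * of_real (decay_integral x))"
      using assms x by (subst hankel1_0_integral)
        (auto simp only: norm_mult norm_divide norm_of_real norm_numeral abs_of_pos pi_gt_zero abs_divide
          abs_numeral)
    also have "\<dots> \<le> 2 / pi * (norm (complex_of_real ?C) + norm (\<i> * complex_of_real ?S)
      + norm (\<i> * complex_of_real (decay_integral x)))"
      by (intro mult_left_mono order_trans[OF norm_triangle_ineq4] add_right_mono norm_triangle_ineq) auto
    finally show ?thesis by (simp add: norm_mult)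
  qed
  also have "\<dots> \<le> 2 / pi * (pi / 2 + pi / 2 + 1 / c)"
    using assms x by (intro mult_left_mono add_mono b decay_integral_bound continuous_intros) auto
  finally show "norm (hankel1_0 x) \<le> 2 / pi * (pi / 2 + pi / 2 + 1 / c)" .
qed

section \<open>Decomposition of the Hankel function into plane waves\<close>

definition propagating :: "real \<Rightarrow> real \<Rightarrow> complex" where
  "propagating x y = (LINT t:{-(pi/2)..pi/2}|lborel. exp (\<i> * of_real (x * sin t + y * cos t)))"

definition evanescent :: "real \<Rightarrow> real \<Rightarrow> real" where
  "evanescent x y = (LINT u:{0..}|lborel. 2 * cos (x * sqrt (1 + u\<^sup>2)) * exp (- y * u) / sqrt (1 + u\<^sup>2))"

lemma evanescent_integrable:
  assumes "y > 0"
  shows "set_integrable lborel {0..} (\<lambda>u. 2 * cos (x * sqrt (1 + u\<^sup>2)) * exp (- y * u) / sqrt (1 + u\<^sup>2))"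
proof (rule set_integrable_bound_exp_decay[where c=y and K=2])
  fix u :: real
  have "norm (2 * cos (x * sqrt (1 + u\<^sup>2)) * exp (- y * u) / sqrt (1 + u\<^sup>2))
    = (2 * \<bar>cos (x * sqrt (1 + u\<^sup>2))\<bar> * exp (- y * u)) / sqrt (1 + u\<^sup>2)"
    using sqrt_one_plus_sq(3)[of u] by (simp add: abs_mult)
  also have "\<dots> \<le> (2 * 1 * exp (- y * u)) / 1"
    using sqrt_one_plus_sq[of u] by (intro frac_le mult_mono) auto
  finally show "norm (2 * cos (x * sqrt (1 + u\<^sup>2)) * exp (- y * u) / sqrt (1 + u\<^sup>2)) \<le> 2 * exp (- y * u)" by simp
qed (use assms in auto)

text \<open>
  Differentiating the plane wave in the direction of rotation of \<open>(x, y)\<close> is, up to sign, the same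
  as differentiating it in the direction \<open>t\<close> of propagation, so only boundary terms remain.
\<close>

lemma propagating_rotate:
  "((\<lambda>\<theta>. propagating (\<rho> * sin \<theta>) (\<rho> * cos \<theta>)) has_vector_derivative - 2 * \<i> * of_real (sin (\<rho> * sin \<theta>))) (at \<theta>)"
proof -
  let ?e = "\<lambda>\<theta> t. exp (\<i> * of_real (\<rho> * sin \<theta> * sin t + \<rho> * cos \<theta> * cos t)) :: complex"
  let ?d = "\<lambda>\<theta> t. \<i> * of_real (\<rho> * cos \<theta> * sin t - \<rho> * sin \<theta> * cos t) * ?e \<theta> t"
  have cI: "set_integrable lborel {-(pi/2)..pi/2} f" if "continuous_on UNIV f" for f :: "real \<Rightarrow> complex"
    by (rule borel_integrable_atLeastAtMost') (use that continuous_on_subset in blast)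
  have e: "((\<lambda>s. exp (\<i> * of_real (g s))) has_vector_derivative \<i> * of_real g' * exp (\<i> * of_real (g s))) (at s)"
    if "(g has_real_derivative g') (at s)" for g g' s
  proof -
    have "((\<lambda>s. \<i> * of_real (g s)) has_vector_derivative \<i> * of_real g') (at s)"
      using that by (auto intro!: derivative_intros simp: has_real_derivative_iff_has_vector_derivative)
    from field_vector_diff_chain_at[OF this DERIV_exp] show ?thesis
      by (simp add: o_def)
  qed
  have L: "((\<lambda>\<theta>. LINT t:{-(pi/2)..pi/2}|lborel. ?e \<theta> t)
    has_vector_derivative (LINT t:{-(pi/2)..pi/2}|lborel. ?d \<theta> t)) (at \<theta>)"
  proof (rule has_vector_derivative_set_lebesgue_integral(2)[where S=UNIV and g="\<lambda>_. \<bar>\<rho>\<bar> + \<bar>\<rho>\<bar>"])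
    show "set_integrable lborel {-(pi/2)..pi/2} (?e z)" for z by (intro cI continuous_intros)
    show "((\<lambda>\<theta>. ?e \<theta> t) has_vector_derivative ?d z t) (at z)" for z t
      by (rule e) (auto intro!: derivative_eq_intros)
    show "norm (?d z t) \<le> \<bar>\<rho>\<bar> + \<bar>\<rho>\<bar>" for z t
    proof -
      have "norm (?d z t) = \<bar>\<rho> * cos z * sin t - \<rho> * sin z * cos t\<bar>"
        by (simp add: norm_mult norm_exp_i_times del: of_real_diff of_real_mult)
      also have "\<dots> \<le> \<bar>\<rho> * cos z * sin t\<bar> + \<bar>\<rho> * sin z * cos t\<bar>" by (rule abs_triangle_ineq4)
      also have "\<dots> \<le> \<bar>\<rho>\<bar> * 1 * 1 + \<bar>\<rho>\<bar> * 1 * 1"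
        unfolding abs_mult by (intro add_mono mult_mono) auto
      finally show ?thesis by simp
    qed
    show "set_integrable lborel {-(pi/2)..pi/2} (\<lambda>_. \<bar>\<rho>\<bar> + \<bar>\<rho>\<bar>)"
      by (rule borel_integrable_atLeastAtMost') (intro continuous_intros)
  qed auto
  have "(LINT t:{-(pi/2)..pi/2}|lborel. ?d \<theta> t) = - ?e \<theta> (pi/2) - (- ?e \<theta> (-(pi/2)))"
    unfolding set_lebesgue_integral_def
  proof (rule integral_FTC_atLeastAtMost)
    show "((\<lambda>t. - ?e \<theta> t) has_vector_derivative ?d \<theta> t) (at t within {-(pi/2)..pi/2})" for t
    proof -
      have "((\<lambda>t. ?e \<theta> t) has_vector_derivative \<i> * of_real (\<rho> * sin \<theta> * cos t - \<rho> * cos \<theta> * sin t) * ?e \<theta> t)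
        (at t)"
        by (rule e) (auto intro!: derivative_eq_intros)
      note D = has_vector_derivative_at_within[OF has_vector_derivative_minus[OF this]]
      have "- (\<i> * of_real (a - b) * z) = \<i> * of_real (b - a) * z" for a b z
        by (simp add: algebra_simps)
      from D[unfolded this] show ?thesis .
    qed
  next
    show "continuous_on {-(pi/2)..pi/2} (?d \<theta>)" by (intro continuous_intros)
  qed simp
  also have "\<dots> = - 2 * \<i> * of_real (sin (\<rho> * sin \<theta>))"
  proof -
    have "?e \<theta> (pi/2) = cis (\<rho> * sin \<theta>)" "?e \<theta> (-(pi/2)) = cis (- (\<rho> * sin \<theta>))"
      by (simp_all add: cis_conv_exp)
    then show ?thesis by (simp only:) (simp add: complex_eq_iff)
  qed
  finally have "(LINT t:{-(pi/2)..pi/2}|lborel. ?d \<theta> t) = - 2 * \<i> * of_real (sin (\<rho> * sin \<theta>))" .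
  with L show ?thesis by (simp only: propagating_def)
qed

lemma exp_decay_tendsto:
  fixes c :: real
  assumes "c > 0"
  shows "((\<lambda>u. exp (- c * u)) \<longlongrightarrow> 0) at_top"
  using assms by real_asymp

text \<open>
  The evanescent waves are the continuation of the propagating ones to complex directions, so the
  rotational derivative is again a total derivative, here of \<open>2 sin (x \<surd>(1 + u\<^sup>2)) exp (-y u)\<close>.
\<close>

lemma evanescent_rotate:
  assumes r: "\<rho> > 0" and th: "\<bar>\<theta>\<bar> < pi / 2"
  shows "((\<lambda>\<theta>. evanescent (\<rho> * sin \<theta>) (\<rho> * cos \<theta>)) has_real_derivative - 2 * sin (\<rho> * sin \<theta>)) (at \<theta>)"
proof -
  \<comment> \<open>On a slightly larger sector the damping \<open>\<rho> cos z\<close> is bounded below, uniformly in \<open>z\<close>.\<close>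
  define \<phi> where "\<phi> = (\<bar>\<theta>\<bar> + pi / 2) / 2"
  have phi: "\<bar>\<theta>\<bar> < \<phi>" "\<phi> < pi / 2" "0 < \<phi>" using th by (auto simp: \<phi>_def)
  define c where "c = \<rho> * cos \<phi>"
  have c: "c > 0" using phi r by (auto simp: c_def intro!: mult_pos_pos cos_gt_zero_pi)
  have cz: "c \<le> \<rho> * cos z" if "z \<in> {-\<phi><..<\<phi>}" for z
  proof -
    have "cos \<phi> \<le> cos \<bar>z\<bar>" using that phi by (intro cos_monotone_0_pi_le) auto
    then show ?thesis using r by (simp add: c_def)
  qed
  let ?s = "\<lambda>u::real. sqrt (1 + u\<^sup>2)"
  let ?b = "\<lambda>z u. 2 * cos (\<rho> * sin z * ?s u) * exp (- (\<rho> * cos z) * u) / ?s u"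
  let ?d = "\<lambda>z u. 2 * (cos (\<rho> * sin z * ?s u) * (\<rho> * sin z * (u / ?s u)) - sin (\<rho> * sin z * ?s u)
    * (\<rho> * cos z)) * exp (- (\<rho> * cos z) * u)"
  have S: "open {-\<phi><..<\<phi>}" "convex {-\<phi><..<\<phi>}" "\<theta> \<in> {-\<phi><..<\<phi>}" using phi by auto
  have i: "set_integrable lborel {0..} (?b z)" if "z \<in> {-\<phi><..<\<phi>}" for z
    using cz[OF that] c by (intro evanescent_integrable) auto
  have d: "((\<lambda>z. ?b z u) has_vector_derivative ?d z u) (at z)" for z u
    unfolding has_real_derivative_iff_has_vector_derivative[symmetric]
  proof -
    have "((\<lambda>z. 2 * cos (\<rho> * sin z * ?s u) * exp (- (\<rho> * cos z) * u)) has_real_derivative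
      2 * (cos (\<rho> * sin z * ?s u) * (\<rho> * sin z * u) - sin (\<rho> * sin z * ?s u) * (\<rho> * cos z * ?s u))
        * exp (- (\<rho> * cos z) * u)) (at z)"
      by (auto intro!: derivative_eq_intros simp: algebra_simps)
    from DERIV_cdivide[OF this, of "?s u"]
    show "((\<lambda>z. ?b z u) has_real_derivative ?d z u) (at z)"
      using sqrt_one_plus_sq(3)[of u] by (simp add: diff_divide_distrib algebra_simps)
  qed
  have b: "norm (?d z u) \<le> 4 * \<rho> * exp (- c * u)" if "z \<in> {-\<phi><..<\<phi>}" "u \<in> {0..}" for z u
  proof -
    have "norm (?d z u) = 2 * \<bar>cos (\<rho> * sin z * ?s u) * (\<rho> * sin z * (u / ?s u)) - sin (\<rho> * sin z * ?s u)
      * (\<rho> * cos z)\<bar> * exp (- (\<rho> * cos z) * u)"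
    proof -
      have "norm (2 * a * exp b) = 2 * \<bar>a\<bar> * exp b" for a b :: real by (simp add: abs_mult)
      then show ?thesis by this
    qed
    also have "\<dots> \<le> 2 * (2 * \<rho>) * exp (- c * u)"
    proof (intro mult_mono)
      have "\<bar>cos (\<rho> * sin z * ?s u) * (\<rho> * sin z * (u / ?s u)) - sin (\<rho> * sin z * ?s u) * (\<rho> * cos z)\<bar>
        \<le> \<bar>cos (\<rho> * sin z * ?s u) * (\<rho> * sin z * (u / ?s u))\<bar> + \<bar>sin (\<rho> * sin z * ?s u) * (\<rho> * cos z)\<bar>"
        by (rule abs_triangle_ineq4)
      also have "\<dots> \<le> 1 * (\<rho> * 1 * 1) + 1 * (\<rho> * 1)"
        unfolding abs_mult using r sqrt_one_plus_sq[of u] that by (intro add_mono mult_mono)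
          (auto simp: divide_le_eq)
      finally show "\<bar>cos (\<rho> * sin z * ?s u) * (\<rho> * sin z * (u / ?s u)) - sin (\<rho> * sin z * ?s u) * (\<rho> * cos z)\<bar>
        \<le> 2 * \<rho>" by simp
      show "exp (- (\<rho> * cos z) * u) \<le> exp (- c * u)" using cz[OF that(1)] that(2)
        by (auto intro!: mult_right_mono)
    qed (use r in auto)
    finally show ?thesis by simp
  qed
  have g: "set_integrable lborel {0..} (\<lambda>u. 4 * \<rho> * exp (- c * u))"
    using set_integrable_exp_decay[OF c] by (intro set_integrable_mult_right) auto
  note L = has_vector_derivative_set_lebesgue_integral[OF S i d b g]
  have y: "\<rho> * cos \<theta> > 0" using cz[OF S(3)] c by simp
  have "(LINT u:{0..}|lborel. ?d \<theta> u) = 0 - 2 * sin (\<rho> * sin \<theta> * ?s 0) * exp (- (\<rho> * cos \<theta>) * 0)"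
  proof (rule integral_FTC_atLeast[where F="\<lambda>u. 2 * sin (\<rho> * sin \<theta> * ?s u) * exp (- (\<rho> * cos \<theta>) * u)"])
    show "((\<lambda>u. 2 * sin (\<rho> * sin \<theta> * ?s u) * exp (- (\<rho> * cos \<theta>) * u)) has_vector_derivative ?d \<theta> u) (at u)" for u
    proof -
      have "(?s has_real_derivative u / ?s u) (at u)"
        using sqrt_one_plus_sq(3)[of u] by (auto intro!: derivative_eq_intros simp: field_simps add_pos_nonneg)
      moreover have "((\<lambda>u. 2 * sin (a * s u) * exp (- b * u)) has_real_derivative
        2 * (cos (a * s u) * (a * s') - sin (a * s u) * b) * exp (- b * u)) (at u)"
        if "(s has_real_derivative s') (at u)" for a b s' and s :: "real \<Rightarrow> real"
        by (auto intro!: derivative_eq_intros that simp: algebra_simps)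
      ultimately show ?thesis
        unfolding has_real_derivative_iff_has_vector_derivative[symmetric] by blast
    qed
    show "continuous_on {0..} (?d \<theta>)" by (intro continuous_intros) auto
    show "set_integrable lborel {0..} (?d \<theta>)" by (rule L(1)) auto
    have "((\<lambda>u. exp (- (\<rho> * cos \<theta>) * u)) \<longlongrightarrow> 0) at_top" using y by (rule exp_decay_tendsto)
    then have z: "((\<lambda>u. 2 * exp (- (\<rho> * cos \<theta>) * u)) \<longlongrightarrow> 2 * 0) at_top" by (intro tendsto_intros)
    show "((\<lambda>u. 2 * sin (\<rho> * sin \<theta> * ?s u) * exp (- (\<rho> * cos \<theta>) * u)) \<longlongrightarrow> 0) at_top"
      by (rule Lim_null_comparison[OF _ z[simplified]]) (auto simp: abs_mult intro!: always_eventually)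
  qed
  then have "(LINT u:{0..}|lborel. ?d \<theta> u) = - 2 * sin (\<rho> * sin \<theta>)" by simp
  moreover have "((\<lambda>z. LINT u:{0..}|lborel. ?b z u) has_vector_derivative (LINT u:{0..}|lborel. ?d \<theta> u)) (at \<theta>)"
    by (rule L(2)) auto
  ultimately show ?thesis
    unfolding has_real_derivative_iff_has_vector_derivative evanescent_def by simp
qed

text \<open>
  In polar coordinates the right-hand side has zero angular derivative, hence may be evaluated on
  the axis \<open>\<theta> = 0\<close>, where it is the integral representation of the Hankel function.
\<close>

theorem hankel_weyl:
  assumes y: "y > 0"
  shows "hankel1_0 (sqrt (x\<^sup>2 + y\<^sup>2)) = (propagating x y - \<i> * of_real (evanescent x y)) / pi"
proof -
  define \<rho> where "\<rho> = sqrt (x\<^sup>2 + y\<^sup>2)"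
  define \<theta> where "\<theta> = arcsin (x / \<rho>)"
  have r: "\<rho> > 0" "\<bar>x\<bar> < \<rho>" "\<rho>\<^sup>2 = x\<^sup>2 + y\<^sup>2"
    using y by (auto simp: \<rho>_def add_nonneg_pos real_less_rsqrt)
  have xr: "- 1 < x / \<rho>" "x / \<rho> < 1" using r by (auto simp: field_simps abs_less_iff)
  have th: "\<bar>\<theta>\<bar> < pi / 2" using arcsin_lt_bounded[OF xr] unfolding \<theta>_def by linarith
  have s: "\<rho> * sin \<theta> = x" using r xr by (simp add: \<theta>_def sin_arcsin)
  have c: "\<rho> * cos \<theta> = y"
  proof -
    have "cos \<theta> = sqrt (1 - (x / \<rho>)\<^sup>2)" unfolding \<theta>_def by (rule cos_arcsin) (use xr in auto)
    also have "1 - (x / \<rho>)\<^sup>2 = (y / \<rho>)\<^sup>2"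
    proof -
      have "(x / \<rho>)\<^sup>2 + (y / \<rho>)\<^sup>2 = (x\<^sup>2 + y\<^sup>2) / \<rho>\<^sup>2"
        by (simp only: power_divide add_divide_distrib)
      also have "\<dots> = 1" using r by (simp only: r(3)[symmetric]) simp
      finally show ?thesis by simp
    qed
    also have "sqrt ((y / \<rho>)\<^sup>2) = y / \<rho>" using y r by simp
    finally show ?thesis using r by simp
  qed
  \<comment> \<open>The angle is measured from the \<open>y\<close>-axis, so that \<open>y > 0\<close> is the range \<open>\<bar>\<theta>\<bar> < \<pi>/2\<close>.\<close>
  define W where "W \<theta> = propagating (\<rho> * sin \<theta>) (\<rho> * cos \<theta>) - \<i>
    * of_real (evanescent (\<rho> * sin \<theta>) (\<rho> * cos \<theta>))" for \<theta>
  have "(W has_vector_derivative 0) (at \<theta> within {- (pi/2)<..<pi/2})" if "\<theta> \<in> {- (pi/2)<..<pi/2}" for \<theta>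
  proof (rule has_vector_derivative_at_within)
    have "(W has_vector_derivative (- 2 * \<i> * of_real (sin (\<rho> * sin \<theta>)) - \<i>
      * of_real (- 2 * sin (\<rho> * sin \<theta>)))) (at \<theta>)"
      unfolding W_def
      using that r
      by (intro derivative_intros propagating_rotate has_vector_derivative_of_real
          evanescent_rotate) (auto simp: abs_less_iff)
    then show "(W has_vector_derivative 0) (at \<theta>)" by simp
  qed
  then obtain C where C: "\<And>\<theta>. \<theta> \<in> {- (pi/2)<..<pi/2} \<Longrightarrow> W \<theta> = C"
    using has_vector_derivative_zero_constant[of "{- (pi/2)<..<pi/2}" W] by auto
  have "\<theta> \<in> {- (pi/2)<..<pi/2}" using th unfolding greaterThanLessThan_iff by linarith
  then have "W \<theta> = W 0" using C[of \<theta>] C[of 0] by simp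
  moreover have "W 0 = 2 * (of_real (LINT t:{0..pi/2}|lborel. cos (\<rho> * cos t))
    + \<i> * of_real (LINT t:{0..pi/2}|lborel. sin (\<rho> * cos t))) - \<i> * of_real (2 * decay_integral \<rho>)"
  proof -
    have "evanescent 0 \<rho> = 2 * decay_integral \<rho>"
      unfolding evanescent_def decay_integral_def by (subst set_integral_mult_right[symmetric]) simp
    moreover have "propagating 0 \<rho> = 2 * (of_real (LINT t:{0..pi/2}|lborel. cos (\<rho> * cos t))
      + \<i> * of_real (LINT t:{0..pi/2}|lborel. sin (\<rho> * cos t)))"
    proof -
      let ?g = "\<lambda>t. exp (\<i> * of_real (\<rho> * cos t)) :: complex"
      have gi: "set_integrable lborel {a..b} ?g" for a b
        by (rule borel_integrable_atLeastAtMost') (intro continuous_intros)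
      have "propagating 0 \<rho> = (LINT t:{-(pi/2)..0}|lborel. ?g t) + (LINT t:{0<..pi/2}|lborel. ?g t)"
      proof -
        have un: "{-(pi/2)..pi/2} = {-(pi/2)..0} \<union> {0<..pi/2}" by auto
        have "propagating 0 \<rho> = (LINT t:{-(pi/2)..0} \<union> {0<..pi/2}|lborel. ?g t)"
          by (simp add: propagating_def un[symmetric])
        also have "\<dots> = (LINT t:{-(pi/2)..0}|lborel. ?g t) + (LINT t:{0<..pi/2}|lborel. ?g t)"
          by (rule set_integral_Un) (auto intro!: set_integrable_subset[OF gi[of 0 "pi/2"]] simp del:
            of_real_mult simp: gi)
        finally show ?thesis .
      qed
      also have "(LINT t:{0<..pi/2}|lborel. ?g t) = (LINT t:{0..pi/2}|lborel. ?g t)"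
        using interval_integral_Ioc[of 0 "pi/2" ?g] interval_integral_Icc[of 0 "pi/2" ?g] by simp
      also have "(LINT t:{-(pi/2)..0}|lborel. ?g t) = (LINT t:{0..pi/2}|lborel. ?g t)"
      proof -
        have "{t. - t \<in> {-(pi/2)..0}} = {0..pi/2}" by auto
        then show ?thesis by (subst set_integral_reflect) simp
      qed
      also have "(LINT t:{0..pi/2}|lborel. ?g t) = of_real (LINT t:{0..pi/2}|lborel. cos (\<rho> * cos t))
        + \<i> * of_real (LINT t:{0..pi/2}|lborel. sin (\<rho> * cos t))"
      proof -
        have "(LINT t:{0..pi/2}|lborel. ?g t)
          = (LINT t:{0..pi/2}|lborel. of_real (cos (\<rho> * cos t)) + \<i> * of_real (sin (\<rho> * cos t)))"
          by (simp only: cis_conv_exp[symmetric] cis.ctr Complex_eq)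
        also have "\<dots> = (LINT t:{0..pi/2}|lborel. of_real (cos (\<rho> * cos t)))
          + (LINT t:{0..pi/2}|lborel. \<i> * of_real (sin (\<rho> * cos t)))"
          by (rule set_integral_add) (rule borel_integrable_atLeastAtMost', intro continuous_intros)+
        finally show ?thesis by (simp add: set_integral_complex_of_real)
      qed
      finally show ?thesis by simp
    qed
    ultimately show ?thesis by (simp add: W_def)
  qed
  ultimately have W: "W \<theta> = 2 * (of_real (LINT t:{0..pi/2}|lborel. cos (\<rho> * cos t))
    + \<i> * of_real (LINT t:{0..pi/2}|lborel. sin (\<rho> * cos t))) - \<i> * of_real (2 * decay_integral \<rho>)"
    by (simp only:)
  have "W \<theta> / pi = hankel1_0 \<rho>"
    unfolding W hankel1_0_integral[OF r(1)] by (simp add: algebra_simps add_divide_distrib diff_divide_distrib)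
  then show ?thesis unfolding W_def s c \<rho>_def[symmetric] by simp
qed

section \<open>Fourier transforms of test functions\<close>

lemma integrable_pair_lborel:
  fixes f :: "'a::euclidean_space \<Rightarrow> 'b::euclidean_space \<Rightarrow> complex"
  assumes m: "(\<lambda>(x, y). f x y) \<in> borel_measurable (lborel \<Otimes>\<^sub>M lborel)"
    and b: "\<And>x y. norm (f x y) \<le> A x * B y"
    and A: "integrable lborel A" and B: "integrable lborel B"
  shows "integrable (lborel \<Otimes>\<^sub>M lborel) (\<lambda>(x, y). f x y)"
proof -
  have [measurable]: "A \<in> borel_measurable borel" "B \<in> borel_measurable borel" using A B by auto
  have "integrable (lborel \<Otimes>\<^sub>M lborel) (\<lambda>(x, y). A x * B y)"
  proof (rule lborel_pair.Fubini_integrable)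
    show "(\<lambda>(x, y). A x * B y) \<in> borel_measurable (lborel \<Otimes>\<^sub>M lborel)" by measurable
    have "(\<lambda>x. \<integral>y. norm (case (x, y) of (x, y) \<Rightarrow> A x * B y) \<partial>lborel) = (\<lambda>x. \<bar>A x\<bar> * (\<integral>y. \<bar>B y\<bar> \<partial>lborel))"
      by (simp add: abs_mult)
    then show "integrable lborel (\<lambda>x. \<integral>y. norm (case (x, y) of (x, y) \<Rightarrow> A x * B y) \<partial>lborel)"
      using A by simp
    show "AE x in lborel. integrable lborel (\<lambda>y. case (x, y) of (x, y) \<Rightarrow> A x * B y)"
      using B by simp
  qed
  then show ?thesis
  proof (rule Bochner_Integration.integrable_bound[OF _ m])
    show "AE x in lborel \<Otimes>\<^sub>M lborel. norm (case x of (x, y) \<Rightarrow> f x y) \<le> norm (case x of (x, y) \<Rightarrow> A x * B y)"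
      using b by (intro AE_I2) (force intro: order_trans[OF _ abs_ge_self])
  qed
qed

lemma Fubini_lborel:
  fixes f :: "'a::euclidean_space \<Rightarrow> 'b::euclidean_space \<Rightarrow> complex"
  assumes m: "(\<lambda>(x, y). f x y) \<in> borel_measurable (lborel \<Otimes>\<^sub>M lborel)"
    and b: "\<And>x y. norm (f x y) \<le> A x * B y"
    and A: "integrable lborel A" and B: "integrable lborel B"
  shows "(\<integral>x. \<integral>y. f x y \<partial>lborel \<partial>lborel) = (\<integral>y. \<integral>x. f x y \<partial>lborel \<partial>lborel)"
proof -
  show ?thesis
    by (rule lborel_pair.Fubini_integral[symmetric, OF integrable_pair_lborel[OF assms]])
qed

lemma fourier_real_lborel:
  assumes "\<phi> \<in> borel_measurable borel"
  shows "fourier \<phi> (x::real) = (\<integral>k. \<phi> k * exp (- (\<i> * of_real (x * k))) \<partial>lborel) / sqrt (2 * pi)"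
proof -
  have [measurable]: "\<phi> \<in> borel_measurable borel" by fact
  have "(\<integral>k. \<phi> k * exp (- (\<i> * of_real (x \<bullet> k))) \<partial>lebesgue) = (\<integral>k. \<phi> k * exp (- (\<i> * of_real (x * k))) \<partial>lborel)"
    by (subst integral_completion) simp_all
  moreover have "(2 * pi) powr (- (1 / 2)) = 1 / sqrt (2 * pi)"
    by (simp add: powr_minus_divide powr_half_sqrt)
  ultimately show ?thesis by (simp add: fourier_def)
qed

lemma gaussian_fourier:
  "(\<integral>x. std_normal_density x *\<^sub>R exp (\<i> * of_real (t * x)) \<partial>lborel) = of_real (exp (- (t\<^sup>2) / 2))"
proof -
  have "char std_normal_distribution t = (\<integral>x. std_normal_density x *\<^sub>R exp (\<i> * of_real (t * x)) \<partial>lborel)"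
    unfolding char_def by (subst integral_density) (auto simp: normal_density_nonneg)
  then show ?thesis by (simp add: char_std_normal_distribution)
qed

text \<open>
  A Gaussian cutoff of width \<open>n\<close> makes the double integral absolutely convergent. Exchanging the
  integrals turns it into the average of \<open>\<phi>\<close> against a Gaussian of width \<open>1/n\<close> around \<open>k\<close>, and both
  sides converge as \<open>n\<close> grows.
\<close>

lemma fourier_inversion:
  fixes \<phi> :: "real \<Rightarrow> complex"
  assumes cont: "continuous_on UNIV \<phi>" and bnd: "\<And>x. norm (\<phi> x) \<le> B"
    and int: "integrable lborel \<phi>" and fint: "integrable lborel (fourier \<phi>)"
  shows "(\<integral>x. fourier \<phi> x * exp (\<i> * of_real (k * x)) \<partial>lborel) = sqrt (2 * pi) * \<phi> k"
proof -
  have [measurable]: "\<phi> \<in> borel_measurable borel" by (rule borel_measurable_continuous_onI[OF cont])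
  have [measurable]: "fourier \<phi> \<in> borel_measurable borel" using fint by auto
  let ?g = "std_normal_density"
  define c where "c = ?g 0"
  have c: "c = 1 / sqrt (2 * pi)" by (simp add: c_def normal_density_def)
  have lim1: "(\<lambda>n. \<integral>x. ?g (x / real (Suc n)) *\<^sub>R (fourier \<phi> x * exp (\<i> * of_real (k * x))) \<partial>lborel) \<longlonglongrightarrow>
     (\<integral>x. c *\<^sub>R (fourier \<phi> x * exp (\<i> * of_real (k * x))) \<partial>lborel)"
  proof (rule integral_dominated_convergence[where w="\<lambda>x. c * norm (fourier \<phi> x)"])
    show "integrable lborel (\<lambda>x. c * norm (fourier \<phi> x))" using fint by simp
    show "AE x in lborel. (\<lambda>n. ?g (x / real (Suc n)) *\<^sub>R (fourier \<phi> x * exp (\<i> * of_real (k * x))))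
      \<longlonglongrightarrow> c *\<^sub>R (fourier \<phi> x * exp (\<i> * of_real (k * x)))"
    proof (rule AE_I2)
      fix x :: real
      have "(\<lambda>n. x / real (Suc n)) \<longlonglongrightarrow> 0" by (rule LIMSEQ_Suc) real_asymp
      then have "(\<lambda>n. ?g (x / real (Suc n))) \<longlonglongrightarrow> ?g 0"
        by (rule isCont_tendsto_compose[rotated]) (auto simp: normal_density_def intro!: continuous_intros)
      then show "(\<lambda>n. ?g (x / real (Suc n)) *\<^sub>R (fourier \<phi> x * exp (\<i> * of_real (k * x))))
        \<longlonglongrightarrow> c *\<^sub>R (fourier \<phi> x * exp (\<i> * of_real (k * x)))"
        unfolding c_def by (intro tendsto_intros)
    qed
    have "?g y \<le> c" for y unfolding c_def normal_density_def by (simp add: divide_right_mono)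
    then show "AE x in lborel. norm (?g (x / real (Suc n)) *\<^sub>R (fourier \<phi> x * exp (\<i> * of_real (k * x))))
      \<le> c * norm (fourier \<phi> x)" for n
      by (intro AE_I2) (auto simp: norm_mult normal_density_nonneg norm_exp_i_times simp del: of_real_mult
        intro!: mult_right_mono)
  qed measurable
  have eq: "(\<integral>x. ?g (x / real (Suc n)) *\<^sub>R (fourier \<phi> x * exp (\<i> * of_real (k * x))) \<partial>lborel)
     = (\<integral>w. ?g w *\<^sub>R \<phi> (k + w / real (Suc n)) \<partial>lborel)" for n
  proof -
    define N where "N = real (Suc n)"
    have N: "N > 0" by (simp add: N_def)
    have gi: "integrable lborel (\<lambda>x. ?g (x / N))"
      using lborel_integrable_real_affine_iff[of "1 / N" ?g 0] N integrable_normal_density[of 1 0] by simp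
    have "(\<integral>x. ?g (x / N) *\<^sub>R (fourier \<phi> x * exp (\<i> * of_real (k * x))) \<partial>lborel)
      = (\<integral>x. \<integral>y. ?g (x / N) *\<^sub>R (\<phi> y * exp (\<i> * of_real ((k - y) * x))) / sqrt (2 * pi) \<partial>lborel \<partial>lborel)"
    proof (rule Bochner_Integration.integral_cong[OF refl])
      fix x
      have "?g (x / N) *\<^sub>R (fourier \<phi> x * exp (\<i> * of_real (k * x))) =
        (\<integral>y. \<phi> y * exp (- (\<i> * of_real (x * y))) \<partial>lborel)
          * (?g (x / N) *\<^sub>R exp (\<i> * of_real (k * x)) / sqrt (2 * pi))"
        by (simp add: fourier_real_lborel scaleR_conv_of_real)
      also have "\<dots> = (\<integral>y. \<phi> y * exp (- (\<i> * of_real (x * y)))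
        * (?g (x / N) *\<^sub>R exp (\<i> * of_real (k * x)) / sqrt (2 * pi)) \<partial>lborel)"
        by (rule integral_mult_left_zero[symmetric])
      also have "\<dots> = (\<integral>y. ?g (x / N) *\<^sub>R (\<phi> y * exp (\<i> * of_real ((k - y) * x))) / sqrt (2 * pi) \<partial>lborel)"
      proof (rule Bochner_Integration.integral_cong[OF refl])
        fix y
        have "exp (\<i> * of_real ((k - y) * x)) = exp (- (\<i> * of_real (x * y))) * exp (\<i> * of_real (k * x))"
          unfolding exp_add[symmetric] by (simp add: algebra_simps)
        then show "\<phi> y * exp (- (\<i> * of_real (x * y)))
          * (?g (x / N) *\<^sub>R exp (\<i> * of_real (k * x)) / sqrt (2 * pi))
          = ?g (x / N) *\<^sub>R (\<phi> y * exp (\<i> * of_real ((k - y) * x))) / sqrt (2 * pi)"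
          by (simp only: scaleR_conv_of_real) (simp add: mult_ac)
      qed
      finally show "?g (x / N) *\<^sub>R (fourier \<phi> x * exp (\<i> * of_real (k * x))) =
        (\<integral>y. ?g (x / N) *\<^sub>R (\<phi> y * exp (\<i> * of_real ((k - y) * x))) / sqrt (2 * pi) \<partial>lborel)" .
    qed
    also have "\<dots> = (\<integral>y. \<integral>x. ?g (x / N) *\<^sub>R (\<phi> y * exp (\<i> * of_real ((k - y) * x))) / sqrt (2 * pi) \<partial>lborel
      \<partial>lborel)"
    proof (rule Fubini_lborel[where A="\<lambda>x. ?g (x / N)" and B="\<lambda>y. norm (\<phi> y) / sqrt (2 * pi)"])
      show "norm (?g (x / N) *\<^sub>R (\<phi> y * exp (\<i> * of_real ((k - y) * x))) / sqrt (2 * pi))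
        \<le> ?g (x / N) * (norm (\<phi> y) / sqrt (2 * pi))" for x y
        by (simp add: norm_mult norm_divide normal_density_nonneg norm_exp_i_times del: of_real_mult)
      show "integrable lborel (\<lambda>y. norm (\<phi> y) / sqrt (2 * pi))" using int by simp
    qed (measurable, rule gi)
    also have "\<dots> = (\<integral>y. \<phi> y * (N * ?g (N * (k - y))) \<partial>lborel)"
    proof (rule Bochner_Integration.integral_cong[OF refl])
      fix y
      have "(\<integral>x. ?g (x / N) *\<^sub>R (\<phi> y * exp (\<i> * of_real ((k - y) * x))) / sqrt (2 * pi) \<partial>lborel)
        = (\<integral>x. (\<phi> y / sqrt (2 * pi)) * (?g (x / N) *\<^sub>R exp (\<i> * of_real ((k - y) * x))) \<partial>lborel)"
        by (intro Bochner_Integration.integral_cong refl) (simp add: scaleR_conv_of_real)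
      also have "\<dots> = (\<phi> y / sqrt (2 * pi)) * (\<integral>x. ?g (x / N) *\<^sub>R exp (\<i> * of_real ((k - y) * x)) \<partial>lborel)"
        by (rule integral_mult_right_zero)
      also have "(\<integral>x. ?g (x / N) *\<^sub>R exp (\<i> * of_real ((k - y) * x)) \<partial>lborel)
        = N *\<^sub>R (\<integral>x. ?g x *\<^sub>R exp (\<i> * of_real ((N * (k - y)) * x)) \<partial>lborel)"
        using lborel_integral_real_affine[of N "\<lambda>x. ?g (x / N) *\<^sub>R exp (\<i> * of_real ((k - y) * x))" 0] N
        by (simp add: mult_ac)
      also have "\<dots> = N *\<^sub>R of_real (exp (- ((N * (k - y))\<^sup>2) / 2))" by (simp only: gaussian_fourier)
      finally show "(\<integral>x. ?g (x / N) *\<^sub>R (\<phi> y * exp (\<i> * of_real ((k - y) * x))) / sqrt (2 * pi) \<partial>lborel)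
        = \<phi> y * (N * ?g (N * (k - y)))"
        by (simp add: normal_density_def scaleR_conv_of_real)
    qed
    also have "\<dots> = \<bar>1 / N\<bar> *\<^sub>R (\<integral>w. \<phi> (k + (1 / N) * w) * (N * ?g (N * (k - (k + (1 / N) * w)))) \<partial>lborel)"
      by (rule lborel_integral_real_affine) (use N in auto)
    also have "\<dots> = (\<integral>w. \<bar>1 / N\<bar> *\<^sub>R (\<phi> (k + (1 / N) * w) * (N * ?g (N * (k - (k + (1 / N) * w))))) \<partial>lborel)"
      by (rule integral_scaleR_right[symmetric])
    also have "\<dots> = (\<integral>w. ?g w *\<^sub>R \<phi> (k + w / N) \<partial>lborel)"
    proof (rule Bochner_Integration.integral_cong[OF refl])
      fix w
      have "N * (k - (k + (1 / N) * w)) = - w" using N by simp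
      moreover have "?g (- w) = ?g w" by (simp add: normal_density_def)
      ultimately show "\<bar>1 / N\<bar> *\<^sub>R (\<phi> (k + (1 / N) * w) * (N * ?g (N * (k - (k + (1 / N) * w)))))
        = ?g w *\<^sub>R \<phi> (k + w / N)"
        using N by (simp add: scaleR_conv_of_real)
    qed
    finally show ?thesis by (simp only: N_def)
  qed
  have lim2: "(\<lambda>n. \<integral>w. ?g w *\<^sub>R \<phi> (k + w / real (Suc n)) \<partial>lborel) \<longlonglongrightarrow> (\<integral>w. ?g w *\<^sub>R \<phi> k \<partial>lborel)"
  proof (rule integral_dominated_convergence[where w="\<lambda>w. ?g w * B"])
    show "integrable lborel (\<lambda>w. ?g w * B)" by (simp add: integrable_normal_density)
    show "AE w in lborel. (\<lambda>n. ?g w *\<^sub>R \<phi> (k + w / real (Suc n))) \<longlonglongrightarrow> ?g w *\<^sub>R \<phi> k"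
    proof (rule AE_I2)
      fix w :: real
      have "(\<lambda>n. k + w / real (Suc n)) \<longlonglongrightarrow> k" by (rule LIMSEQ_Suc[where f="\<lambda>n. k + w / real n"]) real_asymp
      then have "(\<lambda>n. \<phi> (k + w / real (Suc n))) \<longlonglongrightarrow> \<phi> k"
        by (rule continuous_on_tendsto_compose[OF cont]) auto
      then show "(\<lambda>n. ?g w *\<^sub>R \<phi> (k + w / real (Suc n))) \<longlonglongrightarrow> ?g w *\<^sub>R \<phi> k" by (intro tendsto_intros)
    qed
    show "AE w in lborel. norm (?g w *\<^sub>R \<phi> (k + w / real (Suc n))) \<le> ?g w * B" for n
      by (intro AE_I2) (simp add: normal_density_nonneg mult_left_mono bnd)
  qed measurable
  have "(\<integral>w. ?g w *\<^sub>R \<phi> k \<partial>lborel) = \<phi> k"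
    by (subst integral_scaleR_left) (auto simp: integrable_normal_density integral_normal_density)
  then have "c *\<^sub>R (\<integral>x. fourier \<phi> x * exp (\<i> * of_real (k * x)) \<partial>lborel) = \<phi> k"
    using LIMSEQ_unique[OF lim1 lim2[folded eq]] by simp
  then show ?thesis by (simp add: c scaleR_conv_of_real field_simps)
qed

text \<open>
  The properties of test functions used below. The transform is integrable because \<open>1 + x\<^sup>2\<close> times it
  is, up to normalisation, the transform of \<open>\<phi> - \<phi>''\<close> and hence bounded.
\<close>

lemma test_function_fourier_facts:
  assumes t: "test_function {-R<..<R} \<phi>"
  shows "continuous_on UNIV \<phi>" "\<exists>B. \<forall>x. norm (\<phi> x) \<le> B" "\<And>x. x \<notin> {-R<..<R} \<Longrightarrow> \<phi> x = 0"
    "integrable lborel \<phi>" "integrable lborel (fourier \<phi>)"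
proof -
  obtain D where D: "D 0 = \<phi>" "\<And>n x. (D n has_vector_derivative D (Suc n) x) (at x)"
    using t unfolding test_function_def smooth_def by blast
  define K where "K = closure {x. \<phi> x \<noteq> 0}"
  have K: "compact K" "K \<subseteq> {-R<..<R}" using t by (auto simp: test_function_def K_def)
  have Dc: "continuous_on UNIV (D n)" for n
    by (intro continuous_at_imp_continuous_on ballI) (rule has_vector_derivative_continuous[OF D(2)])
  show c: "continuous_on UNIV \<phi>" using Dc[of 0] D(1) by simp
  have z: "D n x = 0" if "x \<notin> K" for n x
    using that
  proof (induction n arbitrary: x)
    case 0
    then show ?case using closure_subset[of "{x. \<phi> x \<noteq> 0}"] by (auto simp: D(1) K_def)
  next
    case (Suc n)
    have o: "open (- K)" using K(1) by (simp add: compact_imp_closed open_Compl)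
    have "(D n has_vector_derivative 0) (at x)"
      by (rule has_vector_derivative_transform_within_open[OF _ o, of "\<lambda>_. 0"]) (use Suc in auto)
    then show ?case by (rule vector_derivative_unique_at[OF D(2)])
  qed
  have z': "D n x = 0" if "x \<notin> {-R<..<R}" for n x using z K(2) that by blast
  from this[of _ 0] show "\<And>x. x \<notin> {-R<..<R} \<Longrightarrow> \<phi> x = 0" by (simp only: D(1))
  have Db: "\<exists>B. \<forall>x. norm (D n x) \<le> B" for n
  proof -
    have "compact (D n ` K)" by (rule compact_continuous_image[OF continuous_on_subset[OF Dc] K(1)]) simp
    then obtain B where B: "\<And>y. y \<in> D n ` K \<Longrightarrow> norm y \<le> B" by (meson bounded_iff compact_imp_bounded)
    then have "norm (D n x) \<le> max B 0" for x using z[of x n] by (cases "x \<in> K") (auto simp: le_max_iff_disj)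
    then show ?thesis by blast
  qed
  from Db[of 0] show "\<exists>B. \<forall>x. norm (\<phi> x) \<le> B" by (simp only: D(1))
  have ind: "indicat_real {-R..R} x *\<^sub>R (D n x * h x) = D n x * h x" for n x and h :: "real \<Rightarrow> complex"
    using z'[of x n] by (cases "x \<in> {-R..R}") auto
  have Di: "integrable lborel (\<lambda>x. D n x * h x)" if "continuous_on UNIV h" for n and h :: "real \<Rightarrow> complex"
  proof -
    have "set_integrable lborel {-R..R} (\<lambda>x. D n x * h x)"
      by (rule borel_integrable_atLeastAtMost')
        (intro continuous_intros continuous_on_subset[OF Dc] continuous_on_subset[OF that] subset_UNIV)
    then show ?thesis unfolding set_integrable_def ind .
  qed
  show pi: "integrable lborel \<phi>" using Di[of "\<lambda>_. 1" 0] D(1) by simp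
  define I where "I n x = (\<integral>k. D n k * exp (- (\<i> * of_real (x * k))) \<partial>lborel)" for n x
  have Ii: "integrable lborel (\<lambda>k. D n k * exp (- (\<i> * of_real (x * k))))" for n x
    by (rule Di) (intro continuous_intros)
  have parts: "I (Suc n) x = \<i> * of_real x * I n x" for n x
  proof (cases "-R \<le> R")
    case True
    let ?e = "\<lambda>k. exp (- (\<i> * of_real (x * k))) :: complex"
    have e: "(?e has_vector_derivative - (\<i> * of_real x) * ?e k) (at k)" for k
    proof -
      have "((\<lambda>k. - (\<i> * of_real (x * k))) has_vector_derivative - (\<i> * of_real x)) (at k)"
        by (auto intro!: derivative_eq_intros simp: has_real_derivative_iff_has_vector_derivative[symmetric])
      from field_vector_diff_chain_at[OF this DERIV_exp] show ?thesis by (simp add: o_def)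
    qed
    have "(\<integral>k. indicator {-R..R} k *\<^sub>R (D (Suc n) k * ?e k + D n k * (- (\<i> * of_real x) * ?e k)) \<partial>lborel)
      = D n R * ?e R - D n (-R) * ?e (-R)"
    proof (rule integral_FTC_atLeastAtMost[OF True])
      show "((\<lambda>k. D n k * ?e k) has_vector_derivative D (Suc n) k * ?e k + D n k * (- (\<i> * of_real x) * ?e k))
        (at k within {-R..R})" for k
        using has_vector_derivative_at_within[OF has_vector_derivative_mult[OF D(2)[of n k] e]]
          by (simp add: add.commute)
    qed (intro continuous_intros continuous_on_subset[OF Dc] subset_UNIV)
    also have "\<dots> = 0" using z'[of R n] z'[of "-R" n] by simp
    also have "(\<integral>k. indicator {-R..R} k *\<^sub>R (D (Suc n) k * ?e k + D n k * (- (\<i> * of_real x) * ?e k)) \<partial>lborel)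
      = I (Suc n) x - \<i> * of_real x * I n x"
    proof -
      have "indicator {-R..R} k *\<^sub>R (D (Suc n) k * ?e k + D n k * (- (\<i> * of_real x) * ?e k))
        = D (Suc n) k * ?e k - \<i> * of_real x * (D n k * ?e k)" for k
        by (cases "k \<in> {-R..R}") (use z'[of k] in \<open>auto simp: algebra_simps\<close>)
      then show ?thesis
        unfolding I_def by (simp only: Bochner_Integration.integral_diff[OF Ii integrable_mult_right[OF Ii]]
          integral_mult_right_zero)
    qed
    finally show ?thesis by simp
  next
    case False
    then have "D n k = 0" for n k by (intro z') auto
    then show ?thesis by (simp add: I_def)
  qed
  have four: "fourier \<phi> x = I 0 x / sqrt (2 * pi)" for x
    using fourier_real_lborel[of \<phi> x] borel_measurable_continuous_onI[OF c] by (simp add: I_def D(1))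
  have bound: "norm (I n x) \<le> (\<integral>k. norm (D n k) \<partial>lborel)" for n x
    unfolding I_def by (rule order_trans[OF integral_norm_bound])
      (simp add: norm_mult norm_exp_i_times del: of_real_mult)
  define C where "C = (\<integral>k. norm (D 0 k) \<partial>lborel) + (\<integral>k. norm (D 2 k) \<partial>lborel)"
  have dec: "norm (fourier \<phi> x) \<le> C * (1 / (1 + x\<^sup>2))" for x
  proof -
    have "I 2 x = - (of_real (x\<^sup>2)) * I 0 x"
      using parts[of 0 x] parts[of 1 x] by (simp add: numeral_2_eq_2 power2_eq_square)
        (simp add: complex_eq_iff algebra_simps)
    then have "I 0 x - I 2 x = of_real (1 + x\<^sup>2) * I 0 x" by (simp add: algebra_simps)
    then have "(1 + x\<^sup>2) * norm (I 0 x) = norm (I 0 x - I 2 x)"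
      by (simp only: norm_mult norm_of_real) simp
    also have "\<dots> \<le> C"
      unfolding C_def by (intro order_trans[OF norm_triangle_ineq4] add_mono bound)
    finally have "norm (I 0 x) \<le> C / (1 + x\<^sup>2)" by (simp add: field_simps add_pos_nonneg)
    moreover have "norm (fourier \<phi> x) \<le> norm (I 0 x)"
    proof -
      have "1 \<le> sqrt (2 * pi)" using pi_ge_two by simp
      then have "norm (I 0 x) / sqrt (2 * pi) \<le> norm (I 0 x) / 1" by (intro frac_le) auto
      then show ?thesis by (simp add: four norm_divide)
    qed
    ultimately show ?thesis by simp
  qed
  have inv: "integrable lborel (\<lambda>x::real. 1 / (1 + x\<^sup>2))"
  proof -
    note g = set_integrable_inverse_one_plus_sq
    have "set_integrable lborel {..0} (\<lambda>u::real. 1 / (1 + u\<^sup>2))"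
      using lborel_integrable_real_affine[OF g[unfolded set_integrable_def], of "-1" 0]
      by (simp add: set_integrable_def indicator_def cong: if_cong)
    from set_integrable_Un[OF this g] have "set_integrable lborel ({..0} \<union> {0..}) (\<lambda>u::real. 1 / (1 + u\<^sup>2))"
      by simp
    moreover have "{..0} \<union> {0..} = (UNIV :: real set)" by auto
    ultimately show ?thesis by (simp add: set_integrable_def)
  qed
  show "integrable lborel (fourier \<phi>)"
  proof (rule Bochner_Integration.integrable_bound)
    show "integrable lborel (\<lambda>x. C * (1 / (1 + x\<^sup>2)))" by (intro integrable_mult_right inv)
    have [measurable]: "\<phi> \<in> borel_measurable borel" by (rule borel_measurable_continuous_onI[OF c])
    have "(\<lambda>x. I 0 x / sqrt (2 * pi)) \<in> borel_measurable lborel"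
      unfolding I_def D(1) by measurable
    then show "fourier \<phi> \<in> borel_measurable lborel" by (simp add: four[abs_def])
    show "AE x in lborel. norm (fourier \<phi> x) \<le> norm (C * (1 / (1 + x\<^sup>2)))"
      by (intro AE_I2 order_trans[OF dec]) (simp only: real_norm_def abs_ge_self)
  qed
qed

section \<open>The Hankel function along a line, paired with Fourier transforms\<close>

lemma norm_mult_exp_i: "norm (z * exp (\<i> * of_real r)) = norm z"
  by (simp add: norm_mult norm_exp_i_times)

text \<open>
  A superposition of waves \<open>exp(\<i> b x)\<close> with integrable weight, paired with a Fourier transform,
  samples the original function at the frequencies \<open>b\<close>: this is Fubini and Fourier inversion.
\<close>

lemma superposition_against_fourier:
  fixes w :: "real \<Rightarrow> complex" and b :: "real \<Rightarrow> real"
  assumes t: "test_function {-R<..<R} \<phi>" and w: "integrable lborel w" and [measurable]: "b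
    \<in> borel_measurable borel"
  shows "(\<integral>x. (\<integral>u. w u * exp (\<i> * of_real (b u * x)) \<partial>lborel) * fourier \<phi> x \<partial>lborel)
    = sqrt (2 * pi) * (\<integral>u. w u * \<phi> (b u) \<partial>lborel)"
proof -
  note F = test_function_fourier_facts[OF t]
  have [measurable]: "fourier \<phi> \<in> borel_measurable borel" "w \<in> borel_measurable borel" using F(5) w by auto
  obtain B where B: "\<And>x. norm (\<phi> x) \<le> B" using F(2) by blast
  have "(\<integral>x. (\<integral>u. w u * exp (\<i> * of_real (b u * x)) \<partial>lborel) * fourier \<phi> x \<partial>lborel)
    = (\<integral>x. \<integral>u. w u * exp (\<i> * of_real (b u * x)) * fourier \<phi> x \<partial>lborel \<partial>lborel)"
    by simp
  also have "\<dots> = (\<integral>u. \<integral>x. w u * exp (\<i> * of_real (b u * x)) * fourier \<phi> x \<partial>lborel \<partial>lborel)"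
  proof (rule Fubini_lborel[where A="\<lambda>x. norm (fourier \<phi> x)" and B="\<lambda>u. norm (w u)"])
    show "norm (w u * exp (\<i> * of_real (b u * x)) * fourier \<phi> x) \<le> norm (fourier \<phi> x) * norm (w u)" for x u
      by (simp add: norm_mult norm_exp_i_times del: of_real_mult)
  qed (use w F(5) in \<open>auto intro!: integrable_norm\<close>)
  also have "\<dots> = (\<integral>u. w u * (sqrt (2 * pi) * \<phi> (b u)) \<partial>lborel)"
    by (simp add: fourier_inversion[OF F(1) B F(4,5), symmetric] mult.assoc mult.commute[of "fourier \<phi> _"]
      del: of_real_mult)
  also have "\<dots> = (\<integral>u. sqrt (2 * pi) * (w u * \<phi> (b u)) \<partial>lborel)" by (simp add: mult_ac)
  finally show ?thesis by simp
qed

lemma propagating_fourier: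
  assumes t: "test_function {-k0<..<k0} \<phi>"
  shows "(\<integral>x. propagating (k0 * (x - x')) Y * fourier \<phi> x \<partial>lborel)
    = sqrt (2 * pi) * (LINT t:{-(pi/2)..pi/2}|lborel. exp (\<i> * of_real (Y * cos t - k0 * x' * sin t))
      * \<phi> (k0 * sin t))"
proof -
  let ?w = "\<lambda>t. indicator {-(pi/2)..pi/2} t *\<^sub>R exp (\<i> * of_real (Y * cos t - k0 * x' * sin t)) :: complex"
  have w: "integrable lborel ?w"
    unfolding set_integrable_def[symmetric] by (rule borel_integrable_atLeastAtMost') (intro continuous_intros)
  have "propagating (k0 * (x - x')) Y = (\<integral>t. ?w t * exp (\<i> * of_real (k0 * sin t * x)) \<partial>lborel)" for x
    unfolding propagating_def set_lebesgue_integral_def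
    by (intro Bochner_Integration.integral_cong refl) (simp add: exp_add[symmetric] algebra_simps)
  then show ?thesis
    using superposition_against_fourier[OF t w, of "\<lambda>t. k0 * sin t"] by (simp add: set_lebesgue_integral_def)
qed

text \<open>
  The evanescent part oscillates along the line only with frequencies \<open>\<plusminus>k0 \<surd>(1 + u\<^sup>2)\<close>, at which
  test functions supported in \<open>(-k0, k0)\<close> vanish.
\<close>

lemma evanescent_fourier:
  assumes t: "test_function {-k0<..<k0} \<phi>" and k0: "k0 > 0" and Y: "Y > 0"
  shows "(\<integral>x. of_real (evanescent (k0 * (x - x')) Y) * fourier \<phi> x \<partial>lborel) = 0"
    "integrable lborel (\<lambda>x. of_real (evanescent (k0 * (x - x')) Y) * fourier \<phi> x)"
proof -
  note F = test_function_fourier_facts[OF t]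
  let ?s = "\<lambda>u::real. sqrt (1 + u\<^sup>2)"
  \<comment> \<open>The sign \<open>\<sigma>\<close> distinguishes the two exponentials in the cosine.\<close>
  let ?w = "\<lambda>\<sigma> u. indicator {0..} u *\<^sub>R
    (exp (\<i> * of_real (- \<sigma> * k0 * x' * ?s u)) * of_real (exp (- Y * u) / ?s u)) :: complex"
  have w: "integrable lborel (?w \<sigma>)" for \<sigma>
    unfolding set_integrable_def[symmetric]
  proof (rule set_integrable_bound_exp_decay[where c=Y and K=1])
    fix u :: real
    have "norm (exp (\<i> * of_real (- \<sigma> * k0 * x' * ?s u)) * of_real (exp (- Y * u) / ?s u) :: complex)
      = exp (- Y * u) / ?s u"
      unfolding norm_mult norm_exp_i_times norm_of_real using sqrt_one_plus_sq(3)[of u] by simp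
    also have "\<dots> \<le> exp (- Y * u) / 1" using sqrt_one_plus_sq[of u] by (intro frac_le) auto
    finally show "norm (exp (\<i> * of_real (- \<sigma> * k0 * x' * ?s u)) * of_real (exp (- Y * u) / ?s u) :: complex)
      \<le> 1 * exp (- Y * u)" by simp
  qed (use Y in auto)
  define I where "I \<sigma> x = (\<integral>u. ?w \<sigma> u * exp (\<i> * of_real (\<sigma> * k0 * ?s u * x)) \<partial>lborel)" for \<sigma> x
  have wi: "integrable lborel (\<lambda>u. ?w \<sigma> u * exp (\<i> * of_real (\<sigma> * k0 * ?s u * x)))" for \<sigma> x
    by (rule Bochner_Integration.integrable_bound[OF w[of \<sigma>]])
      (measurable, simp only: norm_mult_exp_i, simp)
  have ev: "of_real (evanescent (k0 * (x - x')) Y) = I 1 x + I (-1) x" for x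
  proof -
    have "of_real (evanescent (k0 * (x - x')) Y)
      = (\<integral>u. complex_of_real (indicator {0..} u *\<^sub>R (2 * cos (k0 * (x - x') * ?s u) * exp (- Y * u) / ?s u))
        \<partial>lborel)"
      unfolding evanescent_def set_lebesgue_integral_def by (rule integral_complex_of_real[symmetric])
    also have "\<dots> = (\<integral>u. ?w 1 u * exp (\<i> * of_real (1 * k0 * ?s u * x))
      + ?w (-1) u * exp (\<i> * of_real (-1 * k0 * ?s u * x)) \<partial>lborel)"
    proof (rule Bochner_Integration.integral_cong[OF refl])
      fix u :: real
      let ?a = "k0 * (x - x') * ?s u"
      have c: "complex_of_real (2 * cos ?a) = exp (\<i> * of_real ?a) + exp (\<i> * of_real (- ?a))"
        by (simp only: cis_conv_exp[symmetric]) (simp add: complex_eq_iff)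
      have e: "exp (\<i> * of_real (\<sigma> * ?a))
        = exp (\<i> * of_real (- \<sigma> * k0 * x' * ?s u)) * exp (\<i> * of_real (\<sigma> * k0 * ?s u * x))" for \<sigma>
      proof -
        have "\<sigma> * ?a = - \<sigma> * k0 * x' * ?s u + \<sigma> * k0 * ?s u * x" by (simp add: algebra_simps)
        then show ?thesis unfolding exp_add[symmetric] distrib_left[symmetric] of_real_add[symmetric]
          by (simp only:)
      qed
      show "complex_of_real (indicator {0..} u *\<^sub>R (2 * cos ?a * exp (- Y * u) / ?s u))
        = ?w 1 u * exp (\<i> * of_real (1 * k0 * ?s u * x)) + ?w (-1) u * exp (\<i> * of_real (-1 * k0 * ?s u * x))"
      proof -
        have "complex_of_real (2 * cos ?a * exp (- Y * u) / ?s u)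
          = complex_of_real (2 * cos ?a) * of_real (exp (- Y * u) / ?s u)"
          by simp
        also have "\<dots> = (exp (\<i> * of_real (1 * ?a)) + exp (\<i> * of_real (-1 * ?a)))
          * of_real (exp (- Y * u) / ?s u)"
          unfolding c by simp
        finally have "complex_of_real (2 * cos ?a * exp (- Y * u) / ?s u)
          = (exp (\<i> * of_real (1 * ?a)) + exp (\<i> * of_real (-1 * ?a))) * of_real (exp (- Y * u) / ?s u)" .
        moreover have "complex_of_real (i *\<^sub>R r) = i *\<^sub>R (a * v) * b + i *\<^sub>R (c * v) * d"
          if "complex_of_real r = (a * b + c * d) * v" for i r a b c d v
        proof -
          have "complex_of_real (i *\<^sub>R r) = of_real i * ((a * b + c * d) * v)" using that by simp
          then show ?thesis by (simp add: scaleR_conv_of_real algebra_simps)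
        qed
        ultimately show ?thesis unfolding e[of 1] e[of "-1"] by blast
      qed
    qed
    finally show ?thesis unfolding I_def by (simp only: Bochner_Integration.integral_add[OF wi wi])
  qed
  have [measurable]: "fourier \<phi> \<in> borel_measurable borel" using F(5) by auto
  have I0: "(\<integral>x. I \<sigma> x * fourier \<phi> x \<partial>lborel) = 0" if "\<bar>\<sigma>\<bar> = 1" for \<sigma>
  proof -
    have "\<phi> (\<sigma> * k0 * ?s u) = 0" for u
    proof -
      have "\<bar>\<sigma> * k0 * ?s u\<bar> = k0 * ?s u" using that k0 sqrt_one_plus_sq(3)[of u] by (simp add: abs_mult)
      moreover have "k0 * ?s u \<ge> k0 * 1" using k0 sqrt_one_plus_sq(1)[of u] by (intro mult_left_mono) auto
      ultimately have "\<not> \<bar>\<sigma> * k0 * ?s u\<bar> < k0" by simp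
      then show ?thesis by (intro F(3)) (simp only: greaterThanLessThan_iff abs_less_iff, linarith)
    qed
    then show ?thesis
      unfolding I_def by (subst superposition_against_fourier[OF t w]) auto
  qed
  have Ii: "integrable lborel (\<lambda>x. I \<sigma> x * fourier \<phi> x)" for \<sigma>
  proof (rule Bochner_Integration.integrable_bound[where f="\<lambda>x. (\<integral>u. norm (?w \<sigma> u) \<partial>lborel)
    * norm (fourier \<phi> x)"])
    show "integrable lborel (\<lambda>x. (\<integral>u. norm (?w \<sigma> u) \<partial>lborel) * norm (fourier \<phi> x))" using F(5) by simp
    show "(\<lambda>x. I \<sigma> x * fourier \<phi> x) \<in> borel_measurable lborel" unfolding I_def by measurable
    have "norm (I \<sigma> x) \<le> (\<integral>u. norm (?w \<sigma> u) \<partial>lborel)" for x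
      unfolding I_def
      by (rule order_trans[OF integral_norm_bound]) (unfold norm_mult_exp_i, rule order_refl)
    then show "AE x in lborel. norm (I \<sigma> x * fourier \<phi> x)
      \<le> norm ((\<integral>u. norm (?w \<sigma> u) \<partial>lborel) * norm (fourier \<phi> x))"
      by (intro AE_I2) (simp add: norm_mult mult_right_mono)
  qed
  show "integrable lborel (\<lambda>x. of_real (evanescent (k0 * (x - x')) Y) * fourier \<phi> x)"
    unfolding ev distrib_right by (intro Bochner_Integration.integrable_add Ii)
  show "(\<integral>x. of_real (evanescent (k0 * (x - x')) Y) * fourier \<phi> x \<partial>lborel) = 0"
    unfolding ev distrib_right by (simp only: Bochner_Integration.integral_add[OF Ii Ii]) (simp add: I0)
qed

lemma hankel_fourier:
  assumes t: "test_function {-k0<..<k0} \<phi>" and k0: "k0 > 0" and y: "y > 0"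
  shows "(\<integral>x. hankel1_0 (k0 * norm (x - x', y)) * fourier \<phi> x \<partial>lborel)
    = sqrt (2 * pi) / pi * (LINT t:{-(pi/2)..pi/2}|lborel. exp
      (\<i> * of_real (k0 * y * cos t - k0 * x' * sin t)) * \<phi> (k0 * sin t))"
proof -
  note F = test_function_fourier_facts[OF t]
  have Y: "k0 * y > 0" using k0 y by simp
  have [measurable]: "fourier \<phi> \<in> borel_measurable borel" using F(5) by auto
  have pb: "norm (propagating X Y) \<le> pi" for X Y
  proof -
    have "norm (propagating X Y) \<le> (\<integral>t. norm
      (indicator {-(pi/2)..pi/2} t *\<^sub>R exp (\<i> * of_real (X * sin t + Y * cos t)) :: complex) \<partial>lborel)"
      unfolding propagating_def set_lebesgue_integral_def by (rule integral_norm_bound)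
    also have "\<dots> = (\<integral>t. indicator {-(pi/2)..pi/2} t \<partial>lborel)"
      by (intro Bochner_Integration.integral_cong refl) (simp add: norm_exp_i_times del: of_real_add of_real_mult)
    finally show ?thesis by simp
  qed
  have pm: "(\<lambda>x. propagating (k0 * (x - x')) (k0 * y)) \<in> borel_measurable lborel"
    unfolding propagating_def set_lebesgue_integral_def by measurable
  have pi: "integrable lborel (\<lambda>x. propagating (k0 * (x - x')) (k0 * y) * fourier \<phi> x)"
    by (rule Bochner_Integration.integrable_bound[where f="\<lambda>x. pi * norm (fourier \<phi> x)"])
      (use F(5) pm pb in \<open>auto simp: norm_mult intro!: AE_I2 mult_right_mono\<close>)
  have "hankel1_0 (k0 * norm (x - x', y))
    = (propagating (k0 * (x - x')) (k0 * y) - \<i> * of_real (evanescent (k0 * (x - x')) (k0 * y))) / pi" for x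
  proof -
    have "k0 * norm (x - x', y) = sqrt ((k0 * (x - x'))\<^sup>2 + (k0 * y)\<^sup>2)"
      using k0 by (simp add: norm_Pair power_mult_distrib distrib_left[symmetric] real_sqrt_mult)
    then show ?thesis by (simp only: hankel_weyl[OF Y])
  qed
  then have "(\<integral>x. hankel1_0 (k0 * norm (x - x', y)) * fourier \<phi> x \<partial>lborel)
    = (\<integral>x. (1 / pi) * (propagating (k0 * (x - x')) (k0 * y) * fourier \<phi> x) - (\<i> / pi)
      * (of_real (evanescent (k0 * (x - x')) (k0 * y)) * fourier \<phi> x) \<partial>lborel)"
    by (intro Bochner_Integration.integral_cong refl) (simp add: left_diff_distrib diff_divide_distrib)
  also have "\<dots> = (1 / pi) * (\<integral>x. propagating (k0 * (x - x')) (k0 * y) * fourier \<phi> x \<partial>lborel)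
     - (\<i> / pi) * (\<integral>x. of_real (evanescent (k0 * (x - x')) (k0 * y)) * fourier \<phi> x \<partial>lborel)"
    by (simp only: Bochner_Integration.integral_diff[OF integrable_mult_right[OF pi]
      integrable_mult_right[OF evanescent_fourier(2)[OF t k0 Y]]] integral_mult_right_zero)
  finally show ?thesis by (simp add: evanescent_fourier(1)[OF t k0 Y] propagating_fourier[OF t])
qed

section \<open>The scattered field along a line\<close>

lemma helmholtz_G_measurable [measurable]: "helmholtz_G k0 \<in> borel_measurable borel"
proof -
  have "bessel_J0 \<in> borel_measurable borel"
    unfolding bessel_J0_def by measurable
  moreover have "bessel_Y0 \<in> borel_measurable borel"
    unfolding bessel_Y0_def bessel_J0_def by measurable
  ultimately have [measurable]: "hankel1_0 \<in> borel_measurable borel"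
    unfolding hankel1_0_def by measurable
  show ?thesis unfolding helmholtz_G_def by measurable
qed

text \<open>
  Up to the normalisation, the two-dimensional Fourier transform of \<open>q\<close> on the upper half of the
  circle of radius \<open>k0\<close>, parametrised by the first coordinate.
\<close>

definition plane_wave_transform :: "real \<Rightarrow> (real \<times> real \<Rightarrow> complex) \<Rightarrow> real \<Rightarrow> complex" where
  "plane_wave_transform k0 q k = (\<integral>r. q r * exp (- (\<i> * of_real (h_vec k0 k \<bullet> r))) \<partial>lborel)"

lemma kappa_nonzero:
  assumes "k \<in> {-k0<..<k0}"
  shows "kappa k0 k \<noteq> 0"
proof -
  have "\<bar>k\<bar> < k0" using assms by (auto simp: abs_less_iff)
  then have "k\<^sup>2 < k0\<^sup>2" using power_strict_mono[of "\<bar>k\<bar>" k0 2] by simp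
  then show ?thesis by (simp add: kappa_def)
qed

text \<open>
  Passing to the angle removes the singularity of \<open>1/\<kappa>\<close>.
\<close>

lemma kappa_sin:
  assumes "t \<in> {-(pi/2)..pi/2}" "k0 > 0"
  shows "kappa k0 (k0 * sin t) = k0 * cos t"
proof -
  have "cos t \<ge> 0" using assms(1) by (intro cos_ge_zero) auto
  moreover have "k0\<^sup>2 - (k0 * sin t)\<^sup>2 = (k0 * cos t)\<^sup>2"
    by (simp add: power_mult_distrib cos_squared_eq algebra_simps)
  ultimately show ?thesis using assms(2) by (simp add: kappa_def)
qed

lemma kappa_continuous: "continuous_on UNIV (kappa k0)"
  unfolding kappa_def by (intro continuous_intros)

lemma plane_wave_transform_continuous:
  assumes q: "integrable lborel q"
  shows "continuous_on UNIV (plane_wave_transform k0 q)"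
proof (intro continuous_at_imp_continuous_on ballI)
  fix k :: real
  have [measurable]: "q \<in> borel_measurable borel" using q by auto
  show "isCont (plane_wave_transform k0 q) k"
    unfolding continuous_at_sequentially o_def plane_wave_transform_def
  proof (intro allI impI)
    fix X :: "nat \<Rightarrow> real" assume X: "X \<longlonglongrightarrow> k"
    show "(\<lambda>n. \<integral>r. q r * exp (- (\<i> * of_real (h_vec k0 (X n) \<bullet> r))) \<partial>lborel)
      \<longlonglongrightarrow> (\<integral>r. q r * exp (- (\<i> * of_real (h_vec k0 k \<bullet> r))) \<partial>lborel)"
    proof (rule integral_dominated_convergence[where w="\<lambda>r. norm (q r)"])
      have "(\<lambda>n. kappa k0 (X n)) \<longlonglongrightarrow> kappa k0 k"
        by (rule continuous_on_tendsto_compose[OF kappa_continuous X]) auto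
      then have "(\<lambda>n. h_vec k0 (X n)) \<longlonglongrightarrow> h_vec k0 k" unfolding h_vec_def by (intro tendsto_Pair X)
      then show "AE r in lborel. (\<lambda>n. q r * exp (- (\<i> * of_real (h_vec k0 (X n) \<bullet> r))))
        \<longlonglongrightarrow> q r * exp (- (\<i> * of_real (h_vec k0 k \<bullet> r)))"
        by (intro AE_I2 tendsto_intros)
      show "AE r in lborel. norm (q r * exp (- (\<i> * of_real (h_vec k0 (X n) \<bullet> r)))) \<le> norm (q r)" for n
        by (intro AE_I2) (simp add: norm_mult)
    qed (use q in auto)
  qed
qed

text \<open>
  The measurement line keeps the distance \<open>rM - rs\<close> from the half plane that contains the source.
\<close>

lemma helmholtz_G_bounded:
  assumes "k0 > 0" "rM > rs"
  obtains K where "K \<ge> 0" "\<And>x r. snd r < rs \<Longrightarrow> norm (helmholtz_G k0 ((x, rM) - r)) \<le> K"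
proof -
  have "k0 * (rM - rs) > 0" using assms by simp
  from hankel1_0_bounded[OF this] obtain K where K: "\<And>z. z \<ge> k0 * (rM - rs) \<Longrightarrow> norm (hankel1_0 z) \<le> K" by blast
  have "norm (helmholtz_G k0 ((x, rM) - r)) \<le> max K 0" if "snd r < rs" for x r
  proof -
    have "(x, rM) - r = (x - fst r, rM - snd r)" by (cases r) simp
    then have "\<bar>rM - snd r\<bar> \<le> norm ((x, rM) - r)" using norm_snd_le[of "rM - snd r" "x - fst r"] by simp
    moreover have "rM - rs \<le> \<bar>rM - snd r\<bar>" using that by simp
    ultimately have "rM - rs \<le> norm ((x, rM) - r)" by simp
    then have "k0 * (rM - rs) \<le> k0 * norm ((x, rM) - r)" using assms by (intro mult_left_mono) auto
    from K[OF this] have "norm (hankel1_0 (k0 * norm ((x, rM) - r))) \<le> K" .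
    then have "norm (helmholtz_G k0 ((x, rM) - r))
      \<le> K / 4" unfolding helmholtz_G_def by (simp add: norm_mult norm_divide)
    also have "K / 4 \<le> max K 0" by (auto simp: max_def)
    finally show ?thesis .
  qed
  then show ?thesis using that[of "max K 0"] by auto
qed

context
  fixes k0 rs rM :: real and q :: "real \<times> real \<Rightarrow> complex"
  assumes k0: "k0 > 0" and rM: "rM > rs" and q: "integrable lborel q" and supp: "\<And>r. \<not> snd r < rs \<Longrightarrow> q r = 0"
begin

lemma born_measurable: "(\<lambda>(x, r). helmholtz_G k0 ((x, rM) - r) * q r) \<in> borel_measurable (lborel \<Otimes>\<^sub>M lborel)"
proof -
  have [measurable]: "q \<in> borel_measurable borel" using q by auto
  have "(\<lambda>(x, r). (x, rM) - r :: real \<times> real) \<in> borel_measurable (borel :: (real \<times> (real \<times> real)) measure)"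
    by (intro borel_measurable_continuous_onI) (auto simp: case_prod_beta intro!: continuous_intros)
  then have [measurable]: "(\<lambda>(x, r). (x, rM) - r :: real \<times> real) \<in> borel_measurable (lborel \<Otimes>\<^sub>M lborel)"
    by (simp add: lborel_prod)
  have "(\<lambda>p. helmholtz_G k0 (case p of (x, r) \<Rightarrow> (x, rM) - r) * q (snd p)) \<in> borel_measurable (lborel \<Otimes>\<^sub>M lborel)"
    by measurable
  then show ?thesis by (simp add: case_prod_beta)
qed

lemma born_bounded: "\<exists>K. \<forall>x. norm (\<integral>r. helmholtz_G k0 ((x, rM) - r) * q r \<partial>lborel) \<le> K"
proof -
  obtain K where K: "K \<ge> 0" "\<And>x r. snd r < rs \<Longrightarrow> norm (helmholtz_G k0 ((x, rM) - r)) \<le> K"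
    using helmholtz_G_bounded[OF k0 rM] by blast
  have "norm (\<integral>r. helmholtz_G k0 ((x, rM) - r) * q r \<partial>lborel) \<le> (\<integral>r. K * norm (q r) \<partial>lborel)" for x
  proof (rule order_trans[OF integral_norm_bound], rule integral_mono')
    show "integrable lborel (\<lambda>r. K * norm (q r))" using q by simp
    show "norm (helmholtz_G k0 ((x, rM) - r) * q r) \<le> K * norm (q r)" for r
      using K(2)[of r x] supp[of r] by (cases "snd r < rs") (auto simp: norm_mult mult_right_mono)
  qed (use K(1) in auto)
  then show ?thesis by blast
qed

text \<open>
  Two exchanges of integrals: first the pairing moves inside the source integral, where
  \<open>hankel_fourier\<close> evaluates it for every source point; then the angle is moved outside, which leaves
  the transform of the source at the direction \<open>t\<close>.
\<close>

lemma born_paired_with_fourier: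
  assumes t: "test_function {-k0<..<k0} \<phi>"
  shows "(\<integral>x. (\<integral>r. helmholtz_G k0 ((x, rM) - r) * q r \<partial>lborel) * fourier \<phi> x \<partial>lborel)
    = \<i> / 4 * (sqrt (2 * pi) / pi) * (LINT t:{-(pi/2)..pi/2}|lborel. plane_wave_transform k0 q (k0 * sin t)
      * (exp (\<i> * of_real (k0 * rM * cos t)) * \<phi> (k0 * sin t)))"
proof -
  note F = test_function_fourier_facts[OF t]
  have [measurable]: "q \<in> borel_measurable borel" "fourier \<phi> \<in> borel_measurable borel" "\<phi>
    \<in> borel_measurable borel"
    using q F(4,5) by auto
  obtain K where K: "K \<ge> 0" "\<And>x r. snd r < rs \<Longrightarrow> norm (helmholtz_G k0 ((x, rM) - r)) \<le> K"
    using helmholtz_G_bounded[OF k0 rM] by blast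
  obtain B where B: "\<And>x. norm (\<phi> x) \<le> B" using F(2) by blast
  have "(\<integral>x. (\<integral>r. helmholtz_G k0 ((x, rM) - r) * q r \<partial>lborel) * fourier \<phi> x \<partial>lborel)
    = (\<integral>x. \<integral>r. helmholtz_G k0 ((x, rM) - r) * q r * fourier \<phi> x \<partial>lborel \<partial>lborel)" by simp
  also have "\<dots> = (\<integral>r. \<integral>x. helmholtz_G k0 ((x, rM) - r) * q r * fourier \<phi> x \<partial>lborel \<partial>lborel)"
  proof (rule Fubini_lborel[where A="\<lambda>x. norm (fourier \<phi> x)" and B="\<lambda>r. K * norm (q r)"])
    show "(\<lambda>(x, r). helmholtz_G k0 ((x, rM) - r) * q r * fourier \<phi> x) \<in> borel_measurable (lborel \<Otimes>\<^sub>M lborel)"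
      using borel_measurable_times[OF born_measurable, of "\<lambda>p. fourier \<phi> (fst p)"] by (simp add: case_prod_beta)
    show "norm (helmholtz_G k0 ((x, rM) - r) * q r * fourier \<phi> x) \<le> norm (fourier \<phi> x) * (K * norm (q r))" for x r
    proof (cases "snd r < rs")
      case True
      have "norm (helmholtz_G k0 ((x, rM) - r) * q r * fourier \<phi> x)
        = norm (fourier \<phi> x) * (norm (helmholtz_G k0 ((x, rM) - r)) * norm (q r))"
        by (simp add: norm_mult)
      also have "\<dots> \<le> norm (fourier \<phi> x) * (K * norm (q r))"
        using K(2)[OF True] by (intro mult_left_mono mult_right_mono) auto
      finally show ?thesis .
    qed (simp add: supp K(1))
  qed (use q F(5) in auto)
  also have "\<dots> = (\<integral>r. \<integral>t. \<i> / 4 * (sqrt (2 * pi) / pi) * (q r * (indicator {-(pi/2)..pi/2} t *\<^sub>R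
      (exp (\<i> * of_real (k0 * (rM - snd r) * cos t - k0 * fst r * sin t)) * \<phi> (k0 * sin t)))) \<partial>lborel \<partial>lborel)"
  proof (rule Bochner_Integration.integral_cong[OF refl])
    fix r :: "real \<times> real"
    show "(\<integral>x. helmholtz_G k0 ((x, rM) - r) * q r * fourier \<phi> x \<partial>lborel)
      = (\<integral>t. \<i> / 4 * (sqrt (2 * pi) / pi) * (q r * (indicator {-(pi/2)..pi/2} t *\<^sub>R
      (exp (\<i> * of_real (k0 * (rM - snd r) * cos t - k0 * fst r * sin t)) * \<phi> (k0 * sin t)))) \<partial>lborel)"
    proof (cases "snd r < rs")
      case True
      have y: "rM - snd r > 0" using True rM by simp
      have "(x, rM) - r = (x - fst r, rM - snd r)" for x by (cases r) simp
      then have "(\<integral>x. helmholtz_G k0 ((x, rM) - r) * q r * fourier \<phi> x \<partial>lborel)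
        = (\<integral>x. (\<i> / 4 * q r) * (hankel1_0 (k0 * norm (x - fst r, rM - snd r)) * fourier \<phi> x) \<partial>lborel)"
        unfolding helmholtz_G_def by (simp add: mult_ac)
      also have "\<dots> = (\<i> / 4 * q r) * (\<integral>x. hankel1_0 (k0 * norm (x - fst r, rM - snd r)) * fourier \<phi> x \<partial>lborel)"
        by (rule integral_mult_right_zero)
      also note hankel_fourier[OF t k0 y]
      finally show ?thesis
        by (simp only: set_lebesgue_integral_def integral_mult_right_zero) (simp only: mult_ac)
    qed (simp add: supp)
  qed
  also have "\<dots> = \<i> / 4 * (sqrt (2 * pi) / pi) * (\<integral>r. \<integral>t. q r * (indicator {-(pi/2)..pi/2} t *\<^sub>R
      (exp (\<i> * of_real (k0 * (rM - snd r) * cos t - k0 * fst r * sin t)) * \<phi> (k0 * sin t))) \<partial>lborel \<partial>lborel)"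
    by (simp only: integral_mult_right_zero)
  also have "(\<integral>r. \<integral>t. q r * (indicator {-(pi/2)..pi/2} t *\<^sub>R
      (exp (\<i> * of_real (k0 * (rM - snd r) * cos t - k0 * fst r * sin t)) * \<phi> (k0 * sin t))) \<partial>lborel \<partial>lborel)
    = (\<integral>t. \<integral>r. q r * (indicator {-(pi/2)..pi/2} t *\<^sub>R
      (exp (\<i> * of_real (k0 * (rM - snd r) * cos t - k0 * fst r * sin t)) * \<phi> (k0 * sin t))) \<partial>lborel \<partial>lborel)"
  proof (rule Fubini_lborel[where A="\<lambda>r. norm (q r)" and B="\<lambda>t. B * indicator {-(pi/2)..pi/2} t"])
    show "norm (q r * (indicator {-(pi/2)..pi/2} t *\<^sub>R
      (exp (\<i> * of_real (k0 * (rM - snd r) * cos t - k0 * fst r * sin t)) * \<phi> (k0 * sin t))))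
      \<le> norm (q r) * (B * indicator {-(pi/2)..pi/2} t)" for r t
    proof -
      have "norm (q r * (indicator {-(pi/2)..pi/2} t *\<^sub>R
        (exp (\<i> * of_real (k0 * (rM - snd r) * cos t - k0 * fst r * sin t)) * \<phi> (k0 * sin t))))
        = norm (q r) * (norm (\<phi> (k0 * sin t)) * indicator {-(pi/2)..pi/2} t)"
        by (simp only: norm_mult norm_scaleR norm_exp_i_times) simp
      also have "\<dots> \<le> norm (q r) * (B * indicator {-(pi/2)..pi/2} t)"
        by (intro mult_left_mono mult_right_mono B) auto
      finally show ?thesis .
    qed
    show "(\<lambda>(r, t). q r * (indicat_real {-(pi/2)..pi/2} t *\<^sub>R
      (exp (\<i> * of_real (k0 * (rM - snd r) * cos t - k0 * fst r * sin t)) * \<phi> (k0 * sin t))))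
      \<in> borel_measurable (lborel \<Otimes>\<^sub>M lborel)"
    proof -
      define c where "c p = exp (\<i> * of_real
        (k0 * (rM - snd (fst p)) * cos (snd p) - k0 * fst (fst p) * sin (snd p))) * \<phi> (k0 * sin (snd p))"
        for p :: "(real \<times> real) \<times> real"
      have "c \<in> borel_measurable borel"
        unfolding c_def by (intro borel_measurable_continuous_onI continuous_intros
          continuous_on_compose2[OF F(1)]) auto
      then have [measurable]: "c \<in> borel_measurable (lborel \<Otimes>\<^sub>M lborel)" by (simp add: lborel_prod)
      have "(\<lambda>p. q (fst p) * (indicat_real {-(pi/2)..pi/2} (snd p) *\<^sub>R c p))
        \<in> borel_measurable (lborel \<Otimes>\<^sub>M lborel)"
        by measurable
      then show ?thesis by (simp add: case_prod_beta c_def)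
    qed
  qed (use q in auto)
  also have "\<dots> = (LINT t:{-(pi/2)..pi/2}|lborel. plane_wave_transform k0 q (k0 * sin t)
    * (exp (\<i> * of_real (k0 * rM * cos t)) * \<phi> (k0 * sin t)))"
    unfolding set_lebesgue_integral_def
  proof (rule Bochner_Integration.integral_cong[OF refl])
    fix t :: real
    show "(\<integral>r. q r * (indicator {-(pi/2)..pi/2} t *\<^sub>R
      (exp (\<i> * of_real (k0 * (rM - snd r) * cos t - k0 * fst r * sin t)) * \<phi> (k0 * sin t))) \<partial>lborel)
      = indicator {-(pi/2)..pi/2} t *\<^sub>R
        (plane_wave_transform k0 q (k0 * sin t) * (exp (\<i> * of_real (k0 * rM * cos t)) * \<phi> (k0 * sin t)))"
    proof (cases "t \<in> {-(pi/2)..pi/2}")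
      case True
      note kap = kappa_sin[OF True k0]
      have e: "exp (\<i> * of_real (k0 * (rM - snd r) * cos t - k0 * fst r * sin t))
        = exp (- (\<i> * of_real (h_vec k0 (k0 * sin t) \<bullet> r))) * exp (\<i> * of_real (k0 * rM * cos t))" for r
      proof -
        have "h_vec k0 (k0 * sin t) \<bullet> r
          = k0 * sin t * fst r + k0 * cos t * snd r" by (cases r) (simp add: h_vec_def kap)
        then show ?thesis unfolding exp_add[symmetric] by (simp add: algebra_simps)
      qed
      have "(\<integral>r. q r * (exp (\<i> * of_real (k0 * (rM - snd r) * cos t - k0 * fst r * sin t)) * \<phi> (k0 * sin t))
        \<partial>lborel)
        = (\<integral>r. q r * exp (- (\<i> * of_real (h_vec k0 (k0 * sin t) \<bullet> r)))
          * (exp (\<i> * of_real (k0 * rM * cos t)) * \<phi> (k0 * sin t)) \<partial>lborel)"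
        unfolding e by (simp only: mult.assoc)
      then show ?thesis using True by (simp add: plane_wave_transform_def del: of_real_mult)
    qed simp
  qed
  finally show ?thesis .
qed

end

text \<open>
  The substitution \<open>k = k0 sin t\<close>. The singularity of \<open>1/\<kappa>\<close> at \<open>\<plusminus>k0\<close> is harmless because \<open>\<phi>\<close>
  vanishes near these points, which makes the integrand on the right continuous.
\<close>

lemma sine_substitution:
  assumes t: "test_function {-k0<..<k0} \<phi>" and k0: "k0 > 0" and H: "continuous_on UNIV H"
  shows "(LINT t:{-(pi/2)..pi/2}|lborel. H (k0 * sin t) * (exp (\<i> * of_real (k0 * rM * cos t)) * \<phi> (k0 * sin t)))
    = (LINT k:{-k0<..<k0}|lebesgue. exp (\<i> * of_real (kappa k0 k * rM)) / of_real (kappa k0 k) * H k * \<phi> k)"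
proof -
  note F = test_function_fourier_facts[OF t]
  define g where "g k = exp (\<i> * of_real (kappa k0 k * rM)) / of_real (kappa k0 k) * H k * \<phi> k" for k
  define K where "K = closure {x. \<phi> x \<noteq> 0}"
  have K: "closed K" "K \<subseteq> {-k0<..<k0}" using t by (auto simp: test_function_def K_def)
  have "isCont g x" for x
  proof (cases "x \<in> K")
    case True
    then have nz: "kappa k0 x \<noteq> 0" using K(2) by (intro kappa_nonzero) auto
    have c: "isCont (kappa k0) x" "isCont H x" "isCont \<phi> x"
      using kappa_continuous H F(1) by (auto simp: continuous_on_eq_continuous_at)
    show ?thesis unfolding g_def by (intro continuous_intros c) (use nz in simp)
  next
    case False
    have "\<forall>\<^sub>F y in nhds x. y \<in> - K"
      by (rule eventually_nhds_in_open) (use K False in auto)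
    moreover have "g y = 0" if "y \<in> - K" for y
      using that closure_subset[of "{x. \<phi> x \<noteq> 0}"] by (auto simp: g_def K_def)
    ultimately have "\<forall>\<^sub>F y in nhds x. g y = 0" by (auto elim: eventually_mono)
    then show ?thesis using isCont_cong[of g "\<lambda>_. 0" x] by simp
  qed
  then have g: "continuous_on UNIV g" by (intro continuous_at_imp_continuous_on) auto
  have ends: "\<phi> k0 = 0" "\<phi> (- k0) = 0" by (rule F(3), simp)+
  have [measurable]: "g \<in> borel_measurable borel" by (rule borel_measurable_continuous_onI[OF g])
  have "((\<lambda>t. (k0 * cos t) *\<^sub>R g (k0 * sin t)) has_integral integral {k0 * sin (-(pi/2))..k0 * sin (pi/2)} g)
    {-(pi/2)..pi/2}"
  proof (rule has_integral_substitution)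
    show "(\<lambda>t. k0 * sin t) ` {-(pi/2)..pi/2} \<subseteq> {-k0..k0}"
    proof (rule image_subsetI)
      fix t
      have "\<bar>k0 * sin t\<bar> \<le> k0 * 1" using k0 unfolding abs_mult by (intro mult_mono) auto
      then show "k0 * sin t \<in> {-k0..k0}" by (simp add: abs_le_iff)
    qed
    show "continuous_on {-k0..k0} g" using g continuous_on_subset by blast
    show "((\<lambda>t. k0 * sin t) has_real_derivative k0 * cos x) (at x within {-(pi/2)..pi/2})" for x
      by (auto intro!: derivative_eq_intros)
  qed (use k0 in auto)
  then have "((\<lambda>t. (k0 * cos t) *\<^sub>R g (k0 * sin t)) has_integral integral {- k0..k0} g) {-(pi/2)..pi/2}" by simp
  moreover have "(k0 * cos t) *\<^sub>R g (k0 * sin t)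
    = H (k0 * sin t) * (exp (\<i> * of_real (k0 * rM * cos t)) * \<phi> (k0 * sin t))"
    if "t \<in> {-(pi/2)..pi/2}" for t
  proof -
    note kap = kappa_sin[OF that k0]
    show ?thesis
    \<comment> \<open>At the end points \<open>1/\<kappa>\<close> is \<open>1/0 = 0\<close>, but \<open>\<phi>\<close> vanishes there as well.\<close>
    proof (cases "cos t = 0")
      case True
      then have "sin t = 1 \<or> sin t = -1" using sin_cos_squared_add[of t] by (simp add: power2_eq_1_iff)
      then have "\<phi> (k0 * sin t) = 0" using ends by auto
      then show ?thesis by (simp add: g_def)
    next
      case False
      then show ?thesis using k0 by (simp add: g_def kap scaleR_conv_of_real mult_ac)
    qed
  qed
  ultimately have "((\<lambda>t. H (k0 * sin t) * (exp (\<i> * of_real (k0 * rM * cos t)) * \<phi> (k0 * sin t))) has_integral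
    integral {- k0..k0} g) {-(pi/2)..pi/2}"
    by (rule has_integral_eq[rotated])
  moreover have "(LINT t:{-(pi/2)..pi/2}|lborel. H (k0 * sin t)
    * (exp (\<i> * of_real (k0 * rM * cos t)) * \<phi> (k0 * sin t)))
     = integral {-(pi/2)..pi/2} (\<lambda>t. H (k0 * sin t) * (exp (\<i> * of_real (k0 * rM * cos t)) * \<phi> (k0 * sin t)))"
    by (intro set_borel_integral_eq_integral borel_integrable_atLeastAtMost' continuous_intros
        continuous_on_compose2[OF H] continuous_on_compose2[OF F(1)]) auto
  moreover have "integral {- k0..k0} g = (LINT k:{-k0..k0}|lborel. g k)"
    by (intro set_borel_integral_eq_integral(2)[symmetric] borel_integrable_atLeastAtMost'
      continuous_on_subset[OF g]) auto
  moreover have "(LINT k:{-k0..k0}|lborel. g k) = (LINT k:{-k0<..<k0}|lebesgue. g k)"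
  proof -
    have "indicat_real {-k0..k0} k *\<^sub>R g k = indicat_real {-k0<..<k0} k *\<^sub>R g k" for k
      using ends by (cases "k = k0 \<or> k = -k0") (auto simp: indicator_def g_def)
    then show ?thesis unfolding set_lebesgue_integral_def by (subst integral_completion)
      (simp_all only:, measurable)
  qed
  ultimately show ?thesis by (simp add: g_def integral_unique)
qed

section \<open>Borel representatives of the data\<close>

lemma completion_ex_borel_measurable_complex:
  fixes f :: "'a \<Rightarrow> complex"
  assumes f: "f \<in> borel_measurable (completion M)"
  shows "\<exists>f'\<in>borel_measurable M. AE x in M. f x = f' x"
proof -
  have "(\<lambda>x. Re (f x)) \<in> borel_measurable (completion M)" "(\<lambda>x. Im (f x)) \<in> borel_measurable (completion M)"
    using f by measurable
  from this[THEN completion_ex_borel_measurable_real]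
  obtain g h where gh: "g \<in> borel_measurable M" "AE x in M. Re (f x)
    = g x" "h \<in> borel_measurable M" "AE x in M. Im (f x) = h x"
    by blast
  have "AE x in M. f x = Complex (g x) (h x)"
    using gh(2,4) by eventually_elim (simp add: complex_eq_iff)
  moreover have "(\<lambda>x. Complex (g x) (h x)) \<in> borel_measurable M"
    unfolding Complex_eq using gh(1,3) by measurable
  ultimately show ?thesis by (rule bexI[where x="\<lambda>x. Complex (g x) (h x)"])
qed

text \<open>
  The complement of the essential support is a union of open sets on which \<open>f\<close> vanishes almost
  everywhere; by the Lindelof property countably many of them suffice.
\<close>

lemma AE_eq_0_outside_ess_support: "AE y in lebesgue. y \<notin> ess_support f \<longrightarrow> f y = 0"
proof -
  define F where "F = {U. open U \<and> (AE y in lebesgue. y \<in> U \<longrightarrow> f y = 0)}"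
  obtain F' where F': "F' \<subseteq> F" "countable F'" "\<Union>F' = \<Union>F"
  proof (rule Lindelof[of F])
    show "open S" if "S \<in> F" for S using that by (simp add: F_def)
  qed
  have "AE y in lebesgue. \<forall>U\<in>F'. y \<in> U \<longrightarrow> f y = 0"
    unfolding AE_ball_countable[OF F'(2)]
  proof
    fix U assume "U \<in> F'"
    then have "U \<in> F" using F'(1) by blast
    then show "AE y in lebesgue. y \<in> U \<longrightarrow> f y = 0" by (simp add: F_def)
  qed
  then show ?thesis
  proof eventually_elim
    case (elim y)
    have "y \<in> \<Union>F" if "y \<notin> ess_support f" using that unfolding ess_support_def F_def by blast
    then show ?case using elim F'(3) by blast
  qed
qed

text \<open>
  On a set of finite measure, square integrability implies integrability since \<open>\<bar>z\<bar> \<le> 1 + \<bar>z\<bar>\<^sup>2\<close>.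
\<close>

lemma integrable_of_square_integrable:
  fixes f :: "'a \<Rightarrow> complex"
  assumes [measurable]: "f \<in> borel_measurable M" "A \<in> sets M" and A: "emeasure M A < \<infinity>"
    and sq: "integrable M (\<lambda>x. (norm (f x))\<^sup>2)" and supp: "\<And>x. x \<notin> A \<Longrightarrow> f x = 0"
  shows "integrable M f"
proof (rule Bochner_Integration.integrable_bound)
  show "integrable M (\<lambda>x. indicator A x + (norm (f x))\<^sup>2 :: real)"
    using sq A by (intro Bochner_Integration.integrable_add integrable_real_indicator) auto
  have "norm (f x) \<le> 1 + (norm (f x))\<^sup>2" for x
  proof (cases "norm (f x) \<ge> 1")
    case True
    then show ?thesis using self_le_power[OF True, of 2] by simp
  next
    case False
    then show ?thesis by (intro add_increasing2) auto
  qed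
  then show "AE x in M. norm (f x) \<le> norm (indicator A x + (norm (f x))\<^sup>2 :: real)"
    using supp by (intro AE_I2) (auto simp: indicator_def)
qed simp

text \<open>
  Fubini's theorem is applied to product measures, which are not complete. A Lebesgue measurable
  source is therefore replaced by a Borel function that equals it almost everywhere and vanishes
  everywhere outside the ball, which leaves all integrals against Borel functions unchanged.
\<close>

lemma ex_borel_representative:
  fixes f :: "real \<times> real \<Rightarrow> complex"
  assumes f: "square_integrable lebesgue f" and s: "ess_support f \<subseteq> ball 0 R"
  obtains f0 where "integrable lborel f0" "\<And>r. r \<notin> ball 0 R \<Longrightarrow> f0 r = 0"
    "\<And>g. g \<in> borel_measurable borel \<Longrightarrow> (\<integral>r. g r * f r \<partial>lebesgue) = (\<integral>r. g r * f0 r \<partial>lborel)"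
proof -
  have fm: "f \<in> borel_measurable lebesgue" and fs: "integrable lebesgue (\<lambda>x. (norm (f x))\<^sup>2)"
    using f by (auto simp: square_integrable_def)
  obtain f1 where f1 [measurable]: "f1 \<in> borel_measurable lborel" and ae: "AE x in lborel. f x = f1 x"
    using completion_ex_borel_measurable_complex[OF fm] by blast
  define f0 where "f0 r = indicator (ball 0 R) r *\<^sub>R f1 r" for r
  have [measurable]: "f0 \<in> borel_measurable borel" using f1 unfolding f0_def[abs_def]
    by (intro borel_measurable_scaleR borel_measurable_indicator) auto
  have ae0: "AE r in lebesgue. f r = f0 r"
    using AE_completion[OF ae] AE_eq_0_outside_ess_support[of f]
  proof eventually_elim
    case (elim r)
    show ?case
    proof (cases "r \<in> ball 0 R")
      case True
      then show ?thesis using elim(1) by (simp add: f0_def)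
    next
      case False
      then have "f r = 0" using s elim(2) by blast
      then show ?thesis using False by (simp add: f0_def)
    qed
  qed
  have f0l: "f0 \<in> borel_measurable lebesgue" by (rule measurable_completion) simp
  have "integrable lebesgue (\<lambda>r. (norm (f0 r))\<^sup>2)"
  proof (rule integrable_cong_AE_imp[OF fs])
    show "(\<lambda>r. (norm (f0 r))\<^sup>2) \<in> borel_measurable lebesgue" using f0l by measurable
    show "AE r in lebesgue. (norm (f r))\<^sup>2 = (norm (f0 r))\<^sup>2" using ae0 by eventually_elim simp
  qed
  then have sq: "integrable lborel (\<lambda>r. (norm (f0 r))\<^sup>2)"
    by (rule integrable_completion[THEN iffD1, rotated]) simp
  have f0i: "integrable lborel f0"
  proof (rule integrable_of_square_integrable[OF _ _ _ sq, of "ball 0 R"])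
    show "emeasure lborel (ball (0 :: real \<times> real) R) < \<infinity>" by (rule emeasure_bounded_finite[OF bounded_ball])
    show "f0 r = 0" if "r \<notin> ball 0 R" for r using that by (simp add: f0_def)
  qed simp_all
  have f0eq: "(\<integral>r. g r * f r \<partial>lebesgue)
    = (\<integral>r. g r * f0 r \<partial>lborel)" if [measurable]: "g \<in> borel_measurable borel" for g
  proof -
    have gl: "g \<in> borel_measurable lebesgue" by (rule measurable_completion) simp
    have "(\<integral>r. g r * f r \<partial>lebesgue) = (\<integral>r. g r * f0 r \<partial>lebesgue)"
    proof (rule integral_cong_AE)
      show "(\<lambda>r. g r * f r) \<in> borel_measurable lebesgue" by (rule borel_measurable_times[OF gl fm])
      show "(\<lambda>r. g r * f0 r) \<in> borel_measurable lebesgue" by (rule borel_measurable_times[OF gl f0l])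
      show "AE r in lebesgue. g r * f r = g r * f0 r" using ae0 by eventually_elim simp
    qed
    also have "\<dots> = (\<integral>r. g r * f0 r \<partial>lborel)" by (rule integral_completion) simp
    finally show ?thesis .
  qed
  show ?thesis
    by (rule that[OF f0i _ f0eq]) (simp_all add: f0_def)
qed

text \<open>
  For the same reason the density on the completed circle is replaced by a Borel function of the
  angle, extended by zero to the whole line.
\<close>

lemma ex_angular_density:
  assumes a: "square_integrable arc_length a"
  obtains \<alpha> :: "real \<Rightarrow> complex" where "integrable lborel \<alpha>"
    "\<And>g. g \<in> borel_measurable borel \<Longrightarrow> (\<integral>s. a s * g s \<partial>arc_length) = (\<integral>t. \<alpha> t * g (cos t, sin t) \<partial>lborel)"
proof -
  let ?I = "{0..<2 * pi}" let ?S = "sphere 0 1 :: (real \<times> real) set" let ?p = "\<lambda>t. (cos t, sin t) :: real \<times> real"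
  let ?D = "distr (restrict_space lborel ?I) (restrict_space borel ?S) ?p"
  have arc: "arc_length = completion ?D" by (simp add: arc_length_def)
  have am: "a \<in> borel_measurable (completion ?D)" and as: "integrable (completion ?D) (\<lambda>x. (norm (a x))\<^sup>2)"
    using a by (auto simp: square_integrable_def arc)
  have pb: "?p \<in> borel_measurable borel"
    by (intro borel_measurable_continuous_onI continuous_intros)
  have pm [measurable]: "?p \<in> restrict_space lborel ?I \<rightarrow>\<^sub>M restrict_space borel ?S"
  proof (rule measurable_restrict_space2)
    show "?p \<in> borel_measurable (restrict_space lborel ?I)"
      by (rule measurable_restrict_space1) (use pb in simp)
  qed (auto simp: norm_Pair)
  obtain a1 where a1: "a1 \<in> borel_measurable ?D" and ae: "AE x in ?D. a x = a1 x"
    using completion_ex_borel_measurable_complex[OF am] by blast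
  have a1S: "a1 \<in> borel_measurable (restrict_space borel ?S)" using a1 by simp
  define \<alpha> where "\<alpha> t = indicator ?I t *\<^sub>R a1 (?p t)" for t
  have aI: "(\<lambda>t. a1 (?p t)) \<in> borel_measurable (restrict_space lborel ?I)"
    by (rule measurable_compose[OF pm a1S])
  have alm [measurable]: "\<alpha> \<in> borel_measurable borel"
  proof -
    have "(\<lambda>t. indicator ?I t *\<^sub>R a1 (?p t)) \<in> borel_measurable lborel"
      by (rule borel_measurable_restrict_space_iff[THEN iffD1, OF _ aI]) auto
    then show ?thesis unfolding \<alpha>_def[abs_def] by (simp only: measurable_lborel1 measurable_lborel2)
  qed
  have aec: "AE x in completion ?D. a x = a1 x" by (rule AE_completion[OF ae])
  have a1c: "a1 \<in> borel_measurable (completion ?D)" by (rule measurable_completion[OF a1])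
  have "integrable (completion ?D) (\<lambda>x. (norm (a1 x))\<^sup>2)"
  proof (rule integrable_cong_AE_imp[OF as])
    show "(\<lambda>x. (norm (a1 x))\<^sup>2) \<in> borel_measurable (completion ?D)" using a1c by measurable
    show "AE x in completion ?D. (norm (a x))\<^sup>2 = (norm (a1 x))\<^sup>2" using aec by eventually_elim simp
  qed
  then have "integrable ?D (\<lambda>x. (norm (a1 x))\<^sup>2)"
    by (rule integrable_completion[THEN iffD1, rotated]) (use a1 in measurable)
  then have "integrable (restrict_space lborel ?I) (\<lambda>t. (norm (a1 (?p t)))\<^sup>2)"
    by (rule integrable_distr[OF pm])
  then have "integrable lborel (\<lambda>t. indicator ?I t *\<^sub>R (norm (a1 (?p t)))\<^sup>2)"
    by (rule integrable_restrict_space[THEN iffD1, rotated]) simp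
  moreover have "indicator ?I t *\<^sub>R (norm (a1 (?p t)))\<^sup>2 = (norm (\<alpha> t))\<^sup>2" for t
    by (simp add: \<alpha>_def indicator_def)
  ultimately have sq: "integrable lborel (\<lambda>t. (norm (\<alpha> t))\<^sup>2)" by simp
  have "integrable lborel \<alpha>"
  proof (rule integrable_of_square_integrable[OF _ _ _ sq, of ?I])
    show "\<alpha> t = 0" if "t \<notin> ?I" for t using that by (simp add: \<alpha>_def)
  qed simp_all
  moreover have "(\<integral>s. a s * g s \<partial>arc_length) = (\<integral>t. \<alpha> t * g (cos t, sin t) \<partial>lborel)"
    if g: "g \<in> borel_measurable borel" for g
  proof -
    have gS: "g \<in> borel_measurable (restrict_space borel ?S)" by (rule measurable_restrict_space1[OF g])
    then have gD: "g \<in> borel_measurable ?D" by simp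
    have gc: "g \<in> borel_measurable (completion ?D)" by (rule measurable_completion[OF gD])
    have "(\<integral>s. a s * g s \<partial>arc_length) = (\<integral>s. a1 s * g s \<partial>completion ?D)"
      unfolding arc
    proof (rule integral_cong_AE)
      show "(\<lambda>s. a s * g s) \<in> borel_measurable (completion ?D)" by (rule borel_measurable_times[OF am gc])
      show "(\<lambda>s. a1 s * g s) \<in> borel_measurable (completion ?D)" by (rule borel_measurable_times[OF a1c gc])
      show "AE s in completion ?D. a s * g s = a1 s * g s" using aec by eventually_elim simp
    qed
    also have "\<dots> = (\<integral>s. a1 s * g s \<partial>?D)"
      by (rule integral_completion[OF borel_measurable_times[OF a1 gD]])
    also have "\<dots> = (\<integral>t. a1 (?p t) * g (?p t) \<partial>restrict_space lborel ?I)"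
      by (rule integral_distr[OF pm borel_measurable_times[OF a1S gS]])
    also have "\<dots> = (\<integral>t. indicator ?I t *\<^sub>R (a1 (?p t) * g (?p t)) \<partial>lborel)"
      by (rule integral_restrict_space) auto
    also have "\<dots> = (\<integral>t. \<alpha> t * g (cos t, sin t) \<partial>lborel)" by (simp add: \<alpha>_def)
    finally show ?thesis .
  qed
  ultimately show ?thesis using that by blast
qed

section \<open>Fourier diffraction\<close>

theorem theorem2p3:
  fixes k0 rs rM :: real and f a :: "real \<times> real \<Rightarrow> complex"
  assumes "k0 > 0" and "rs > 0" and "rM > rs"
    and "square_integrable lebesgue f" and "ess_support f \<subseteq> ball 0 rs"
    and "square_integrable arc_length a"
  shows "slowly_growing (\<lambda>x. born_field k0 f a (x, rM)) \<and>
    given_by_on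
      (fourier_distribution (regular_distribution (\<lambda>x. born_field k0 f a (x, rM))))
      {- k0 <..< k0}
      (\<lambda>k. of_real (sqrt (pi / 2)) *
         (\<i> * exp (\<i> * of_real (kappa k0 k * rM)) / of_real (kappa k0 k)) *
         (\<integral>s. a s * fourier f (h_vec k0 k - k0 *\<^sub>R s) \<partial>arc_length))"
proof -
  obtain f0 where f0: "integrable lborel f0" "\<And>r. r \<notin> ball 0 rs \<Longrightarrow> f0 r = 0"
    "\<And>g. g \<in> borel_measurable borel \<Longrightarrow> (\<integral>r. g r * f r \<partial>lebesgue) = (\<integral>r. g r * f0 r \<partial>lborel)"
    using ex_borel_representative[OF assms(4,5)] by blast
  obtain \<alpha> :: "real \<Rightarrow> complex" where al: "integrable lborel \<alpha>"
    "\<And>g. g \<in> borel_measurable borel \<Longrightarrow> (\<integral>s. a s * g s \<partial>arc_length) = (\<integral>t. \<alpha> t * g (cos t, sin t) \<partial>lborel)"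
    using ex_angular_density[OF assms(6)] by blast
  have [measurable]: "f0 \<in> borel_measurable borel" "\<alpha> \<in> borel_measurable borel" using f0(1) al(1) by auto
  define U where "U r = (\<integral>t. \<alpha> t * exp (\<i> * of_real (k0 * (r \<bullet> (cos t, sin t)))) \<partial>lborel)" for r :: "real \<times> real"
  have inc: "incident_field k0 a = U"
    unfolding incident_field_def U_def
    by (intro ext al(2) borel_measurable_continuous_onI continuous_intros)
  have [measurable]: "U \<in> borel_measurable borel"
  proof -
    have "(\<lambda>(r, t). exp (\<i> * of_real (k0 * (r \<bullet> (cos t, sin t)))))
      \<in> borel_measurable (borel :: ((real \<times> real) \<times> real) measure)"
      by (intro borel_measurable_continuous_onI) (auto simp: case_prod_beta intro!: continuous_intros)
    then have [measurable]: "(\<lambda>(r, t). exp (\<i> * of_real (k0 * (r \<bullet> (cos t, sin t)))))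
      \<in> borel_measurable ((borel :: (real \<times> real) measure) \<Otimes>\<^sub>M lborel)"
      by (simp add: borel_prod measurable_cong_sets[OF sets_pair_measure_cong[OF refl sets_lborel] refl])
    have "(\<lambda>(r, t). \<alpha> t * exp (\<i> * of_real (k0 * (r \<bullet> (cos t, sin t)))))
      \<in> borel_measurable ((borel :: (real \<times> real) measure) \<Otimes>\<^sub>M lborel)"
      by measurable
    then show ?thesis unfolding U_def by (rule lborel.borel_measurable_lebesgue_integral)
  qed
  have Ub: "norm (U r) \<le> (\<integral>t. norm (\<alpha> t) \<partial>lborel)" for r
    unfolding U_def by (rule order_trans[OF integral_norm_bound]) (unfold norm_mult_exp_i, rule order_refl)
  define q where "q r = f0 r * U r" for r
  have q: "integrable lborel q"
  proof (rule Bochner_Integration.integrable_bound)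
    show "integrable lborel (\<lambda>r. norm (f0 r) * (\<integral>t. norm (\<alpha> t) \<partial>lborel))" using f0(1) by simp
    show "AE r in lborel. norm (q r) \<le> norm (norm (f0 r) * (\<integral>t. norm (\<alpha> t) \<partial>lborel))"
      unfolding q_def by (intro AE_I2) (simp add: norm_mult mult_left_mono Ub)
  qed (simp add: q_def[abs_def])
  have supp: "q r = 0" if "\<not> snd r < rs" for r
  proof -
    have "\<bar>snd r\<bar> \<le> norm r" using norm_snd_le[of "snd r" "fst r"] by simp
    then have "r \<notin> ball 0 rs" using that by simp
    then show ?thesis by (simp add: q_def f0(2))
  qed
  note core = assms(1) assms(3) q supp
  define Bq where "Bq x = (\<integral>r. helmholtz_G k0 ((x, rM) - r) * q r \<partial>lborel)" for x
  have born: "born_field k0 f a (x, rM) = Bq x" for x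
  proof -
    have "born_field k0 f a (x, rM) = (\<integral>r. (helmholtz_G k0 ((x, rM) - r) * U r) * f r \<partial>lebesgue)"
      by (simp add: born_field_def inc mult_ac)
    also have "\<dots> = (\<integral>r. (helmholtz_G k0 ((x, rM) - r) * U r) * f0 r \<partial>lborel)"
    proof (rule f0(3))
      have "(\<lambda>r. (x, rM) - r) \<in> borel_measurable borel"
        by (intro borel_measurable_continuous_onI continuous_intros)
      then show "(\<lambda>r. helmholtz_G k0 ((x, rM) - r) * U r) \<in> borel_measurable borel" by measurable
    qed
    finally show ?thesis by (simp add: Bq_def q_def mult_ac)
  qed
  have Bm [measurable]: "Bq \<in> borel_measurable borel"
    unfolding Bq_def using lborel.borel_measurable_lebesgue_integral[OF born_measurable[OF core]] by simp
  have fourier2: "fourier f \<xi> = (\<integral>r. exp (- (\<i> * of_real (\<xi> \<bullet> r))) * f0 r \<partial>lborel) / (2 * pi)" for \<xi>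
  proof -
    have "(\<integral>r. f r * exp (- (\<i> * of_real (\<xi> \<bullet> r))) \<partial>lebesgue)
      = (\<integral>r. exp (- (\<i> * of_real (\<xi> \<bullet> r))) * f0 r \<partial>lborel)"
      by (subst mult.commute) (intro f0(3) borel_measurable_continuous_onI continuous_intros)
    then show ?thesis by (simp add: fourier_def powr_minus_divide)
  qed
  \<comment> \<open>The transform of the product \<open>f u\<^sup>i\<^sup>n\<^sup>c\<close> at \<open>h k\<close> superposes shifted transforms of \<open>f\<close>.\<close>
  have far: "(\<integral>s. a s * fourier f (h_vec k0 k - k0 *\<^sub>R s) \<partial>arc_length)
    = plane_wave_transform k0 q k / (2 * pi)" for k
  proof -
    let ?e = "\<lambda>t r. exp (- (\<i> * of_real ((h_vec k0 k - k0 *\<^sub>R (cos t, sin t)) \<bullet> r))) :: complex"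
    have cont: "(\<lambda>(s, r). exp (- (\<i> * of_real ((h_vec k0 k - k0 *\<^sub>R s) \<bullet> r))) :: complex)
      \<in> borel_measurable ((borel :: (real \<times> real) measure) \<Otimes>\<^sub>M lborel)"
    proof -
      have "(\<lambda>(s, r). exp (- (\<i> * of_real ((h_vec k0 k - k0 *\<^sub>R s) \<bullet> r))) :: complex)
        \<in> borel_measurable (borel :: ((real \<times> real) \<times> (real \<times> real)) measure)"
        by (intro borel_measurable_continuous_onI) (auto simp: case_prod_beta intro!: continuous_intros)
      then show ?thesis by (simp add: borel_prod
        measurable_cong_sets[OF sets_pair_measure_cong[OF refl sets_lborel] refl])
    qed
    have "(\<integral>s. a s * fourier f (h_vec k0 k - k0 *\<^sub>R s) \<partial>arc_length)
      = (\<integral>t. \<alpha> t * fourier f (h_vec k0 k - k0 *\<^sub>R (cos t, sin t)) \<partial>lborel)"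
    proof (rule al(2))
      have "(\<lambda>(s, r). exp (- (\<i> * of_real ((h_vec k0 k - k0 *\<^sub>R s) \<bullet> r))) * f0 r)
        \<in> borel_measurable ((borel :: (real \<times> real) measure) \<Otimes>\<^sub>M lborel)"
        using cont by measurable
      from lborel.borel_measurable_lebesgue_integral[OF this]
      show "(\<lambda>s. fourier f (h_vec k0 k - k0 *\<^sub>R s)) \<in> borel_measurable borel"
        unfolding fourier2 by measurable
    qed
    also have "\<dots> = (\<integral>t. \<integral>r. \<alpha> t * (?e t r * f0 r) \<partial>lborel \<partial>lborel) / (2 * pi)"
      unfolding fourier2 by simp
    also have "(\<integral>t. \<integral>r. \<alpha> t * (?e t r * f0 r) \<partial>lborel \<partial>lborel) = (\<integral>r. \<integral>t. \<alpha> t * (?e t r * f0 r) \<partial>lborel \<partial>lborel)"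
    proof (rule Fubini_lborel[where A="\<lambda>t. norm (\<alpha> t)" and B="\<lambda>r. norm (f0 r)"])
      have "(\<lambda>(t, r). ?e t r) \<in> borel_measurable (borel :: (real \<times> (real \<times> real)) measure)"
        by (intro borel_measurable_continuous_onI) (auto simp: case_prod_beta intro!: continuous_intros)
      then have [measurable]: "(\<lambda>(t, r). ?e t r)
        \<in> borel_measurable (lborel \<Otimes>\<^sub>M lborel)" by (simp add: lborel_prod)
      have "(\<lambda>p. \<alpha> (fst p) * ((case p of (t, r) \<Rightarrow> ?e t r) * f0 (snd p)))
        \<in> borel_measurable (lborel \<Otimes>\<^sub>M lborel)" by measurable
      then show "(\<lambda>(t, r). \<alpha> t * (?e t r * f0 r))
        \<in> borel_measurable (lborel \<Otimes>\<^sub>M lborel)" by (simp add: case_prod_beta)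
      show "norm (\<alpha> t * (?e t r * f0 r)) \<le> norm (\<alpha> t) * norm (f0 r)" for t r by (simp add: norm_mult)
    qed (use al(1) f0(1) in auto)
    also have "\<dots> = plane_wave_transform k0 q k"
      unfolding plane_wave_transform_def
    proof (rule Bochner_Integration.integral_cong[OF refl])
      fix r :: "real \<times> real"
      have "\<alpha> t * (?e t r * f0 r) = (f0 r * exp (- (\<i> * of_real (h_vec k0 k \<bullet> r))))
        * (\<alpha> t * exp (\<i> * of_real (k0 * (r \<bullet> (cos t, sin t)))))" for t
      proof -
        have "?e t r = exp (- (\<i> * of_real (h_vec k0 k \<bullet> r))) * exp (\<i> * of_real (k0 * (r \<bullet> (cos t, sin t))))"
        proof -
          have "(h_vec k0 k - k0 *\<^sub>R (cos t, sin t)) \<bullet> r = h_vec k0 k \<bullet> r - k0 * (r \<bullet> (cos t, sin t))"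
            by (simp only: inner_diff_left inner_scaleR_left inner_commute[of r])
          then show ?thesis unfolding exp_add[symmetric] by (simp only:) (simp add: algebra_simps)
        qed
        then show ?thesis by (simp only: mult_ac)
      qed
      then have "(\<integral>t. \<alpha> t * (?e t r * f0 r) \<partial>lborel) = (f0 r * exp (- (\<i> * of_real (h_vec k0 k \<bullet> r)))) * U r"
        unfolding U_def by (simp only: integral_mult_right_zero)
      then show "(\<integral>t. \<alpha> t * (?e t r * f0 r) \<partial>lborel) = q r * exp (- (\<i> * of_real (h_vec k0 k \<bullet> r)))"
        by (simp only: q_def mult_ac)
    qed
    finally show ?thesis .
  qed
  let ?g = "\<lambda>k. of_real (sqrt (pi / 2)) * (\<i> * exp (\<i> * of_real (kappa k0 k * rM)) / of_real (kappa k0 k))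
    * (plane_wave_transform k0 q k / (2 * pi))"
  have "slowly_growing Bq"
  proof -
    obtain C where C: "\<And>x. norm (Bq x) \<le> C" using born_bounded[OF core] unfolding Bq_def by blast
    have "\<forall>x. norm (Bq x) \<le> C * (1 + \<bar>x\<bar>) ^ 0" using C by simp
    moreover have "Bq \<in> borel_measurable lebesgue" by (rule measurable_completion) simp
    ultimately show ?thesis unfolding slowly_growing_def by blast
  qed
  moreover have "set_integrable lebesgue K ?g" if K: "compact K" "K \<subseteq> {-k0<..<k0}" for K
  proof -
    have "kappa k0 k \<noteq> 0" if "k \<in> K" for k
      using K(2) that by (intro kappa_nonzero) auto
    then have "continuous_on K ?g"
      by (intro continuous_intros continuous_on_subset[OF kappa_continuous]
        continuous_on_subset[OF plane_wave_transform_continuous[OF q]]) auto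
    note i = borel_integrable_compact[OF K(1) this]
    show ?thesis
      unfolding set_integrable_def integrable_completion[OF borel_measurable_integrable[OF i]] by (rule i)
  qed
  moreover have "fourier_distribution (regular_distribution Bq) \<phi> = (LINT x:{-k0<..<k0}|lebesgue. ?g x * \<phi> x)"
    if t: "test_function {-k0<..<k0} \<phi>" for \<phi>
  proof -
    have [measurable]: "fourier \<phi> \<in> borel_measurable borel" using test_function_fourier_facts(5)[OF t] by auto
    have "fourier_distribution (regular_distribution Bq) \<phi> = (\<integral>x. Bq x * fourier \<phi> x \<partial>lborel)"
      unfolding fourier_distribution_def regular_distribution_def by (rule integral_completion) simp
    also have "\<dots> = \<i> / 4 * (sqrt (2 * pi) / pi)
      * (LINT k:{-k0<..<k0}|lebesgue. exp (\<i> * of_real (kappa k0 k * rM)) / of_real (kappa k0 k)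
        * plane_wave_transform k0 q k * \<phi> k)"
      unfolding Bq_def sine_substitution[OF t assms(1) plane_wave_transform_continuous[OF q], symmetric]
      by (rule born_paired_with_fourier[OF core t])
    also have "\<dots> = (LINT k:{-k0<..<k0}|lebesgue. \<i> / 4 * (sqrt (2 * pi) / pi)
      * (exp (\<i> * of_real (kappa k0 k * rM)) / of_real (kappa k0 k) * plane_wave_transform k0 q k * \<phi> k))"
      by (simp only: set_integral_mult_right)
    also have "\<dots> = (LINT x:{-k0<..<k0}|lebesgue. ?g x * \<phi> x)"
    proof -
      have "sqrt (2 * pi) = sqrt (2\<^sup>2 * (pi / 2))" by simp
      also have "\<dots> = 2 * sqrt (pi / 2)" by (simp only: real_sqrt_mult real_sqrt_abs abs_numeral)
      finally have "complex_of_real (sqrt (2 * pi) / pi) = 2 * of_real (sqrt (pi / 2)) / of_real pi" by simp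
      then have "\<i> / 4 * complex_of_real (sqrt (2 * pi) / pi) * (e / \<kappa> * Q * p)
        = of_real (sqrt (pi / 2)) * (\<i> * e / \<kappa>) * (Q / (2 * pi)) * p" for e \<kappa> Q p
        by (simp only:) (simp add: divide_simps)
      then show ?thesis by (simp only:)
    qed
    finally show ?thesis .
  qed
  ultimately show ?thesis
    unfolding born far given_by_on_def by blast
qed

end
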